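(* There is a set $X \subseteq S_\infty \subseteq \omega^\omega$ which is a (lightface) $\Pi^0_1$ subset of $\omega^\omega$, and which freely generates a subgroup $\mathcal{G} = \langle X \rangle \leq S_\infty$ such that $\mathcal{G}$ is a (lightface) $\Sigma^0_2$ subset of $\omega^\omega$ and $\mathcal{G}$ is a maximal cofinitary group.
   Context: $\omega$ is the set of natural numbers and $\omega^\omega$ is the Baire space of all functions $\omega \to \omega$. $S_\infty$ is the group (under composition) of all permutations of $\omega$, viewed as a subset of $\omega^\omega$, with identity $\mathrm{id}_\omega$. An element $g \in S_\infty \setminus \{\mathrm{id}_\omega\}$ is called cofinitary if it has only finitely many fixed points. A subgroup $G \leq S_\infty$ is a cofinitary group if every $g \in G \setminus \{\mathrm{id}_\omega\}$ is cofinitary. A cofinitary group is maximal (an mcg) if it is not strictly contained in any cofinitary group. $\langle X\rangle$ denotes the subgroup generated by $X$; $X$ freely generates $\langle X \rangle$ if the canonical homomorphism from the free group on $X$ to $\langle X\rangle$ is an isomorphism. $\Pi^0_1$ and $\Sigma^0_2$ denote the lightface (effective) pointclasses of the arithmetical hierarchy for subsets of $\omega^\omega$: $A$ is $\Pi^0_1$ if there is a computable set $R \subseteq \omega^{<\omega}$ with $A = \{f : (\forall k)\, f\upharpoonright k \in R\}$, and $A$ is $\Sigma^0_2$ if there is a computable $R \subseteq \omega \times \omega^{<\omega}$ with $A = \{f : (\exists n)(\forall k)\, (n, f\upharpoonright k) \in R\}$. *)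

theory Defs
  imports "HOL-Algebra.Bij" "HOL-Algebra.Generated_Groups" "HOL-Library.Nat_Bijection"
begin

section \<open>Computability\<close>

text \<open>
  Kleene's partial recursive functions.  Programs carry no arity annotation: a program is run on an
  argument list, and once the length of that list is fixed the number of arguments of every
  subprogram is determined, so that programs run on lists of length \<open>k\<close> compute exactly the
  \<open>k\<close>-ary partial recursive functions.
\<close>

datatype prog =
    Zero
  | Succ
  | Proj nat
  | Comp prog "prog list"
  | PrimRec prog prog
  | Mu prog

inductive computes :: "prog \<Rightarrow> nat list \<Rightarrow> nat \<Rightarrow> bool" where
  zero: "computes Zero xs 0"
| succ: "computes Succ [x] (Suc x)"
| proj: "i < length xs \<Longrightarrow> computes (Proj i) xs (xs ! i)"
| comp: "list_all2 (\<lambda>g y. computes g xs y) gs ys \<Longrightarrow> computes f ys z \<Longrightarrow> computes (Comp f gs) xs z"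
| rec_zero: "computes f xs y \<Longrightarrow> computes (PrimRec f g) (0 # xs) y"
| rec_Suc: "computes (PrimRec f g) (n # xs) y \<Longrightarrow> computes g (n # y # xs) z
    \<Longrightarrow> computes (PrimRec f g) (Suc n # xs) z"
| mu: "computes f (n # xs) 0 \<Longrightarrow> (\<forall>m<n. \<exists>y. y \<noteq> 0 \<and> computes f (m # xs) y)
    \<Longrightarrow> computes (Mu f) xs n"

lemma computes_deterministic: "computes p xs y \<Longrightarrow> computes p xs z \<Longrightarrow> y = z"
proof (induction arbitrary: z rule: computes.induct)
  case (zero xs)
  from zero.prems show ?case by cases simp
next
  case (succ x)
  from succ.prems show ?case by cases simp
next
  case (proj i xs)
  from proj.prems show ?case by cases simp
next
  case (comp xs gs ys f w)
  from comp.prems obtain ys' where ys': "list_all2 (\<lambda>g y. computes g xs y) gs ys'" "computes f ys' z"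
    by cases (rule that)
  have "ys = ys'"
  proof (rule nth_equalityI)
    show "length ys = length ys'"
      using list_all2_lengthD[OF comp.IH(1)] list_all2_lengthD[OF ys'(1)] by argo
    fix i assume "i < length ys"
    moreover from this have "i < length gs"
      using list_all2_lengthD[OF comp.IH(1)] by argo
    ultimately show "ys ! i = ys' ! i"
      using list_all2_nthD[OF comp.IH(1), of i] list_all2_nthD[OF ys'(1), of i] by blast
  qed
  then show ?case using comp.IH(2) ys'(2) by simp
next
  case (rec_zero f xs y g)
  from rec_zero.prems have "computes f xs z" by cases
  then show ?case by (rule rec_zero.IH)
next
  case (rec_Suc f g n xs y w)
  from rec_Suc.prems obtain y' where "computes (PrimRec f g) (n # xs) y'" "computes g (n # y' # xs) z"
    by cases (rule that)
  then show ?case using rec_Suc.IH by metis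
next
  case (mu f n xs)
  from mu.prems have z: "computes f (z # xs) 0 \<and> (\<forall>m<z. \<exists>y. y \<noteq> 0 \<and> computes f (m # xs) y)"
    by cases (rule conjI)
  have "\<not> z < n" using mu.IH(2) z by blast
  moreover have "\<not> n < z" using mu.IH(1) z by blast
  ultimately show ?case by simp
qed

definition computable_set :: "nat set \<Rightarrow> bool" where
  "computable_set A \<longleftrightarrow> (\<exists>p. \<forall>x. computes p [x] (if x \<in> A then 1 else 0))"

text \<open>
  Finite sequences are coded by the (effective, bijective) coding \<^const>\<open>list_encode\<close>, pairs by
  Cantor's pairing function \<^const>\<open>prod_encode\<close>.
\<close>

definition computable_seqs :: "nat list set \<Rightarrow> bool" where
  "computable_seqs R \<longleftrightarrow> computable_set (list_encode ` R)"

definition computable_nat_seqs :: "(nat \<times> nat list) set \<Rightarrow> bool" where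
  "computable_nat_seqs R \<longleftrightarrow> computable_set ((\<lambda>(n, s). prod_encode (n, list_encode s)) ` R)"


section \<open>Lightface pointclasses\<close>

abbreviation initial_segment :: "(nat \<Rightarrow> nat) \<Rightarrow> nat \<Rightarrow> nat list" where
  "initial_segment f k \<equiv> map f [0..<k]"

definition lightface_Pi01 :: "(nat \<Rightarrow> nat) set \<Rightarrow> bool" where
  "lightface_Pi01 A \<longleftrightarrow>
    (\<exists>R. computable_seqs R \<and> A = {f. \<forall>k. initial_segment f k \<in> R})"

definition lightface_Sigma02 :: "(nat \<Rightarrow> nat) set \<Rightarrow> bool" where
  "lightface_Sigma02 A \<longleftrightarrow>
    (\<exists>R. computable_nat_seqs R \<and> A = {f. \<exists>n. \<forall>k. (n, initial_segment f k) \<in> R})"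


section \<open>Free groups\<close>

text \<open>
  The free group on \<open>X\<close> consists of the reduced words over \<open>X\<close>.  The letter \<open>(True, x)\<close> stands
  for \<open>x\<close>, and \<open>(False, x)\<close> for its formal inverse.
\<close>

type_synonym 'a word = "(bool \<times> 'a) list"

definition cancels :: "bool \<times> 'a \<Rightarrow> bool \<times> 'a \<Rightarrow> bool" where
  "cancels a b \<longleftrightarrow> snd a = snd b \<and> fst a \<noteq> fst b"

definition reduced :: "'a word \<Rightarrow> bool" where
  "reduced w \<longleftrightarrow> successively (\<lambda>a b. \<not> cancels a b) w"

text \<open>\<open>push a w\<close> is the reduced form of \<open>a # w\<close>, for reduced \<open>w\<close>.\<close>

fun push :: "bool \<times> 'a \<Rightarrow> 'a word \<Rightarrow> 'a word" where
  "push a [] = [a]"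
| "push a (b # w) = (if cancels a b then w else a # b # w)"

definition free_group :: "'a set \<Rightarrow> 'a word monoid" where
  "free_group X =
    \<lparr>carrier = {w. w \<in> lists (UNIV \<times> X) \<and> reduced w},
     mult = (\<lambda>v w. foldr push v w),
     one = []\<rparr>"

definition word_value :: "('a, 'b) monoid_scheme \<Rightarrow> 'a word \<Rightarrow> 'a" where
  "word_value G w = foldr (\<lambda>(b, x) y. (if b then x else inv\<^bsub>G\<^esub> x) \<otimes>\<^bsub>G\<^esub> y) w \<one>\<^bsub>G\<^esub>"

definition freely_generates :: "('a, 'b) monoid_scheme \<Rightarrow> 'a set \<Rightarrow> bool" where
  "freely_generates G X \<longleftrightarrow> word_value G \<in> iso (free_group X) (G\<lparr>carrier := generate G X\<rparr>)"

lemma reduced_Nil [simp]: "reduced []"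
  by (simp add: reduced_def)

lemma reduced_push: "reduced w \<Longrightarrow> reduced (push a w)"
  by (cases w) (auto simp: reduced_def successively_Cons)

lemma reduced_foldr_push: "reduced w \<Longrightarrow> reduced (foldr push v w)"
  by (induction v) (auto intro: reduced_push)

lemma foldr_push_reduced_Nil: "reduced v \<Longrightarrow> foldr push v [] = v"
proof (induction v)
  case (Cons a v)
  then have "foldr push v [] = v" by (auto simp: reduced_def successively_Cons)
  with Cons.prems show ?case by (cases v) (auto simp: reduced_def)
qed simp

lemma push_push:
  assumes "reduced w" "cancels a b"
  shows "push a (push b w) = w"
proof (cases w)
  case Nil
  with assms(2) show ?thesis by simp
next
  case (Cons c v)
  show ?thesis
  proof (cases "cancels b c")
    case True
    with assms(2) have "a = c" by (auto simp: cancels_def prod_eq_iff)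
    with True Cons assms(1) show ?thesis by (cases v) (auto simp: reduced_def)
  next
    case False
    with Cons assms(2) show ?thesis by simp
  qed
qed

lemma foldr_push_push: "reduced w \<Longrightarrow> foldr push (push a v) w = push a (foldr push v w)"
  by (cases v) (auto simp: push_push reduced_foldr_push)

lemma foldr_push_assoc:
  "reduced w \<Longrightarrow> foldr push (foldr push u v) w = foldr push u (foldr push v w)"
  by (induction u) (auto simp: foldr_push_push)

lemma push_in_lists: "a \<in> A \<Longrightarrow> w \<in> lists A \<Longrightarrow> push a w \<in> lists A"
  by (cases w) auto

lemma foldr_push_in_lists: "v \<in> lists A \<Longrightarrow> w \<in> lists A \<Longrightarrow> foldr push v w \<in> lists A"
proof (induction v)
  case (Cons a v)
  then have "a \<in> A" "foldr push v w \<in> lists A" by auto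
  then show ?case using push_in_lists by simp
qed simp

lemma left_inverse_exists:
  "w \<in> lists (UNIV \<times> X) \<Longrightarrow> reduced w \<Longrightarrow>
    \<exists>v. v \<in> lists (UNIV \<times> X) \<and> reduced v \<and> foldr push v w = []"
proof (induction w)
  case Nil
  then show ?case by (auto intro!: exI[of _ "[]"])
next
  case (Cons a w)
  have "reduced w" "w \<in> lists (UNIV \<times> X)"
    using Cons.prems by (auto simp: reduced_def successively_Cons)
  then obtain v where v: "v \<in> lists (UNIV \<times> X)" "reduced v" "foldr push v w = []"
    using Cons.IH by blast
  let ?a' = "(\<not> fst a, snd a)"
  let ?v = "foldr push v [?a']"
  have a': "?a' \<in> UNIV \<times> X" using Cons.prems(1) by auto
  have "?v \<in> lists (UNIV \<times> X)" using v(1) a' by (intro foldr_push_in_lists) auto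
  moreover have "reduced ?v" by (rule reduced_foldr_push) (simp add: reduced_def)
  moreover have "foldr push ?v (a # w) = []"
    using Cons.prems(2) v(3) by (simp add: foldr_push_assoc cancels_def)
  ultimately show ?case by blast
qed

lemma group_free_group: "group (free_group X)"
proof (rule groupI)
  fix u v assume "u \<in> carrier (free_group X)" "v \<in> carrier (free_group X)"
  then show "u \<otimes>\<^bsub>free_group X\<^esub> v \<in> carrier (free_group X)"
    using foldr_push_in_lists[of u "UNIV \<times> X" v] reduced_foldr_push[of v u]
    by (simp add: free_group_def del: in_lists_conv_set)
next
  fix w assume "w \<in> carrier (free_group X)"
  then show "\<exists>v\<in>carrier (free_group X). v \<otimes>\<^bsub>free_group X\<^esub> w = \<one>\<^bsub>free_group X\<^esub>"
    using left_inverse_exists[of w X] by (auto simp: free_group_def simp del: in_lists_conv_set)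
qed (auto simp: free_group_def foldr_push_assoc)

context group
begin

lemma word_value_closed:
  assumes "X \<subseteq> carrier G" "w \<in> lists (UNIV \<times> X)"
  shows "word_value G w \<in> generate G X"
  using assms(2)
proof (induction w rule: lists.induct)
  case Nil
  show ?case by (simp add: word_value_def generate.one)
next
  case (Cons a w)
  obtain b x where "a = (b, x)" by (cases a)
  moreover from this have "(if b then x else inv x) \<in> generate G X"
    using Cons.hyps by (simp add: generate.incl generate.inv)
  ultimately show ?case
    using Cons.IH by (cases b) (simp_all add: word_value_def generate.eng)
qed

lemma word_value_push:
  assumes "X \<subseteq> carrier G" "a \<in> UNIV \<times> X" "w \<in> lists (UNIV \<times> X)"
  shows "word_value G (push a w) = word_value G [a] \<otimes> word_value G w"
proof (cases w)
  case Nil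
  have "word_value G [a] \<in> carrier G"
    using word_value_closed[OF assms(1), of "[a]"] assms generate_in_carrier by auto
  with Nil show ?thesis by (simp add: word_value_def)
next
  case (Cons b v)
  obtain c x where a: "a = (c, x)" by (cases a)
  obtain d y where b: "b = (d, y)" by (cases b)
  have "x \<in> carrier G" "y \<in> carrier G" using assms a b Cons by auto
  moreover have "word_value G v \<in> carrier G"
    using word_value_closed[OF assms(1), of v] assms Cons generate_in_carrier by auto
  moreover from calculation have
    "x \<otimes> (inv x \<otimes> word_value G v) = word_value G v"
    "inv x \<otimes> (x \<otimes> word_value G v) = word_value G v"
    by (simp_all flip: m_assoc)
  ultimately show ?thesis
    using a b Cons by (auto simp: word_value_def cancels_def)
qed

lemma word_value_hom:
  assumes "X \<subseteq> carrier G"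
  shows "word_value G \<in> hom (free_group X) (G\<lparr>carrier := generate G X\<rparr>)"
proof (rule homI)
  fix u v
  assume u: "u \<in> carrier (free_group X)" and v: "v \<in> carrier (free_group X)"
  have "word_value G (foldr push u v) = word_value G u \<otimes> word_value G v"
    if "u \<in> lists (UNIV \<times> X)" "v \<in> lists (UNIV \<times> X)" for u v
    using that
  proof (induction u rule: list.induct)
    case Nil
    then show ?case
      using word_value_closed[OF assms, of v] generate_in_carrier[OF assms]
      by (simp add: word_value_def)
  next
    case (Cons a u)
    have closed: "word_value G w \<in> carrier G" if "w \<in> lists (UNIV \<times> X)" for w
      using word_value_closed[OF assms that] generate_in_carrier[OF assms] by simp
    have au: "a \<in> UNIV \<times> X" "u \<in> lists (UNIV \<times> X)" and vl: "v \<in> lists (UNIV \<times> X)"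
      using Cons.prems by auto
    obtain c x where a: "a = (c, x)" by (cases a)
    have "word_value G (a # u) = word_value G [a] \<otimes> word_value G u"
      using a au assms by (auto simp: word_value_def)
    moreover have "word_value G [a] \<in> carrier G" using au by (intro closed) auto
    moreover have IH: "word_value G (foldr push u v) = word_value G u \<otimes> word_value G v"
      using Cons.IH au(2) vl by blast
    ultimately show ?case
      using word_value_push[OF assms au(1) foldr_push_in_lists[OF au(2) vl]]
        IH closed[OF au(2)] closed[OF vl]
      by (simp add: m_assoc)
  qed
  with u v show "word_value G (u \<otimes>\<^bsub>free_group X\<^esub> v)
      = word_value G u \<otimes>\<^bsub>G\<lparr>carrier := generate G X\<rparr>\<^esub> word_value G v"
    by (simp add: free_group_def)
qed (use word_value_closed[OF assms] in \<open>auto simp: free_group_def\<close>)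

end


section \<open>Cofinitary groups\<close>

abbreviation S_infinity :: "(nat \<Rightarrow> nat) monoid" where
  "S_infinity \<equiv> BijGroup UNIV"

lemma S_infinity_simps:
  "carrier S_infinity = {f. bij f}"
  "bij f \<Longrightarrow> bij g \<Longrightarrow> f \<otimes>\<^bsub>S_infinity\<^esub> g = f \<circ> g"
  "\<one>\<^bsub>S_infinity\<^esub> = id"
  by (simp_all add: BijGroup_def Bij_def compose_def comp_def id_def restrict_UNIV)

definition cofinitary :: "(nat \<Rightarrow> nat) \<Rightarrow> bool" where
  "cofinitary g \<longleftrightarrow> g \<in> carrier S_infinity - {id} \<and> finite {n. g n = n}"

definition cofinitary_group :: "(nat \<Rightarrow> nat) set \<Rightarrow> bool" where
  "cofinitary_group G \<longleftrightarrow> subgroup G S_infinity \<and> (\<forall>g \<in> G - {id}. cofinitary g)"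

definition maximal_cofinitary_group :: "(nat \<Rightarrow> nat) set \<Rightarrow> bool" where
  "maximal_cofinitary_group G \<longleftrightarrow>
    cofinitary_group G \<and> \<not> (\<exists>H. cofinitary_group H \<and> G \<subset> H)"

end

theory Submission
  imports Defs
begin

text \<open>
  There is one generator \<open>chi b\<close> for every \<open>b :: nat \<Rightarrow> bool\<close>.  By default \<open>chi b\<close> and its inverse
  send a number \<open>v\<close> to children \<open>D b v\<close>, \<open>E b v\<close>: codes containing \<open>v\<close> and an initial segment of
  \<open>b\<close> (its label).  So walking along a reduced word climbs a forest in which every step can be read
  off.  The even bits of \<open>b\<close> from position 2 on claim values \<open>g u = m\<close> of a permutation \<open>g\<close>.  For
  each level \<open>k\<close> they determine at most one candidate pair \<open>(u, m)\<close>, where \<open>u\<close> is a root coding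
  \<open>k\<close> bits of the claims.  The odd bits select a single class of candidates, and candidates of that
  class are granted: \<open>chi b u = m\<close>.

  A cyclically reduced word with many fixed points would yield walks which are closed by grants.  The
  roots grow so fast that such a walk has a grant whose target lies on the default path above its own
  source.  Candidates of this kind form a chain for the relation \<open>prec\<close>, and since the class fixes the
  depth in that relation, only finitely many occur.  Conversely, let \<open>g\<close> be any permutation.  If some
  class contains infinitely many of its candidates, a generator granting that class agrees with \<open>g\<close>
  infinitely often.  Otherwise every depth occurs for finitely many candidates only, so by Koenig's lemma
  there is an infinite chain, whose labels converge to generators that spell a word agreeing with
  \<open>g\<close> infinitely often.  Either way a cofinitary group containing \<open>g\<close> and all generators forces
  \<open>g\<close> to be a product of generators and their inverses.

  For the complexity bounds one must recover \<open>b\<close> from the values of a group element within a compact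
  set.  The bits of \<open>b\<close> are bounded but its first claims are not.  Numbers congruent to 3 modulo 4 are
  roots at which the value of a word exceeds the first claim of a chosen letter.  Thus the group is the
  union of the sets \<open>FG n\<close> in which the first claims are bounded by a fixed function of the values, each
  of them is effectively closed uniformly in \<open>n\<close> by compactness of the space of bits, and one of
  them is the set of generators.
\<close>

type_synonym bits = "nat \<Rightarrow> bool"

section \<open>Closure properties of the computable functions\<close>

definition rn :: "nat \<Rightarrow> (nat list \<Rightarrow> nat) \<Rightarrow> bool" where
  "rn k F \<longleftrightarrow> (\<exists>p. \<forall>xs. length xs = k \<longrightarrow> computes p xs (F xs))"

definition urec :: "(nat \<Rightarrow> nat) \<Rightarrow> bool" where
  "urec f \<longleftrightarrow> rn 1 (\<lambda>xs. f (xs ! 0))"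

definition rec2 :: "(nat \<Rightarrow> nat \<Rightarrow> nat) \<Rightarrow> bool" where
  "rec2 f \<longleftrightarrow> rn 2 (\<lambda>xs. f (xs ! 0) (xs ! 1))"

lemma rn_proj: "i < k \<Longrightarrow> rn k (\<lambda>xs. xs ! i)"
  unfolding rn_def by (rule exI[of _ "Proj i"]) (auto intro: computes.proj)

lemma rn_comp1:
  assumes "urec f" "rn k g"
  shows "rn k (\<lambda>xs. f (g xs))"
proof -
  obtain p q where p: "\<And>xs. length xs = 1 \<Longrightarrow> computes p xs (f (xs ! 0))"
    and q: "\<And>xs. length xs = k \<Longrightarrow> computes q xs (g xs)"
    using assms unfolding urec_def rn_def by auto
  have "computes (Comp p [q]) xs (f (g xs))" if "length xs = k" for xs
    using p[of "[g xs]"] q[OF that] by (intro computes.comp[of _ _ "[g xs]"]) auto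
  then show ?thesis unfolding rn_def by blast
qed

lemma rn_comp2:
  assumes "rec2 f" "rn k g" "rn k h"
  shows "rn k (\<lambda>xs. f (g xs) (h xs))"
proof -
  obtain p q r where p: "\<And>xs. length xs = 2 \<Longrightarrow> computes p xs (f (xs ! 0) (xs ! 1))"
    and q: "\<And>xs. length xs = k \<Longrightarrow> computes q xs (g xs)"
    and r: "\<And>xs. length xs = k \<Longrightarrow> computes r xs (h xs)"
    using assms unfolding rec2_def rn_def by blast
  have "computes (Comp p [q, r]) xs (f (g xs) (h xs))" if "length xs = k" for xs
    using p[of "[g xs, h xs]"] q[OF that] r[OF that]
    by (intro computes.comp[of _ _ "[g xs, h xs]"]) auto
  then show ?thesis unfolding rn_def by blast
qed

lemma urec_Suc: "urec Suc"
  unfolding urec_def rn_def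
proof (intro exI[of _ Succ] allI impI)
  fix xs :: "nat list" assume "length xs = 1"
  then obtain x where "xs = [x]" by (cases xs) auto
  then show "computes Succ xs (Suc (xs ! 0))" by (auto intro: computes.succ)
qed

lemma rn_const: "rn k (\<lambda>xs. c)"
proof (induction c)
  case 0
  show ?case unfolding rn_def by (rule exI[of _ Zero]) (auto intro: computes.zero)
next
  case (Suc c)
  show ?case by (rule rn_comp1[OF urec_Suc Suc])
qed

lemma rec2_rec_nat:
  assumes "urec f" "rn 3 (\<lambda>xs. g (xs ! 0) (xs ! 1) (xs ! 2))"
  shows "rec2 (\<lambda>n y. rec_nat (f y) (\<lambda>n r. g n r y) n)"
proof -
  obtain p q where p: "\<And>xs. length xs = 1 \<Longrightarrow> computes p xs (f (xs ! 0))"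
    and q: "\<And>xs. length xs = 3 \<Longrightarrow> computes q xs (g (xs ! 0) (xs ! 1) (xs ! 2))"
    using assms unfolding urec_def rn_def by auto
  have *: "computes (PrimRec p q) [n, y] (rec_nat (f y) (\<lambda>n r. g n r y) n)" for n y
  proof (induction n)
    case 0
    show ?case using p[of "[y]"] by (auto intro: computes.rec_zero)
  next
    case (Suc n)
    show ?case
      using q[of "[n, rec_nat (f y) (\<lambda>n r. g n r y) n, y]"] Suc
      by (auto intro: computes.rec_Suc)
  qed
  have "computes (PrimRec p q) xs (rec_nat (f (xs ! 1)) (\<lambda>n r. g n r (xs ! 1)) (xs ! 0))"
    if "length xs = 2" for xs
  proof -
    have "xs = [xs ! 0, xs ! 1]"
      using that by (auto simp: list_eq_iff_nth_eq less_Suc_eq numeral_2_eq_2)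
    with *[of "xs ! 0" "xs ! 1"] show ?thesis by metis
  qed
  then show ?thesis unfolding rec2_def rn_def by blast
qed

lemma urec_diag: "rec2 f \<Longrightarrow> urec g \<Longrightarrow> urec h \<Longrightarrow> urec (\<lambda>z. f (g z) (h z))"
  unfolding urec_def by (rule rn_comp2)

lemma urec_comp: "urec f \<Longrightarrow> urec g \<Longrightarrow> urec (\<lambda>z. f (g z))"
  using rn_comp1[of f 1 "\<lambda>xs. g (xs ! 0)"] unfolding urec_def by simp

lemma urec_id: "urec (\<lambda>z. z)"
  unfolding urec_def by (rule rn_proj) simp

lemma urec_const: "urec (\<lambda>z. c)"
  unfolding urec_def by (rule rn_const)

lemma rec2_cong: "rec2 f \<Longrightarrow> (\<And>x y. f x y = g x y) \<Longrightarrow> rec2 g"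
  by (subgoal_tac "f = g") auto

lemma rec2_swap: "rec2 f \<Longrightarrow> rec2 (\<lambda>x y. f y x)"
  using rn_comp2[of f 2 "\<lambda>xs. xs ! 1" "\<lambda>xs. xs ! 0"] unfolding rec2_def by (simp add: rn_proj)

lemma rec2_add: "rec2 (+)"
proof (rule rec2_cong)
  show "rec2 (\<lambda>n y. rec_nat y (\<lambda>n r. Suc r) n)"
    by (rule rec2_rec_nat[OF urec_id]) (rule rn_comp1[OF urec_Suc rn_proj], simp)
  show "rec_nat y (\<lambda>n r. Suc r) x = x + y" for x y by (induction x) auto
qed

lemma rec2_mult: "rec2 (*)"
proof (rule rec2_cong)
  show "rec2 (\<lambda>n y. rec_nat 0 (\<lambda>n r. r + y) n)"
    by (rule rec2_rec_nat[OF urec_const]) (rule rn_comp2[OF rec2_add rn_proj rn_proj], simp_all)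
  show "rec_nat 0 (\<lambda>n r. r + y) x = x * y" for x y :: nat by (induction x) auto
qed

text \<open>Truncated subtraction iterates the predecessor. The recursion runs on the subtrahend, so
  the arguments are swapped at the end.\<close>

lemma rec2_diff: "rec2 (-)"
proof -
  have "rec2 (\<lambda>n y. rec_nat 0 (\<lambda>n r. n) n)"
    by (rule rec2_rec_nat[OF urec_const]) (rule rn_proj, simp)
  then have pred: "urec (\<lambda>z. rec_nat 0 (\<lambda>n r. n) z)"
    using urec_diag[OF _ urec_id urec_id] by blast
  have "rec2 (\<lambda>n y. rec_nat y (\<lambda>n r. rec_nat 0 (\<lambda>n r. n) r) n)"
    by (rule rec2_rec_nat[OF urec_id]) (rule rn_comp1[OF pred rn_proj], simp)
  moreover have "rec_nat y (\<lambda>n r. rec_nat 0 (\<lambda>n r. n) r) n = y - n" for n y :: nat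
  proof (induction n)
    case (Suc n)
    have "rec_nat 0 (\<lambda>n r. n) r = r - 1" for r :: nat by (cases r) auto
    with Suc show ?case by simp
  qed simp
  ultimately have "rec2 (\<lambda>n y. y - n)" by simp
  then show ?thesis using rec2_swap by blast
qed

lemma urec_triangle: "urec triangle"
proof -
  have "rec2 (\<lambda>n y. rec_nat 0 (\<lambda>n r. r + Suc n) n)"
    by (rule rec2_rec_nat[OF urec_const])
      (rule rn_comp2[OF rec2_add rn_proj rn_comp1[OF urec_Suc rn_proj]], simp_all)
  moreover have "rec_nat 0 (\<lambda>n r. r + Suc n) x = triangle x" for x
    by (induction x) (auto simp: triangle_Suc)
  ultimately have "rec2 (\<lambda>n y. triangle n)" by simp
  then show ?thesis using urec_diag[OF _ urec_id urec_id] by blast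
qed

lemma rec2_prod_encode: "rec2 (\<lambda>x y. prod_encode (x, y))"
  unfolding prod_encode_def rec2_def
  by (simp, intro rn_comp2[OF rec2_add] rn_comp1[OF urec_triangle] rn_proj) simp_all

section \<open>Cantor's pairing function and its computable inverses\<close>

definition pe :: "nat \<Rightarrow> nat \<Rightarrow> nat" where "pe x y = prod_encode (x, y)"
definition pfst :: "nat \<Rightarrow> nat" where "pfst z = fst (prod_decode z)"
definition psnd :: "nat \<Rightarrow> nat" where "psnd z = snd (prod_decode z)"

lemma pfst_pe [simp]: "pfst (pe x y) = x" and psnd_pe [simp]: "psnd (pe x y) = y"
  by (simp_all add: pfst_def psnd_def pe_def)

lemma pe_collapse [simp]: "pe (pfst z) (psnd z) = z"
  by (simp add: pfst_def psnd_def pe_def)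

lemma pe_eq_iff [simp]: "pe a b = pe c d \<longleftrightarrow> a = c \<and> b = d"
  by (auto simp: pe_def)

text \<open>The index of the diagonal on which the pair coded by \<open>z\<close> lies. The
  truncated differences add 1 exactly when the next triangular number is reached, so that decoding
  becomes primitive recursive.\<close>

definition troot :: "nat \<Rightarrow> nat" where
  "troot z = rec_nat 0 (\<lambda>n r. r + (1 - (triangle (Suc r) - Suc n))) z"

lemma troot: "triangle (troot z) \<le> z \<and> z < triangle (Suc (troot z))"
proof (induction z)
  case (Suc z)
  let ?r = "troot z"
  have st: "troot (Suc z) = ?r + (1 - (triangle (Suc ?r) - Suc z))" by (simp add: troot_def)
  show ?case
  proof (cases "triangle (Suc ?r) \<le> Suc z")
    case True
    with st have "troot (Suc z) = Suc ?r" by simp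
    with True Suc show ?thesis by simp
  next
    case False
    with st have "troot (Suc z) = ?r" by simp
    with False Suc show ?thesis by simp
  qed
qed (simp add: troot_def)

lemma pe_mono: "a \<le> c \<Longrightarrow> b \<le> d \<Longrightarrow> pe a b \<le> pe c d"
proof -
  have mono: "triangle m \<le> triangle n" if "m \<le> n" for m n
    using that by (induction rule: dec_induct) auto
  show "a \<le> c \<Longrightarrow> b \<le> d \<Longrightarrow> pe a b \<le> pe c d"
    unfolding pe_def prod_encode_def using mono[of "a + b" "c + d"] by simp
qed

lemma troot_pe: "troot (pe a b) = a + b"
proof (rule ccontr)
  have mono: "triangle m \<le> triangle n" if "m \<le> n" for m n
    using that by (induction rule: dec_induct) auto
  have z: "triangle (a + b) \<le> pe a b" "pe a b < triangle (Suc (a + b))"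
    by (simp_all add: pe_def prod_encode_def)
  assume "troot (pe a b) \<noteq> a + b"
  then consider "Suc (troot (pe a b)) \<le> a + b" | "Suc (a + b) \<le> troot (pe a b)" by linarith
  then show False
  proof cases
    case 1
    from mono[OF this] z troot[of "pe a b"] show False by linarith
  next
    case 2
    from mono[OF this] z troot[of "pe a b"] show False by linarith
  qed
qed

lemma pfst_alt: "pfst z = z - triangle (troot z)"
proof -
  have "a = pe a b - triangle (troot (pe a b))" for a b
    unfolding troot_pe by (simp add: pe_def prod_encode_def)
  from this[of "pfst z" "psnd z"] show ?thesis by simp
qed

lemma psnd_alt: "psnd z = troot z - pfst z"
  using troot_pe[of "pfst z" "psnd z"] by simp

lemma urec_troot: "urec troot"
proof -
  have "rec2 (\<lambda>n y. rec_nat 0 (\<lambda>n r. r + (1 - (triangle (Suc r) - Suc n))) n)"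
    by (rule rec2_rec_nat[OF urec_const],
        intro rn_comp2[OF rec2_add] rn_comp2[OF rec2_diff] rn_comp1[OF urec_triangle]
          rn_comp1[OF urec_Suc] rn_const rn_proj) simp_all
  then have "rec2 (\<lambda>n y. troot n)" by (simp add: troot_def)
  then show ?thesis using urec_diag[OF _ urec_id urec_id] by blast
qed

lemma urec_pfst: "urec pfst"
proof -
  have "urec (\<lambda>z. z - triangle (troot z))"
    by (rule urec_diag[OF rec2_diff urec_id urec_comp[OF urec_triangle urec_troot]])
  then show ?thesis by (simp add: pfst_alt[symmetric])
qed

lemma urec_psnd: "urec psnd"
proof -
  have "urec (\<lambda>z. troot z - pfst z)"
    by (rule urec_diag[OF rec2_diff urec_troot urec_pfst])
  then show ?thesis by (simp add: psnd_alt[symmetric])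
qed

text \<open>
  From here on an environment of several variables is a single number, decomposed by \<open>pfst\<close> and
  \<open>psnd\<close>; a binder pushes its variable in front of the environment.
\<close>

definition dec :: "bits \<Rightarrow> bool" where
  "dec P \<longleftrightarrow> urec (\<lambda>z. of_bool (P z))"

named_theorems rec_intros

lemma r_id [rec_intros]: "urec (\<lambda>z. z)" by (rule urec_id)
lemma r_const [rec_intros]: "urec (\<lambda>z. c)" by (rule urec_const)
lemma r_pfst [rec_intros]: "urec g \<Longrightarrow> urec (\<lambda>z. pfst (g z))" by (rule urec_comp[OF urec_pfst])
lemma r_psnd [rec_intros]: "urec g \<Longrightarrow> urec (\<lambda>z. psnd (g z))" by (rule urec_comp[OF urec_psnd])
lemma r_Suc [rec_intros]: "urec g \<Longrightarrow> urec (\<lambda>z. Suc (g z))" by (rule urec_comp[OF urec_Suc])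
lemma r_add [rec_intros]: "urec g \<Longrightarrow> urec h \<Longrightarrow> urec (\<lambda>z. g z + h z)"
  by (rule urec_diag[OF rec2_add])
lemma r_mult [rec_intros]: "urec g \<Longrightarrow> urec h \<Longrightarrow> urec (\<lambda>z. g z * h z)"
  by (rule urec_diag[OF rec2_mult])
lemma r_diff [rec_intros]: "urec g \<Longrightarrow> urec h \<Longrightarrow> urec (\<lambda>z. g z - h z)"
  by (rule urec_diag[OF rec2_diff])
lemma r_pe [rec_intros]: "urec g \<Longrightarrow> urec h \<Longrightarrow> urec (\<lambda>z. pe (g z) (h z))"
  unfolding pe_def by (rule urec_diag[OF rec2_prod_encode])

lemma r_rec [rec_intros]:
  assumes b: "urec b" and f: "urec f" and g: "urec (\<lambda>w. g (pfst w) (pfst (psnd w)) (psnd (psnd w)))"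
  shows "urec (\<lambda>z. rec_nat (f z) (\<lambda>n r. g n r z) (b z))"
proof -
  have "rn 3 (\<lambda>xs. (\<lambda>w. g (pfst w) (pfst (psnd w)) (psnd (psnd w)))
      (pe (xs ! 0) (pe (xs ! 1) (xs ! 2))))"
    unfolding pe_def by (intro rn_comp1[OF g] rn_comp2[OF rec2_prod_encode] rn_proj) simp_all
  then have "rec2 (\<lambda>n y. rec_nat (f y) (\<lambda>n r. g n r y) n)"
    using rec2_rec_nat[OF f, of g] by simp
  from urec_diag[OF this b urec_id] show ?thesis .
qed

lemma r_bool [rec_intros]: "dec P \<Longrightarrow> urec (\<lambda>z. of_bool (P z))" by (simp add: dec_def)

lemma urec_cong: "urec f \<Longrightarrow> (\<And>z. f z = g z) \<Longrightarrow> urec g"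
  by (subgoal_tac "f = g") auto

lemma dec_cong: "dec P \<Longrightarrow> (\<And>z. P z \<longleftrightarrow> Q z) \<Longrightarrow> dec Q"
  by (subgoal_tac "P = Q") auto

lemma d_zero: "urec f \<Longrightarrow> dec (\<lambda>z. f z = 0)"
  unfolding dec_def by (rule urec_cong[of "\<lambda>z. 1 - f z"], (intro rec_intros; assumption), auto)

lemma d_le [rec_intros]: "urec f \<Longrightarrow> urec g \<Longrightarrow> dec (\<lambda>z. f z \<le> g z)"
  by (rule dec_cong[OF d_zero[of "\<lambda>z. f z - g z"]], (intro rec_intros; assumption), auto)

lemma d_not [rec_intros]: "dec P \<Longrightarrow> dec (\<lambda>z. \<not> P z)"
  by (rule dec_cong[OF d_zero[of "\<lambda>z. of_bool (P z)"]], (simp add: dec_def), simp)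

lemma d_and [rec_intros]: "dec P \<Longrightarrow> dec Q \<Longrightarrow> dec (\<lambda>z. P z \<and> Q z)"
  unfolding dec_def
  by (rule urec_cong[of "\<lambda>z. of_bool (P z) * of_bool (Q z)"], rule r_mult, assumption, assumption, auto)

lemma d_or [rec_intros]: "dec P \<Longrightarrow> dec Q \<Longrightarrow> dec (\<lambda>z. P z \<or> Q z)"
  by (rule dec_cong[of "\<lambda>z. \<not> (\<not> P z \<and> \<not> Q z)"], (intro rec_intros; assumption), auto)

lemma d_imp [rec_intros]: "dec P \<Longrightarrow> dec Q \<Longrightarrow> dec (\<lambda>z. P z \<longrightarrow> Q z)"
  by (rule dec_cong[of "\<lambda>z. \<not> P z \<or> Q z"], (intro rec_intros; assumption), auto)

lemma d_iff [rec_intros]: "dec P \<Longrightarrow> dec Q \<Longrightarrow> dec (\<lambda>z. P z = Q z)"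
  by (rule dec_cong[of "\<lambda>z. (P z \<longrightarrow> Q z) \<and> (Q z \<longrightarrow> P z)"], (intro rec_intros; assumption), auto)

lemma d_less [rec_intros]: "urec f \<Longrightarrow> urec g \<Longrightarrow> dec (\<lambda>z. f z < g z)"
  by (rule dec_cong[of "\<lambda>z. Suc (f z) \<le> g z"], (intro rec_intros; assumption), auto)

lemma d_eq [rec_intros]: "urec f \<Longrightarrow> urec g \<Longrightarrow> dec (\<lambda>z. f z = g z)"
  by (rule dec_cong[of "\<lambda>z. f z \<le> g z \<and> g z \<le> f z"], (intro rec_intros; assumption), auto)

lemma d_const [rec_intros]: "dec (\<lambda>z. c)"
  unfolding dec_def by (rule r_const)

lemma d_comp: "dec P \<Longrightarrow> urec f \<Longrightarrow> dec (\<lambda>z. P (f z))"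
  unfolding dec_def by (rule urec_comp)

lemma r_if [rec_intros]: "dec P \<Longrightarrow> urec f \<Longrightarrow> urec g \<Longrightarrow> urec (\<lambda>z. if P z then f z else g z)"
  by (rule urec_cong[of "\<lambda>z. of_bool (P z) * f z + of_bool (\<not> P z) * g z"], (intro rec_intros; assumption), auto)

lemma d_if [rec_intros]: "dec P \<Longrightarrow> dec Q \<Longrightarrow> dec R \<Longrightarrow> dec (\<lambda>z. if P z then Q z else R z)"
  by (rule dec_cong[of "\<lambda>z. (P z \<longrightarrow> Q z) \<and> (\<not> P z \<longrightarrow> R z)"], (intro rec_intros; assumption), auto)

lemma r_sum [rec_intros]:
  assumes "urec b" "urec (\<lambda>w. f (pfst w) (psnd w))"
  shows "urec (\<lambda>z. \<Sum>i<b z. f i z)"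
proof (rule urec_cong)
  \<comment> \<open>The recursion puts the previous value between the index and the environment; it
    is skipped here.\<close>
  have *: "urec (\<lambda>w. (\<lambda>v. f (pfst v) (psnd v)) (pe (pfst w) (psnd (psnd w))))"
    by (rule urec_comp[OF assms(2)]) (intro rec_intros)
  show "urec (\<lambda>z. rec_nat 0 (\<lambda>n r. r + f n z) (b z))"
    by (intro rec_intros assms(1) *[simplified])
  have "rec_nat 0 (\<lambda>n r. r + f n z) m = (\<Sum>i<m. f i z)" for z m
    by (induction m) auto
  then show "rec_nat 0 (\<lambda>n r. r + f n z) (b z) = (\<Sum>i<b z. f i z)" for z .
qed

lemma d_ex_less [rec_intros]:
  assumes "urec b" "dec (\<lambda>w. P (pfst w) (psnd w))"
  shows "dec (\<lambda>z. \<exists>i<b z. P i z)"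
proof (rule dec_cong)
  show "dec (\<lambda>z. \<not> (\<Sum>i<b z. of_bool (P i z)) \<le> (0::nat))"
    by (intro rec_intros assms)
  show "(\<not> (\<Sum>i<b z. of_bool (P i z)) \<le> (0::nat)) \<longleftrightarrow> (\<exists>i<b z. P i z)" for z
    by (auto simp: sum_eq_0_iff)
qed

lemma d_all_less [rec_intros]:
  assumes "urec b" "dec (\<lambda>w. P (pfst w) (psnd w))"
  shows "dec (\<lambda>z. \<forall>i<b z. P i z)"
  by (rule dec_cong[of "\<lambda>z. \<not> (\<exists>i<b z. \<not> P i z)"], intro rec_intros assms, simp)

lemma d_ex_le [rec_intros]:
  assumes "urec b" "dec (\<lambda>w. P (pfst w) (psnd w))"
  shows "dec (\<lambda>z. \<exists>i\<le>b z. P i z)"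
  by (rule dec_cong[of "\<lambda>z. \<exists>i<Suc (b z). P i z"], intro rec_intros assms, simp add: less_Suc_eq_le)

lemma d_all_le [rec_intros]:
  assumes "urec b" "dec (\<lambda>w. P (pfst w) (psnd w))"
  shows "dec (\<lambda>z. \<forall>i\<le>b z. P i z)"
  by (rule dec_cong[of "\<lambda>z. \<forall>i<Suc (b z). P i z"], intro rec_intros assms, simp add: less_Suc_eq_le)

lemma r_funpow [rec_intros]:
  assumes "urec b" "urec (\<lambda>w. f (pfst w) (psnd w))" "urec g"
  shows "urec (\<lambda>z. ((\<lambda>y. f y z) ^^ b z) (g z))"
proof (rule urec_cong)
  have *: "urec (\<lambda>w. (\<lambda>v. f (pfst v) (psnd v)) (pe (pfst (psnd w)) (psnd (psnd w))))"
    by (rule urec_comp[OF assms(2)]) (intro rec_intros)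
  show "urec (\<lambda>z. rec_nat (g z) (\<lambda>n r. f r z) (b z))"
    by (rule r_rec[OF assms(1,3)]) (rule *[simplified])
  have "rec_nat (g z) (\<lambda>n r. f r z) m = ((\<lambda>y. f y z) ^^ m) (g z)" for z m
    by (induction m) auto
  then show "rec_nat (g z) (\<lambda>n r. f r z) (b z) = ((\<lambda>y. f y z) ^^ b z) (g z)" for z .
qed

lemma r_power [rec_intros]:
  assumes "urec f" "urec g"
  shows "urec (\<lambda>z. f z ^ g z)"
proof (rule urec_cong)
  show "urec (\<lambda>z. ((\<lambda>y. f z * y) ^^ g z) 1)"
    by (rule r_funpow[OF assms(2)]) (intro rec_intros urec_comp[OF assms(1)])+
  have "((\<lambda>y. a * y) ^^ m) 1 = a ^ m" for a m :: nat by (induction m) auto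
  then show "((\<lambda>y. f z * y) ^^ g z) 1 = f z ^ g z" for z .
qed

text \<open>The quotient counts the positive multiples of the divisor up to the dividend; the guard
  yields the value 0 for division by 0.\<close>

lemma r_div [rec_intros]:
  assumes "urec f" "urec g"
  shows "urec (\<lambda>z. f z div g z)"
proof (rule urec_cong)
  show "urec (\<lambda>z. \<Sum>i<f z. of_bool (0 < g z \<and> Suc i * g z \<le> f z))"
    by (rule r_sum[OF assms(1)]) (intro rec_intros urec_comp[OF assms(1)] urec_comp[OF assms(2)])
  have "(\<Sum>i<a. of_bool (0 < b \<and> Suc i * b \<le> a)) = a div b" for a b :: nat
  proof (cases "b = 0")
    case False
    have "{i. i < a \<and> Suc i * b \<le> a} = {..<a div b}"
    proof (rule Set.set_eqI, rule iffI)
      fix i assume "i \<in> {..<a div b}"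
      then have "Suc i \<le> a div b" by simp
      then have "Suc i * b \<le> a" using False by (simp add: less_eq_div_iff_mult_less_eq)
      moreover from this False have "i < a"
        by (metis Suc_le_eq dual_order.trans mult.right_neutral mult_le_mono2 One_nat_def not_gr_zero Suc_leI)
      ultimately show "i \<in> {i. i < a \<and> Suc i * b \<le> a}" by simp
    next
      fix i assume "i \<in> {i. i < a \<and> Suc i * b \<le> a}"
      then have "Suc i \<le> a div b" using False
        by (simp add: less_eq_div_iff_mult_less_eq del: mult_Suc)
      then show "i \<in> {..<a div b}" by simp
    qed
    moreover have "(\<Sum>i<a. of_bool (0 < b \<and> Suc i * b \<le> a)) = card {i. i < a \<and> Suc i * b \<le> a}"
      using False by (simp add: sum.If_cases of_bool_def Int_def del: mult_Suc)
    ultimately show ?thesis by simp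
  qed simp
  then show "(\<Sum>i<f z. of_bool (0 < g z \<and> Suc i * g z \<le> f z)) = f z div g z" for z .
qed

lemma r_mod [rec_intros]:
  assumes "urec f" "urec g"
  shows "urec (\<lambda>z. f z mod g z)"
  by (rule urec_cong[of "\<lambda>z. f z - f z div g z * g z"], intro rec_intros assms, simp add: minus_div_mult_eq_mod)

lemma d_bit [rec_intros]:
  assumes "urec f" "urec g"
  shows "dec (\<lambda>z. bit (f z) (g z))"
  by (rule dec_cong[of "\<lambda>z. (f z div 2 ^ g z) mod 2 = 1"], intro rec_intros assms, simp add: bit_iff_odd odd_iff_mod_2_eq_one)

lemma d_odd [rec_intros]: "urec f \<Longrightarrow> dec (\<lambda>z. odd (f z))"
  by (rule dec_cong[of "\<lambda>z. f z mod 2 = 1"], (intro rec_intros; assumption), simp add: odd_iff_mod_2_eq_one)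

text \<open>Course-of-values recursion: \<open>\<Phi>\<close> receives the values below its argument as a bit table.\<close>

fun tab :: "(bits \<Rightarrow> nat \<Rightarrow> bool) \<Rightarrow> nat \<Rightarrow> nat" where
  "tab \<Phi> 0 = 0"
| "tab \<Phi> (Suc n) = tab \<Phi> n + of_bool (\<Phi> (bit (tab \<Phi> n)) n) * 2 ^ n"

definition cov :: "(bits \<Rightarrow> nat \<Rightarrow> bool) \<Rightarrow> nat \<Rightarrow> bool" where
  "cov \<Phi> n = \<Phi> (bit (tab \<Phi> n)) n"

lemma bit_add_power: "t < 2 ^ n \<Longrightarrow> bit (t + of_bool c * 2 ^ n) i \<longleftrightarrow> (if i = n then c else bit t i)"
  for t :: nat
proof -
  assume t: "t < 2 ^ n"
  then have tt: "\<not> bit t i" if "n \<le> i" for i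
    using that by (metis bit_take_bit_iff not_less take_bit_nat_eq_self)
  have "t + of_bool c * 2 ^ n = Bit_Operations.or t (of_bool c * 2 ^ n)"
    by (rule disjunctive_add_eq_or) (intro bit_eqI, use tt in \<open>auto simp: bit_and_iff bit_exp_iff\<close>)
  then show ?thesis using tt by (auto simp: bit_or_iff bit_exp_iff)
qed

lemma tab_less: "tab \<Phi> n < 2 ^ n"
  by (induction n) (auto simp: of_bool_def)

lemma bit_tab: "bit (tab \<Phi> n) i \<longleftrightarrow> i < n \<and> cov \<Phi> i"
  by (induction n) (auto simp: bit_add_power[OF tab_less] cov_def[symmetric] less_Suc_eq)

lemma cov_unfold: "cov \<Phi> n = \<Phi> (\<lambda>i. i < n \<and> cov \<Phi> i) n"
proof -
  have "bit (tab \<Phi> n) = (\<lambda>i. i < n \<and> cov \<Phi> i)" by (simp add: bit_tab fun_eq_iff)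
  then show ?thesis by (simp add: cov_def)
qed

lemma r_tab:
  assumes "urec b" and d: "dec (\<lambda>w. \<Phi> (psnd (psnd w)) (bit (pfst (psnd w))) (pfst w))"
  shows "urec (\<lambda>z. tab (\<Phi> z) (b z))"
proof (rule urec_cong)
  show "urec (\<lambda>z. rec_nat 0 (\<lambda>n r. r + of_bool (\<Phi> z (bit r) n) * 2 ^ n) (b z))"
    by (rule r_rec[OF assms(1)]) (intro rec_intros d)+
  have "rec_nat 0 (\<lambda>n r. r + of_bool (\<Phi> z (bit r) n) * 2 ^ n) m = tab (\<Phi> z) m" for z m
    by (induction m) auto
  then show "rec_nat 0 (\<lambda>n r. r + of_bool (\<Phi> z (bit r) n) * 2 ^ n) (b z) = tab (\<Phi> z) (b z)" for z .
qed

lemma d_cov: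
  assumes "urec b" and d: "dec (\<lambda>w. \<Phi> (psnd (psnd w)) (bit (pfst (psnd w))) (pfst w))"
  shows "dec (\<lambda>z. cov (\<Phi> z) (b z))"
proof -
  have "urec (\<lambda>z. pe (b z) (pe (tab (\<Phi> z) (b z)) z))"
    by (intro rec_intros assms(1) r_tab[of b \<Phi>, OF assms])
  from d_comp[OF d this] show ?thesis by (simp add: cov_def)
qed

section \<open>Finite labels\<close>

text \<open>Labels are numbers, so that truncation to a shorter label is reduction modulo a power of
  two.\<close>

definition pre :: "bits \<Rightarrow> nat \<Rightarrow> nat" where
  "pre b n = (\<Sum>i<n. of_bool (b i) * 2 ^ i)"

lemma pre_Suc: "pre b (Suc n) = pre b n + of_bool (b n) * 2 ^ n"
  by (simp add: pre_def)

lemma pre_less: "pre b n < 2 ^ n"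
  by (induction n) (auto simp: pre_Suc pre_def of_bool_def)

lemma bit_pre: "bit (pre b n) i \<longleftrightarrow> i < n \<and> b i"
  by (induction n) (auto simp: pre_Suc bit_add_power[OF pre_less] less_Suc_eq, simp add: pre_def)

lemma bit_mod_power: "bit (t mod 2 ^ n) i \<longleftrightarrow> i < n \<and> bit t i" for t :: nat
  by (simp add: bit_take_bit_iff flip: take_bit_eq_mod)

lemma pre_mod: "m \<le> n \<Longrightarrow> pre b n mod 2 ^ m = pre b m"
  by (rule bit_eqI) (auto simp: bit_mod_power bit_pre)

lemma pre_bit: "pre (bit t) n = t mod 2 ^ n"
  by (rule bit_eqI) (auto simp: bit_mod_power bit_pre)

lemma pre_eq_iff: "pre b n = pre c n \<longleftrightarrow> (\<forall>i<n. b i = c i)"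
proof
  show "\<forall>i<n. b i = c i" if "pre b n = pre c n"
    using bit_pre[of b n] bit_pre[of c n] that by auto
qed (auto simp: pre_def)

lemma pre_mono_eq: "pre b n = pre c n \<Longrightarrow> m \<le> n \<Longrightarrow> pre b m = pre c m"
  by (auto simp: pre_eq_iff)

section \<open>Codes of the vertices\<close>

text \<open>
  \<open>ch s v t a\<close> is the child of \<open>v\<close> with label \<open>t\<close> in direction \<open>s\<close>; the labels of children of \<open>v\<close>
  have length \<open>hh v\<close>, enough to decide all grants into \<open>v\<close>.  Numbers divisible by 4 are roots that
  receive grants, numbers congruent to 3 modulo 4 are roots that reveal claims.
\<close>

definition hh :: "nat \<Rightarrow> nat" where "hh m = 2 * pe (8 * m + 8) (8 * m + 8) + 3"

definition ch :: "bool \<Rightarrow> nat \<Rightarrow> nat \<Rightarrow> nat \<Rightarrow> nat" where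
  "ch s v t a = 4 * pe v (pe t a) + (if s then 1 else 2)"

definition vtx :: "nat \<Rightarrow> nat" where "vtx c = pfst (c div 4)"
definition lab :: "nat \<Rightarrow> nat" where "lab c = pfst (psnd (c div 4))"
definition aux :: "nat \<Rightarrow> nat" where "aux c = psnd (psnd (c div 4))"

definition isch :: "nat \<Rightarrow> bool" where "isch c \<longleftrightarrow> c mod 4 = 1 \<or> c mod 4 = 2"

lemma ch_simps [simp]:
  "vtx (ch s v t a) = v" "lab (ch s v t a) = t" "aux (ch s v t a) = a" "isch (ch s v t a)"
  "ch s v t a mod 4 = (if s then 1 else 2)"
  by (auto simp: ch_def vtx_def lab_def aux_def isch_def)

lemma ch_eq_iff [simp]: "ch s v t a = ch s' v' t' a' \<longleftrightarrow> s = s' \<and> v = v' \<and> t = t' \<and> a = a'"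
proof
  assume *: "ch s v t a = ch s' v' t' a'"
  have "v = v'" "t = t'" "a = a'"
    using arg_cong[OF *, of vtx] arg_cong[OF *, of lab] arg_cong[OF *, of aux] by simp_all
  moreover have "s = s'" using arg_cong[OF *, of "\<lambda>c. c mod 4"] by (simp split: if_splits)
  ultimately show "s = s' \<and> v = v' \<and> t = t' \<and> a = a'" by simp
qed simp

lemma ch_collapse: "isch c \<Longrightarrow> ch (c mod 4 = 1) (vtx c) (lab c) (aux c) = c"
  by (auto simp: isch_def ch_def vtx_def lab_def aux_def) presburger+

lemma pe_ge1: "a \<le> pe a b" and pe_ge2: "b \<le> pe a b"
  using le_prod_encode_1[of a b] le_prod_encode_2[of b a] by (simp_all add: pe_def)

lemma pfst_le: "pfst z \<le> z" and psnd_le: "psnd z \<le> z"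
  using pe_ge1[of "pfst z" "psnd z"] pe_ge2[of "psnd z" "pfst z"] by simp_all

lemma vtx_le: "vtx c \<le> c" unfolding vtx_def using pfst_le[of "c div 4"] by linarith

lemma vtx_less: "isch c \<Longrightarrow> vtx c < c"
  using pfst_le[of "c div 4"] by (auto simp: vtx_def isch_def)

lemma funpow_vtx_le: "(vtx ^^ q) m \<le> m"
  by (induction q) (auto intro: le_trans[OF vtx_le])

lemma ch_ge: "v < ch s v t a" and ch_ge_lab: "t < ch s v t a" and ch_ge_aux: "a < ch s v t a"
  unfolding ch_def using pe_ge1[of v "pe t a"] pe_ge2[of "pe t a" v] pe_ge1[of t a] pe_ge2[of a t]
  by auto

lemma pe_strict_mono: "a < c \<Longrightarrow> b \<le> d \<Longrightarrow> pe a b < pe c d"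
  using pe_mono[of a c b d] by (metis less_le pe_eq_iff less_imp_le_nat)

lemma ch_strict_mono: "v < v' \<Longrightarrow> t \<le> t' \<Longrightarrow> a \<le> a' \<Longrightarrow> ch s v t a < ch s v' t' a'"
  unfolding ch_def using pe_strict_mono[of v v' "pe t a" "pe t' a'"] pe_mono[of t t' a a'] by auto

lemma hh_strict_mono: "v < v' \<Longrightarrow> hh v < hh v'"
  unfolding hh_def using pe_strict_mono[of "8*v+8" "8*v'+8" "8*v+8" "8*v'+8"] by simp

lemma hh_mono: "v \<le> v' \<Longrightarrow> hh v \<le> hh v'"
  by (metis hh_strict_mono le_less)

lemma hh_ge: "v < hh v"
  unfolding hh_def using pe_ge1[of "8*v+8" "8*v+8"] by simp

section \<open>Levels, candidates and grants\<close>

text \<open>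
  \<open>FF v\<close> bounds the children of \<open>v\<close> with auxiliary part 0, and the roots \<open>rt e i\<close> of level \<open>e\<close> with
  \<open>i \<le> AA e\<close> are out of reach of \<open>e\<close> climbing steps from the roots of lower levels.
\<close>

definition FF :: "nat \<Rightarrow> nat" where "FF v = 4 * pe v (pe (2 ^ hh v) 0) + 2"

fun AA :: "nat \<Rightarrow> nat" where
  "AA 0 = 1"
| "AA (Suc e) = (FF ^^ Suc e) (8 * AA e) + 1"

definition rt :: "nat \<Rightarrow> nat \<Rightarrow> nat" where "rt e i = 4 * (AA e + i)"

text \<open>A binary numeral with leading digit 1, so that the level determines both
  \<open>k\<close> and the first \<open>k\<close> claim bits; see \<open>lev_eq\<close>.\<close>

definition lev :: "bits \<Rightarrow> nat \<Rightarrow> nat" where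
  "lev b k = 2 ^ k + pre (\<lambda>i. b (2 * i + 2)) k"

definition cl :: "bits \<Rightarrow> nat \<Rightarrow> nat \<Rightarrow> bool" where "cl b u a \<longleftrightarrow> b (2 * pe u a + 2)"

text \<open>
  A permutation sends one of the \<open>AA e + 1\<close> roots of level \<open>e\<close> to a value \<open>\<ge> AA e\<close>.  The candidate
  is the first one, and this is visible from the bits that a label of a child of \<open>m\<close> contains.
\<close>

definition cand :: "bits \<Rightarrow> nat \<Rightarrow> nat \<Rightarrow> nat \<Rightarrow> bool" where
  "cand b k u m \<longleftrightarrow> k \<le> m \<and> AA (lev b k) \<le> m \<and> cl b u m \<and> (\<forall>a<m. \<not> cl b u a) \<and>
    (\<exists>i\<le>AA (lev b k). u = rt (lev b k) i \<and> (\<forall>j<i. \<exists>a<AA (lev b k). cl b (rt (lev b k) j) a))"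

text \<open>
  \<open>rp I u m r\<close>: the \<open>r\<close> steps from \<open>u\<close> up to \<open>m\<close> are steps that some reduced word takes.  The parameter
  \<open>I v t\<close> stands for ``a generator with label \<open>t\<close> grants the value \<open>v\<close>'', in which case there is no
  backward step from \<open>v\<close> to its \<open>E\<close>-child; it is defined below by recursion.
\<close>

definition okc :: "(nat \<Rightarrow> nat \<Rightarrow> bool) \<Rightarrow> nat \<Rightarrow> bool" where
  "okc I c \<longleftrightarrow> isch c \<and> aux c = 0 \<and> lab c < 2 ^ hh (vtx c) \<and> (c mod 4 = 2 \<longrightarrow> \<not> I (vtx c) (lab c))"

definition nocan :: "nat \<Rightarrow> bool" where
  "nocan c \<longleftrightarrow> (vtx c mod 4 \<noteq> c mod 4 \<longrightarrow> lab (vtx c) \<noteq> lab c mod 2 ^ hh (vtx (vtx c)))"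

definition rp :: "(nat \<Rightarrow> nat \<Rightarrow> bool) \<Rightarrow> nat \<Rightarrow> nat \<Rightarrow> nat \<Rightarrow> bool" where
  "rp I u m r \<longleftrightarrow> (vtx ^^ r) m = u \<and> (\<forall>q<r. okc I ((vtx ^^ q) m) \<and> (Suc q < r \<longrightarrow> nocan ((vtx ^^ q) m)))"

text \<open>Labels on one path truncate those on the other, as happens when the same generators are
  followed from roots of different size.\<close>

definition coh :: "nat \<Rightarrow> nat \<Rightarrow> nat \<Rightarrow> bool" where
  "coh r m m' \<longleftrightarrow> (\<forall>q<r. (vtx ^^ q) m mod 4 = (vtx ^^ q) m' mod 4 \<and>
    lab ((vtx ^^ q) m) = lab ((vtx ^^ q) m') mod 2 ^ hh (vtx ((vtx ^^ q) m)))"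

text \<open>
  If \<open>j\<close> precedes \<open>k\<close>, then the two paths may be spelled by the same word.
\<close>

definition prec :: "(nat \<Rightarrow> nat \<Rightarrow> bool) \<Rightarrow> bits \<Rightarrow> nat \<Rightarrow> nat \<Rightarrow> nat \<Rightarrow> bool" where
  "prec I b j k m' \<longleftrightarrow> (\<exists>m<m'. \<exists>u\<le>8*m'. \<exists>u'\<le>8*m'. \<exists>r\<le>m'.
     cand b j u m \<and> cand b k u' m' \<and> rp I u m r \<and> rp I u' m' r \<and> coh r m m')"

text \<open>
  The roots \<open>4 * pe N u + 3\<close> form the system \<open>N\<close>.  The value 0 of \<open>sysno\<close> means ``no system'', and
  the types 0 and \<open>Suc (Suc N)\<close> of \<open>sty\<close> are given to the first and to the later candidates in the
  system \<open>N\<close>: a generator grants infinitely often into at most one system.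
\<close>

definition vroot :: "nat \<Rightarrow> nat" where "vroot m = ((\<lambda>c. if isch c then vtx c else c) ^^ m) m"

definition sysno :: "nat \<Rightarrow> nat" where
  "sysno m = (if vroot m mod 4 = 3 then Suc (pfst (vroot m div 4)) else 0)"

definition sty :: "bits \<Rightarrow> nat \<Rightarrow> nat \<Rightarrow> nat" where
  "sty b k m = (if sysno m = 0 then 1
    else if \<exists>j<k. \<exists>m'<m. \<exists>u\<le>8*m. cand b j u m' \<and> sysno m' = sysno m then Suc (sysno m) else 0)"

text \<open>The sum is the depth, the number of predecessors in \<open>prec\<close>. Pairing it with
  the type lets a single selected index fix both.\<close>

definition cls :: "(nat \<Rightarrow> nat \<Rightarrow> bool) \<Rightarrow> bits \<Rightarrow> nat \<Rightarrow> nat \<Rightarrow> nat" where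
  "cls I b k m = pe (\<Sum>j<k. of_bool (prec I b j k m)) (sty b k m)"

text \<open>
  Bit 0 of \<open>b\<close> is the parity of its labels, so this keeps grants away from the values \<open>D b v\<close>.
\<close>

definition okb :: "bits \<Rightarrow> nat \<Rightarrow> bool" where
  "okb b m \<longleftrightarrow> (if m mod 4 = 1 then b 0 \<noteq> odd (lab m) else \<not> b 0)"

abbreviation clb :: "nat \<Rightarrow> nat" where "clb m \<equiv> pe (8 * m + 8) (8 * m + 8)"

text \<open>Taking the least level with target \<open>m\<close> makes the source of a grant into
  \<open>m\<close> unique. The odd bits are examined only below \<open>clb m\<close>, which exceeds
  the class (\<open>cls_bound\<close>), so that finitely many bits decide the grant.\<close>

definition GrI :: "(nat \<Rightarrow> nat \<Rightarrow> bool) \<Rightarrow> bits \<Rightarrow> nat \<Rightarrow> nat \<Rightarrow> bool" where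
  "GrI I b u m \<longleftrightarrow> (\<exists>k\<le>m. cand b k u m \<and> (\<forall>j<k. \<forall>u'\<le>8*m. \<not> cand b j u' m) \<and> okb b m \<and>
     (\<forall>i<clb m. b (2 * i + 1) = (i = cls I b k m)))"

text \<open>The pair \<open>(v, t)\<close> is represented by the numeral with leading digit 1
  followed by \<open>t\<close> in \<open>hh v\<close> binary digits. As \<open>hh\<close> increases
  strictly, smaller vertices get smaller indices and course-of-values recursion applies.\<close>

definition PhiIn :: "bits \<Rightarrow> nat \<Rightarrow> bool" where
  "PhiIn I i \<longleftrightarrow> (\<exists>v\<le>i. \<exists>t\<le>i. i = 2 ^ hh v + t \<and> t < 2 ^ hh v \<and>
     (\<exists>u\<le>8*v. GrI (\<lambda>v' t'. I (2 ^ hh v' + t')) (bit t) u v))"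

definition In :: "nat \<Rightarrow> nat \<Rightarrow> bool" where "In v t \<longleftrightarrow> cov PhiIn (2 ^ hh v + t)"

definition Gr :: "bits \<Rightarrow> nat \<Rightarrow> nat \<Rightarrow> bool" where "Gr b u m \<longleftrightarrow> GrI In b u m"

section \<open>Growth of the levels and separation of their roots\<close>

lemma FF_ge: "v \<le> FF v" unfolding FF_def using pe_ge1[of v "pe (2 ^ hh v) 0"] by simp

lemma FF_mono: "v \<le> v' \<Longrightarrow> FF v \<le> FF v'"
  unfolding FF_def by (simp add: pe_mono hh_mono)

lemma FF_pow_mono: "v \<le> v' \<Longrightarrow> (FF ^^ n) v \<le> (FF ^^ n) v'"
  by (induction n) (auto intro: FF_mono)

lemma FF_pow_ge: "v \<le> (FF ^^ n) v"
  by (induction n) (auto intro: le_trans[OF _ FF_ge])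

lemma FF_pow_le: "n \<le> n' \<Longrightarrow> (FF ^^ n) v \<le> (FF ^^ n') v"
  by (induction n' rule: dec_induct) (auto intro: le_trans[OF _ FF_ge])

lemma AA_Suc_gt: "8 * AA e < AA (Suc e)"
  using FF_pow_ge[of "8 * AA e" "Suc e"] by simp

lemma AA_pos: "0 < AA e" by (induction e) auto

lemma AA_less: "e < e' \<Longrightarrow> 8 * AA e < AA e'"
proof (induction rule: less_Suc_induct)
  case (1 i) show ?case by (rule AA_Suc_gt)
qed linarith

lemma AA_mono: "e \<le> e' \<Longrightarrow> AA e \<le> AA e'"
  using AA_less[of e e'] by (cases "e = e'") auto

lemma AA_ge: "e < AA e"
proof (induction e)
  case (Suc e) with AA_Suc_gt[of e] show ?case by linarith
qed simp

lemma rt_bounds: "i \<le> AA e \<Longrightarrow> 4 * AA e \<le> rt e i \<and> rt e i \<le> 8 * AA e"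
  by (simp add: rt_def)

lemma rt_eq: "i \<le> AA e \<Longrightarrow> i' \<le> AA e' \<Longrightarrow> rt e i = rt e' i' \<Longrightarrow> e = e' \<and> i = i'"
  using rt_bounds[of i e] rt_bounds[of i' e'] AA_less[of e e'] AA_less[of e' e]
  by (cases e e' rule: linorder_cases) (auto simp: rt_def)

text \<open>\<open>AA e\<close> was chosen beyond \<open>e\<close> applications of \<open>FF\<close>
  to everything in the preceding level, which dominates all lower levels.\<close>

lemma ball_bound: "e' < e \<Longrightarrow> i \<le> AA e' \<Longrightarrow> r \<le> e \<Longrightarrow> (FF ^^ r) (rt e' i) < AA e"
proof -
  assume *: "e' < e" "i \<le> AA e'" "r \<le> e"
  then obtain d where d: "e = Suc d" "e' \<le> d" by (cases e) auto
  have "(FF ^^ r) (rt e' i) \<le> (FF ^^ r) (8 * AA d)"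
    using rt_bounds[OF *(2)] AA_mono[OF d(2)] by (intro FF_pow_mono) linarith
  also have "\<dots> \<le> (FF ^^ e) (8 * AA d)" using * by (intro FF_pow_le)
  also have "\<dots> < AA e" using d by simp
  finally show ?thesis .
qed

lemma lev_bounds: "2 ^ k \<le> lev b k" "lev b k < 2 ^ Suc k"
  using pre_less[of "\<lambda>i. b (2 * i + 2)" k] by (auto simp: lev_def)

lemma lev_ge: "k \<le> lev b k"
  using lev_bounds(1)[of k b] less_exp[of k] by linarith

lemma lev_strict: "k < k' \<Longrightarrow> lev b k < lev c k'"
proof -
  assume "k < k'"
  have "lev b k < 2 ^ Suc k" by (rule lev_bounds)
  also have "\<dots> \<le> 2 ^ k'" using \<open>k < k'\<close> by (intro power_increasing) auto
  also have "\<dots> \<le> lev c k'" by (rule lev_bounds)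
  finally show ?thesis .
qed

lemma lev_eq: "lev b k = lev c k' \<longleftrightarrow> k = k' \<and> (\<forall>i<k. b (2 * i + 2) = c (2 * i + 2))"
proof
  assume *: "lev b k = lev c k'"
  then have "k = k'"
    using lev_strict[of k k' b c] lev_strict[of k' k c b] by (cases k k' rule: linorder_cases) auto
  with * show "k = k' \<and> (\<forall>i<k. b (2 * i + 2) = c (2 * i + 2))"
    by (simp add: lev_def pre_eq_iff)
qed (auto simp: lev_def pre_eq_iff)

lemma pe_less_hh: "x \<le> 8 * m + 8 \<Longrightarrow> y \<le> 8 * m + 8 \<Longrightarrow> 2 * pe x y + 2 < hh m"
  using pe_mono[of x "8*m+8" y "8*m+8"] by (simp add: hh_def)

lemma small_less_hh: "i \<le> 8 * m + 8 \<Longrightarrow> 2 * i + 2 < hh m"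
  using pe_less_hh[of i m 0] pe_ge1[of i 0] by linarith

lemma cl_cong: "\<forall>i<hh m. b i = c i \<Longrightarrow> u \<le> 8 * m + 8 \<Longrightarrow> a \<le> 8 * m + 8 \<Longrightarrow> cl b u a = cl c u a"
  unfolding cl_def using pe_less_hh by blast

lemma lev_cong: "\<forall>i<hh m. b i = c i \<Longrightarrow> k \<le> m \<Longrightarrow> lev b k = lev c k"
  unfolding lev_eq using small_less_hh[of _ m] by auto

lemma cand_bounds: "cand b k u m \<Longrightarrow> k \<le> m \<and> u \<le> 8 * m \<and> AA (lev b k) \<le> m \<and> u mod 4 = 0"
  unfolding cand_def using rt_bounds by (fastforce simp: rt_def)

lemma cand_imp_cong: "\<forall>i<hh m. b i = c i \<Longrightarrow> m' \<le> m \<Longrightarrow> cand b k u m' \<Longrightarrow> cand c k u m'"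
proof -
  assume *: "\<forall>i<hh m. b i = c i" "m' \<le> m" and c: "cand b k u m'"
  have k: "k \<le> m'" and e: "AA (lev b k) \<le> m'" using c by (auto simp: cand_def)
  have l: "lev b k = lev c k" using lev_cong[OF *(1)] k *(2) by simp
  have u: "u \<le> 8 * m'" using cand_bounds[OF c] by simp
  have cl: "cl b u' a = cl c u' a" if "u' \<le> 8 * m'" "a \<le> m'" for u' a
    using cl_cong[OF *(1)] that *(2) by simp
  from c obtain i where i: "i \<le> AA (lev b k)" "u = rt (lev b k) i"
    "\<forall>j<i. \<exists>a<AA (lev b k). cl b (rt (lev b k) j) a" by (auto simp: cand_def)
  have "\<exists>a<AA (lev b k). cl c (rt (lev b k) j) a" if "j < i" for j
  proof -
    from i(3) that obtain a where a: "a < AA (lev b k)" "cl b (rt (lev b k) j) a" by blast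
    have "rt (lev b k) j \<le> 8 * m'" using rt_bounds[of j "lev b k"] i(1) that e by simp
    with a cl e show ?thesis by (metis less_le_trans less_imp_le_nat)
  qed
  with i c cl[OF u] show "cand c k u m'" unfolding cand_def l[symmetric] by auto
qed

lemma cand_cong: "\<forall>i<hh m. b i = c i \<Longrightarrow> m' \<le> m \<Longrightarrow> cand b k u m' = cand c k u m'"
  using cand_imp_cong[of m b c] cand_imp_cong[of m c b] by auto

text \<open>Of two different roots of the level, the earlier one has a claim below
  \<open>AA (lev b k)\<close> according to the other candidate, while its own first claim is at
  least that large.\<close>

lemma cand_unique:
  assumes "cand b k u m" "cand b k u' m'"
  shows "u = u'" "m = m'"
proof -
  let ?e = "lev b k"
  obtain i where i: "i \<le> AA ?e" "u = rt ?e i" "\<forall>j<i. \<exists>a<AA ?e. cl b (rt ?e j) a"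
    using assms(1) by (auto simp: cand_def)
  obtain i' where i': "i' \<le> AA ?e" "u' = rt ?e i'" "\<forall>j<i'. \<exists>a<AA ?e. cl b (rt ?e j) a"
    using assms(2) by (auto simp: cand_def)
  have n: "\<not> cl b u a" "\<not> cl b u' a" if "a < AA ?e" for a
    using assms that by (auto simp: cand_def)
  have "\<not> i < i'" "\<not> i' < i" using i i' n by blast+
  then show u: "u = u'" using i i' by simp
  show "m = m'" using assms u unfolding cand_def by (metis nat_neq_iff)
qed

text \<open>The root intervals of different levels are disjoint, so a source reveals its
  level.\<close>

lemma cand_level:
  assumes "cand b k u m" "cand c k' u m'"
  shows "k = k'" "lev b k = lev c k"
proof -
  obtain i where i: "i \<le> AA (lev b k)" "u = rt (lev b k) i" using assms(1) by (auto simp: cand_def)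
  obtain i' where i': "i' \<le> AA (lev c k')" "u = rt (lev c k') i'"
    using assms(2) by (auto simp: cand_def)
  have "lev b k = lev c k'" using rt_eq[OF i(1) i'(1)] i i' by simp
  then show "k = k'" "lev b k = lev c k" by (auto simp: lev_eq)
qed

section \<open>Grants are well defined and decided by finitely many bits\<close>

lemma funpow_vtx_ch: "isch ((vtx ^^ q) m) \<Longrightarrow> vtx ((vtx ^^ q) m) < m"
  using vtx_less[of "(vtx ^^ q) m"] funpow_vtx_le[of q m] by linarith

lemma rp_cong:
  assumes "\<And>v t. v < m \<Longrightarrow> t < 2 ^ hh v \<Longrightarrow> I v t = J v t"
  shows "rp I u m r = rp J u m r"
proof -
  have "okc I ((vtx ^^ q) m) = okc J ((vtx ^^ q) m)" for q
    unfolding okc_def using assms funpow_vtx_ch[of q m] by blast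
  then show ?thesis by (simp add: rp_def)
qed

text \<open>The paths in \<open>prec\<close> start at targets up to \<open>m\<close>, and every
  vertex satisfying \<open>okc\<close> has a smaller parent, so \<open>I\<close> is queried only at
  vertices below \<open>m\<close>. This makes the recursion behind \<open>In\<close> well
  founded.\<close>

lemma GrI_cong:
  assumes "\<And>v t. v < m \<Longrightarrow> t < 2 ^ hh v \<Longrightarrow> I v t = J v t"
  shows "GrI I b u m = GrI J b u m"
proof -
  have "rp I u m' r = rp J u m' r" if "m' \<le> m" for u m' r
    by (rule rp_cong) (use assms that in auto)
  then have "prec I b j k m = prec J b j k m" for j k
    by (simp add: prec_def less_imp_le_nat cong: conj_cong)
  then show ?thesis by (simp add: GrI_def cls_def)
qed

lemma GrI_imp_local:
  assumes "\<forall>i<hh m. b i = c i" "GrI I b u m"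
  shows "GrI I c u m"
proof -
  have cd: "cand b k u m' = cand c k u m'" if "m' \<le> m" for k u m'
    by (rule cand_cong[OF assms(1) that])
  then have p: "prec I b j k m = prec I c j k m" for j k
    by (simp add: prec_def less_imp_le_nat cong: conj_cong)
  have s: "sty b k m = sty c k m" for k
    using cd by (simp add: sty_def less_imp_le_nat cong: conj_cong)
  have o: "okb b m = okb c m" using assms(1) by (auto simp: okb_def hh_def)
  have i: "2 * i + 1 < hh m" if "i < clb m" for i
    using that by (simp add: hh_def)
  from assms(2) obtain k where k: "k \<le> m" "cand b k u m" "\<forall>j<k. \<forall>u'\<le>8*m. \<not> cand b j u' m"
    "okb b m" "\<forall>i<clb m. b (2 * i + 1) = (i = cls I b k m)"
    unfolding GrI_def by blast
  have "cls I b k m = cls I c k m" by (simp add: cls_def p s)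
  with k cd o i assms(1) have "cand c k u m" "\<forall>j<k. \<forall>u'\<le>8*m. \<not> cand c j u' m"
    "okb c m" "\<forall>i<clb m. c (2 * i + 1) = (i = cls I c k m)"
    by auto
  with k(1) show ?thesis unfolding GrI_def by blast
qed

lemma Gr_local: "\<forall>i<hh m. b i = c i \<Longrightarrow> Gr b u m = Gr c u m"
  unfolding Gr_def using GrI_imp_local[of m b c] GrI_imp_local[of m c b] by auto

lemma GrI_u_le: "GrI I b u m \<Longrightarrow> u \<le> 8 * m"
  unfolding GrI_def using cand_bounds by blast

lemma index_inj:
  fixes t t' :: nat
  assumes "2 ^ hh v + t = 2 ^ hh v' + t'" "t < 2 ^ hh v" "t' < 2 ^ hh v'"
  shows "v = v' \<and> t = t'"
proof -
  have False if "v < v'" "2 ^ hh v + t = 2 ^ hh v' + t'" "t < 2 ^ hh v" for v v' t t' :: nat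
  proof -
    have "(2::nat) ^ Suc (hh v) \<le> 2 ^ hh v'"
      using hh_strict_mono[OF that(1)] by (intro power_increasing) auto
    with that(2,3) show False by simp
  qed
  from this[of v v' t t'] this[of v' v t' t] assms show ?thesis
    by (cases v v' rule: linorder_cases) auto
qed

lemma index_less: "v' < v \<Longrightarrow> t' < 2 ^ hh v' \<Longrightarrow> (2::nat) ^ hh v' + t' < 2 ^ hh v + t"
proof -
  assume *: "v' < v" "t' < 2 ^ hh v'"
  have "(2::nat) ^ Suc (hh v') \<le> 2 ^ hh v"
    using hh_strict_mono[OF *(1)] by (intro power_increasing) auto
  with * show ?thesis by simp
qed

lemma In_iff:
  assumes t: "t < 2 ^ hh v"
  shows "In v t \<longleftrightarrow> (\<exists>u. Gr (bit t) u v)"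
proof -
  let ?n = "2 ^ hh v + t"
  let ?J = "\<lambda>v' t'. 2 ^ hh v' + t' < ?n \<and> cov PhiIn (2 ^ hh v' + t')"
  have g: "GrI ?J (bit t) u v = Gr (bit t) u v" for u
    unfolding Gr_def by (rule GrI_cong) (use index_less in \<open>auto simp: In_def\<close>)
  have v: "v \<le> ?n" using hh_ge[of v] less_exp[of "hh v"] by linarith
  have "In v t \<longleftrightarrow> (\<exists>v'\<le>?n. \<exists>t'\<le>?n. ?n = 2 ^ hh v' + t' \<and> t' < 2 ^ hh v' \<and>
     (\<exists>u\<le>8*v'. GrI ?J (bit t') u v'))"
    unfolding In_def by (subst cov_unfold) (simp add: PhiIn_def)
  also have "\<dots> \<longleftrightarrow> (\<exists>u\<le>8*v. GrI ?J (bit t) u v)"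
  proof
    assume "\<exists>v'\<le>?n. \<exists>t'\<le>?n. ?n = 2 ^ hh v' + t' \<and> t' < 2 ^ hh v' \<and>
     (\<exists>u\<le>8*v'. GrI ?J (bit t') u v')"
    then show "\<exists>u\<le>8*v. GrI ?J (bit t) u v" using index_inj[OF _ t] by blast
  next
    assume "\<exists>u\<le>8*v. GrI ?J (bit t) u v"
    with v t have "v \<le> ?n \<and> t \<le> ?n \<and> ?n = 2 ^ hh v + t \<and> t < 2 ^ hh v \<and>
     (\<exists>u\<le>8*v. GrI ?J (bit t) u v)" by simp
    then show "\<exists>v'\<le>?n. \<exists>t'\<le>?n. ?n = 2 ^ hh v' + t' \<and> t' < 2 ^ hh v' \<and>
     (\<exists>u\<le>8*v'. GrI ?J (bit t') u v')" by blast
  qed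
  also have "\<dots> \<longleftrightarrow> (\<exists>u. Gr (bit t) u v)" using g GrI_u_le by blast
  finally show ?thesis .
qed

lemma In_pre: "In v (pre b (hh v)) \<longleftrightarrow> (\<exists>u. Gr b u v)"
proof -
  have "Gr (bit (pre b (hh v))) u v = Gr b u v" for u
    by (rule Gr_local) (simp add: bit_pre)
  then show ?thesis by (simp add: In_iff[OF pre_less])
qed

lemma Gr_cand:
  assumes "Gr b u m"
  obtains k where "cand b k u m" "\<And>j u'. j < k \<Longrightarrow> \<not> cand b j u' m" "okb b m"
    "\<And>i. i < clb m \<Longrightarrow> b (2 * i + 1) = (i = cls In b k m)"
  using assms cand_bounds unfolding Gr_def GrI_def by blast

lemma Gr_out_unique: "Gr b u m \<Longrightarrow> Gr b u m' \<Longrightarrow> m = m'"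
  by (metis Gr_cand cand_level(1) cand_unique(2))

lemma Gr_in_unique: "Gr b u m \<Longrightarrow> Gr b u' m \<Longrightarrow> u = u'"
  by (metis Gr_cand linorder_neqE_nat cand_unique(1))

lemma Gr_mod4: "Gr b u m \<Longrightarrow> u mod 4 = 0"
  by (metis Gr_cand cand_bounds)

section \<open>The generators\<close>

definition fcv :: "bits \<Rightarrow> nat \<Rightarrow> nat" where
  "fcv b u = (if \<exists>a. cl b u a then Suc (LEAST a. cl b u a) else 0)"

text \<open>
  The system \<open>N\<close> with \<open>psnd N = 4 * p + 2 * of_bool c + of_bool s\<close> reveals the claims of the generators
  with \<open>b p = c\<close>, to letters of sign \<open>s\<close>.
\<close>

definition xi :: "bits \<Rightarrow> nat \<Rightarrow> bool \<Rightarrow> nat" where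
  "xi b v s = (if v mod 4 = 3 \<and> b (psnd (pfst (v div 4)) div 4) = odd (psnd (pfst (v div 4)) div 2)
     \<and> s = odd (psnd (pfst (v div 4))) then fcv b (psnd (v div 4)) else 0)"

definition D :: "bits \<Rightarrow> nat \<Rightarrow> nat" where "D b v = ch True v (pre b (hh v)) (xi b v True)"
definition E :: "bits \<Rightarrow> nat \<Rightarrow> nat" where "E b v = ch False v (pre b (hh v)) (xi b v False)"

lemma vtx_D [simp]: "vtx (D b v) = v" and vtx_E [simp]: "vtx (E b v) = v"
  by (simp_all add: D_def E_def)

lemma D_eq_iff [simp]: "D b v = D b w \<longleftrightarrow> v = w" and E_eq_iff [simp]: "E b v = E b w \<longleftrightarrow> v = w"
  by (metis vtx_D, metis vtx_E)

lemma mod4_D [simp]: "D b v mod 4 = 1" and mod4_E [simp]: "E b v mod 4 = 2"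
  by (simp_all add: D_def E_def)

lemma D_neq_E [simp]: "D b v \<noteq> E c w" "E c w \<noteq> D b v"
  by (auto simp: D_def E_def)

lemma D_gt: "v < D b v" and E_gt: "v < E b v"
  by (simp_all add: D_def E_def ch_ge)

lemma Gr_not_D: "\<not> Gr b u (D b v)"
proof
  assume "Gr b u (D b v)"
  then have "okb b (D b v)" using Gr_cand by blast
  moreover have "bit (pre b (hh v)) 0 = b 0" by (simp add: bit_pre hh_def)
  ultimately show False by (simp add: okb_def D_def bit_0)
qed

text \<open>
  \<open>dn b z\<close> holds if \<open>chi b\<close> maps \<open>z\<close> to its parent; \<open>dn\<close> calls itself at the grandparent.
\<close>

definition PhiDn :: "bits \<Rightarrow> bits \<Rightarrow> nat \<Rightarrow> bool" where
  "PhiDn b I z \<longleftrightarrow> E b (vtx z) = z \<and> \<not> (\<exists>u\<le>8*vtx z. Gr b u (vtx z)) \<and>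
    \<not> (D b (vtx (vtx z)) = vtx z \<and> \<not> (\<exists>m. Gr b (vtx (vtx z)) m) \<and> \<not> I (vtx (vtx z)))"

definition dn :: "bits \<Rightarrow> nat \<Rightarrow> bool" where "dn b = cov (PhiDn b)"

definition att :: "bits \<Rightarrow> nat \<Rightarrow> bool" where
  "att b w \<longleftrightarrow> \<not> (\<exists>m. Gr b w m) \<and> \<not> dn b w"

definition chi :: "bits \<Rightarrow> nat \<Rightarrow> nat" where
  "chi b z = (if \<exists>m. Gr b z m then THE m. Gr b z m else if dn b z then vtx z else D b z)"

definition ich :: "bits \<Rightarrow> nat \<Rightarrow> nat" where
  "ich b w = (if \<exists>u. Gr b u w then THE u. Gr b u w
     else if D b (vtx w) = w \<and> att b (vtx w) then vtx w else E b w)"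

lemma Gr_u_le: "Gr b u m \<Longrightarrow> u \<le> 8 * m"
  unfolding Gr_def by (rule GrI_u_le)

text \<open>If the parent of \<open>z\<close> is already the value \<open>D\<close> at an attached
  grandparent, then \<open>z\<close> may not map to it as well. The grandparent is smaller than
  \<open>z\<close>, so the recursive call in \<open>PhiDn\<close> sees the true value.\<close>

lemma dn_iff: "dn b z \<longleftrightarrow> E b (vtx z) = z \<and> \<not> (\<exists>u. Gr b u (vtx z)) \<and>
    \<not> (D b (vtx (vtx z)) = vtx z \<and> att b (vtx (vtx z)))"
proof -
  have "vtx (vtx z) < z" if "E b (vtx z) = z" "D b (vtx (vtx z)) = vtx z"
    using E_gt[of "vtx z" b] D_gt[of "vtx (vtx z)" b] that by simp
  moreover have "(\<exists>u\<le>8*vtx z. Gr b u (vtx z)) \<longleftrightarrow> (\<exists>u. Gr b u (vtx z))"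
    using Gr_u_le by blast
  ultimately show ?thesis unfolding dn_def by (subst cov_unfold) (auto simp: PhiDn_def att_def dn_def)
qed

lemma chi_Gr: "Gr b z m \<Longrightarrow> chi b z = m"
  unfolding chi_def using Gr_out_unique by auto

lemma ich_Gr: "Gr b u w \<Longrightarrow> ich b w = u"
  unfolding ich_def using Gr_in_unique by auto

lemma Gr_not_E: "\<not> Gr b (E c v) m"
  using Gr_mod4 mod4_E by (metis zero_neq_numeral)

lemma dn_not_Gr: "dn b z \<Longrightarrow> \<not> Gr b z m"
  using Gr_not_E[of b b "vtx z" m] by (simp add: dn_iff)

lemma chi_dn: "dn b z \<Longrightarrow> chi b z = vtx z"
  unfolding chi_def using dn_not_Gr by auto

lemma chi_att: "att b z \<Longrightarrow> chi b z = D b z"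
  unfolding chi_def att_def by auto

lemma chi_cases:
  obtains (Gr) "Gr b z (chi b z)" | (dn) "dn b z" "z = E b (chi b z)" | (att) "att b z" "chi b z = D b z"
proof -
  consider m where "Gr b z m" | "dn b z" | "att b z" by (auto simp: att_def)
  then show thesis
  proof cases
    case 1 with chi_Gr that(1) show ?thesis by blast
  next
    case 2 with chi_dn that(2) show ?thesis by (simp add: dn_iff)
  next
    case 3 with chi_att that(3) show ?thesis by blast
  qed
qed

lemma ich_chi: "ich b (chi b z) = z"
proof (cases rule: chi_cases[of b z])
  case Gr then show ?thesis by (rule ich_Gr)
next
  case dn
  then have "vtx z = chi b z" by (simp add: chi_dn)
  with dn show ?thesis unfolding ich_def by (auto simp: dn_iff)
next
  case att
  then show ?thesis unfolding ich_def using Gr_not_D by auto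
qed

lemma chi_ich: "chi b (ich b w) = w"
proof -
  consider u where "Gr b u w" | "\<not> (\<exists>u. Gr b u w)" "D b (vtx w) = w" "att b (vtx w)"
    | "\<not> (\<exists>u. Gr b u w)" "\<not> (D b (vtx w) = w \<and> att b (vtx w))" by auto
  then show ?thesis
  proof cases
    case 1 then show ?thesis using ich_Gr chi_Gr by metis
  next
    case 2 then show ?thesis by (simp add: ich_def chi_att)
  next
    case 3
    then have "ich b w = E b w" by (auto simp: ich_def)
    moreover have "dn b (E b w)" using 3 by (simp add: dn_iff)
    ultimately show ?thesis by (simp add: chi_dn)
  qed
qed

lemma bij_chi: "bij (chi b)"
  by (rule o_bij[of "ich b"]) (auto simp: ich_chi chi_ich fun_eq_iff)

lemma inv_chi: "inv_into UNIV (chi b) = ich b"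
  by (rule inv_unique_comp) (auto simp: ich_chi chi_ich fun_eq_iff)

section \<open>Reduced words have finitely many fixed points\<close>

lemma cand_less: "cand b j u m \<Longrightarrow> cand c k u' m' \<Longrightarrow> j < k \<Longrightarrow> u < u'"
proof -
  assume *: "cand b j u m" "cand c k u' m'" "j < k"
  obtain i where i: "i \<le> AA (lev b j)" "u = rt (lev b j) i" using *(1) by (auto simp: cand_def)
  obtain i' where i': "i' \<le> AA (lev c k)" "u' = rt (lev c k) i'" using *(2) by (auto simp: cand_def)
  from AA_less[OF lev_strict[OF *(3), of b c]] rt_bounds[OF i(1)] rt_bounds[OF i'(1)]
  show "u < u'" using i i' AA_pos[of "lev c k"] by linarith
qed

lemma okc_less:
  assumes "okc I c" "okc J d" "c mod 4 = d mod 4" "lab c \<le> lab d" "vtx c < vtx d"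
  shows "c < d"
proof -
  have "ch (c mod 4 = 1) (vtx c) (lab c) (aux c) < ch (d mod 4 = 1) (vtx d) (lab d) (aux d)"
    using assms by (auto simp: okc_def intro: ch_strict_mono)
  moreover have "isch c" "isch d" using assms(1,2) by (auto simp: okc_def)
  ultimately show ?thesis by (simp only: ch_collapse)
qed

text \<open>Induction from the roots towards the targets: a larger parent with a label that is at
  least as large gives a larger child.\<close>

lemma path_mono:
  assumes "rp I u m r" "rp J u' m' r" "coh r m m'" "u < u'" "q \<le> r"
  shows "(vtx ^^ q) m < (vtx ^^ q) m'"
  using assms(5)
proof (induction q rule: inc_induct)
  case base
  then show ?case using assms by (simp add: rp_def)
next
  case (step q)
  let ?c = "(vtx ^^ q) m" and ?d = "(vtx ^^ q) m'"
  have c: "okc I ?c" "okc J ?d" "?c mod 4 = ?d mod 4" "lab ?c = lab ?d mod 2 ^ hh (vtx ?c)"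
    using assms step unfolding rp_def coh_def by auto
  show ?case using okc_less[OF c(1-3)] c(4) step by simp
qed

text \<open>By \<open>path_mono\<close> the label lengths grow from the first path to the second, so
  successive truncations compose.\<close>

lemma coh_trans:
  assumes "coh r m m'" "coh r m' m''" "rp I u m r" "rp J u' m' r" "u < u'"
  shows "coh r m m''"
  unfolding coh_def
proof (intro allI impI conjI)
  fix q assume q: "q < r"
  show "(vtx ^^ q) m mod 4 = (vtx ^^ q) m'' mod 4" using assms q by (auto simp: coh_def)
  have "vtx ((vtx ^^ q) m) \<le> vtx ((vtx ^^ q) m')"
    using path_mono[OF assms(3,4,1,5), of "Suc q"] q by simp
  then have "(2::nat) ^ hh (vtx ((vtx ^^ q) m)) dvd 2 ^ hh (vtx ((vtx ^^ q) m'))"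
    by (intro le_imp_power_dvd hh_mono)
  then show "lab ((vtx ^^ q) m) = lab ((vtx ^^ q) m'') mod 2 ^ hh (vtx ((vtx ^^ q) m))"
    using assms(1,2) q by (auto simp: coh_def mod_mod_cancel)
qed

text \<open>A path ends at a number divisible by 4, which is not a child and hence cannot be passed
  by a longer path.\<close>

lemma rp_length:
  assumes "rp I u m r" "rp J u m r'" "u mod 4 = 0"
  shows "r = r'"
proof -
  have False if "r < r'" "rp I u m r" "rp J u m r'" for r r' I J
  proof -
    have "isch ((vtx ^^ r) m)" using that(1,3) unfolding rp_def okc_def by blast
    then show False using that(2) assms(3) by (simp add: rp_def isch_def)
  qed
  from this[of r r'] this[of r' r] assms show ?thesis by (cases r r' rule: linorder_cases) auto
qed

lemma rp_le: "rp I u m r \<Longrightarrow> r \<le> m"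
proof -
  assume "rp I u m r"
  then have "(vtx ^^ q) m + q \<le> m" if "q \<le> r" for q
    using that
  proof (induction q)
    case (Suc q)
    then have "isch ((vtx ^^ q) m)" by (simp add: rp_def okc_def)
    from vtx_less[OF this] Suc show ?case by simp
  qed simp
  from this[of r] show ?thesis by simp
qed

abbreviation depth :: "bits \<Rightarrow> nat \<Rightarrow> nat \<Rightarrow> nat" where
  "depth b k m \<equiv> (\<Sum>j<k. of_bool (prec In b j k m))"

lemma depth_card: "depth b k m = card {j. j < k \<and> prec In b j k m}"
  by (simp add: sum.If_cases of_bool_def Int_def)

lemma precI:
  assumes "cand b j u m" "cand b k u' m'" "rp In u m r" "rp In u' m' r" "coh r m m'" "j < k"
  shows "prec In b j k m'"
proof -
  have u: "u < u'" by (rule cand_less[OF assms(1,2,6)])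
  have "m < m'" using path_mono[OF assms(3,4,5) u, of 0] by simp
  with assms cand_bounds[OF assms(1)] cand_bounds[OF assms(2)] rp_le[OF assms(4)]
  show ?thesis unfolding prec_def by (meson le_trans less_imp_le_nat mult_le_mono2)
qed

lemma prec_trans:
  assumes "prec In b i j m" "prec In b j k m'" "cand b j u m" "i < j" "j < k"
  shows "prec In b i k m'"
proof -
  obtain mi ui u1 r where 1: "cand b i ui mi" "cand b j u1 m" "rp In ui mi r" "rp In u1 m r" "coh r mi m"
    using assms(1) unfolding prec_def by blast
  obtain mj uj u' r' where 2: "cand b j uj mj" "cand b k u' m'" "rp In uj mj r'" "rp In u' m' r'" "coh r' mj m'"
    using assms(2) unfolding prec_def by blast
  have e: "uj = u1" "mj = m" using cand_unique[OF 2(1) 1(2)] by auto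
  have r: "r' = r" using rp_length[of In u1 m r' In r] 2(3) 1(4) cand_bounds[OF 1(2)] e by simp
  have "coh r mi m'"
    using coh_trans[OF 1(5) _ 1(3,4) cand_less[OF 1(1,2) assms(4)]] 2(5) e r by simp
  then show ?thesis using precI[OF 1(1) 2(2) 1(3)] 2 r assms by auto
qed

text \<open>The predecessors of \<open>j\<close> are predecessors of \<open>k\<close> by
  transitivity, and \<open>j\<close> itself is an additional one.\<close>

lemma depth_less:
  assumes "prec In b j k m'" "cand b j u m" "j < k"
  shows "depth b j m < depth b k m'"
  unfolding depth_card
proof (rule psubset_card_mono)
  show "{i. i < j \<and> prec In b i j m} \<subset> {i. i < k \<and> prec In b i k m'}"
    using prec_trans[OF _ assms(1,2) _ assms(3)] assms by auto
qed simp

lemma cls_bound: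
  assumes "k \<le> m"
  shows "cls In b k m < clb m"
proof -
  have "depth b k m \<le> k"
    unfolding depth_card using card_mono[of "{..<k}" "{j. j < k \<and> prec In b j k m}"] by auto
  moreover have "((\<lambda>c. if isch c then vtx c else c) ^^ n) m \<le> m" for n
    by (induction n) (auto intro: le_trans[OF vtx_le])
  then have "vroot m \<le> m" by (simp add: vroot_def)
  then have "sysno m \<le> m + 1"
    unfolding sysno_def using pfst_le[of "vroot m div 4"] by auto
  then have "sty b k m \<le> m + 2" by (simp add: sty_def)
  ultimately show ?thesis
    unfolding cls_def using assms by (intro pe_strict_mono) auto
qed

lemma Gr_class:
  assumes "Gr b u m" "cand b k u m"
  shows "i < clb m \<Longrightarrow> b (2 * i + 1) = (i = cls In b k m)"
    and "b (2 * cls In b k m + 1)"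
proof -
  obtain k' where "cand b k' u m" "\<And>i. i < clb m \<Longrightarrow> b (2 * i + 1) = (i = cls In b k' m)"
    using Gr_cand[OF assms(1)] by metis
  then show *: "\<And>i. i < clb m \<Longrightarrow> b (2 * i + 1) = (i = cls In b k m)"
    using cand_level(1)[OF assms(2)] by blast
  show "b (2 * cls In b k m + 1)" using *[of "cls In b k m"] cls_bound cand_bounds[OF assms(2)] by blast
qed

text \<open>The class of the smaller target lies within the range of odd bits examined for the
  larger one, where only one bit is set.\<close>

lemma Gr_same_class:
  assumes "Gr b u m" "cand b k u m" "Gr b u' m'" "cand b k' u' m'"
  shows "cls In b k m = cls In b k' m'"
proof -
  have "cls In b k m = cls In b k' m'"
    if "m \<le> m'" "Gr b u m" "cand b k u m" "Gr b u' m'" "cand b k' u' m'" for u u' m m' k k'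
  proof -
    have "cls In b k m < clb m" using cls_bound cand_bounds[OF that(3)] by blast
    also have "\<dots> \<le> clb m'" using that(1) by (intro pe_mono) auto
    finally show ?thesis using Gr_class(1)[OF that(4,5)] Gr_class(2)[OF that(2,3)] by blast
  qed
  from this[of m m'] this[of m' m] assms show ?thesis by (metis nat_le_linear)
qed

lemma Gr_same_depth:
  assumes "Gr b u m" "cand b k u m" "Gr b u' m'" "cand b k' u' m'"
  shows "depth b k m = depth b k' m'" "sty b k m = sty b k' m'"
  using Gr_same_class[OF assms] by (simp_all add: cls_def)

text \<open>The claims need a clause of their own: generators with equal claims have the same
  candidates even if other bits differ.\<close>

definition told :: "nat \<Rightarrow> bits \<Rightarrow> bits \<Rightarrow> bool" where
  "told N y y' \<longleftrightarrow> (y \<noteq> y' \<longrightarrow> (\<exists>i<N. y i \<noteq> y' i)) \<and>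
     ((\<exists>i. y (2*i+2) \<noteq> y' (2*i+2)) \<longrightarrow> (\<exists>i<N. y (2*i+2) \<noteq> y' (2*i+2)))"

definition sep :: "bits set \<Rightarrow> nat \<Rightarrow> bool" where
  "sep Y N \<longleftrightarrow> (\<forall>y\<in>Y. \<forall>y'\<in>Y. told N y y')"

lemma told_mono: "told N y y' \<Longrightarrow> N \<le> N' \<Longrightarrow> told N' y y'"
  unfolding told_def by (meson less_le_trans)

lemma sep_mono: "sep Y N \<Longrightarrow> N \<le> N' \<Longrightarrow> sep Y N'"
  unfolding sep_def using told_mono by blast

lemma told_eqI: "told N y y' \<Longrightarrow> (\<And>i. i < N \<Longrightarrow> y i = y' i) \<Longrightarrow> y = y'"
  unfolding told_def by auto

lemma told_exists: "\<exists>n. told n y y'"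
proof (cases "y = y'")
  case True
  then show ?thesis by (simp add: told_def)
next
  case False
  then obtain i where i: "y i \<noteq> y' i" by (auto simp: fun_eq_iff)
  show ?thesis
  proof (cases "\<exists>j. y (2*j+2) \<noteq> y' (2*j+2)")
    case True
    then obtain j where j: "y (2*j+2) \<noteq> y' (2*j+2)" ..
    have "told (Suc (i + j)) y y'"
      unfolding told_def using i j by (intro conjI impI) (auto intro: exI[of _ i] exI[of _ j])
    then show ?thesis ..
  next
    case False
    then have "told (Suc i) y y'" unfolding told_def using i by auto
    then show ?thesis ..
  qed
qed

lemma sep_exists: "finite Y \<Longrightarrow> \<exists>N. sep Y N"
proof -
  assume fin: "finite Y"
  obtain n where n: "\<And>y y'. told (n y y') y y'" using told_exists by metis
  have "n y y' \<le> (\<Sum>p\<in>Y \<times> Y. n (fst p) (snd p))" if "y \<in> Y" "y' \<in> Y" for y y'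
    using that fin member_le_sum[of "(y, y')" "Y \<times> Y" "\<lambda>p. n (fst p) (snd p)"] by simp
  then have "sep Y (\<Sum>p\<in>Y \<times> Y. n (fst p) (snd p))"
    unfolding sep_def using n told_mono by blast
  then show ?thesis ..
qed

text \<open>
  \<open>lPE N s y a b\<close>: the letter \<open>(s, y)\<close> leads from \<open>a\<close> up to its parent \<open>b\<close>.  The threshold \<open>N\<close>
  is large enough for the labels to tell the generators at hand apart, so that the parent is unique.
\<close>

definition lPE :: "nat \<Rightarrow> bool \<Rightarrow> bits \<Rightarrow> nat \<Rightarrow> nat \<Rightarrow> bool" where
  "lPE N s y a b \<longleftrightarrow> (\<not> s \<and> a = D y b \<and> att y b \<and> N \<le> b) \<or> (s \<and> a = E y b \<and> dn y a \<and> N \<le> b) \<or>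
     (s \<and> Gr y a b \<and> (\<exists>k\<ge>N. cand y k a b))"

lemma cand_gamma: "\<forall>i. y (2*i+2) = y' (2*i+2) \<Longrightarrow> cand y = cand y'"
proof -
  assume *: "\<forall>i. y (2*i+2) = y' (2*i+2)"
  then have "cl y = cl y'" by (auto simp: cl_def fun_eq_iff)
  moreover have "lev y = lev y'" using * by (auto simp: fun_eq_iff lev_eq)
  ultimately show ?thesis by (simp add: cand_def fun_eq_iff)
qed

lemma sep_label:
  assumes "sep Y N" "y \<in> Y" "y' \<in> Y" "N \<le> b" "pre y (hh b) = pre y' (hh b)"
  shows "y = y'"
proof (rule told_eqI)
  show "told N y y'" using assms by (simp add: sep_def)
  show "y i = y' i" if "i < N" for i
    using assms(4,5) that hh_ge[of b] by (simp add: pre_eq_iff)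
qed

lemma sep_level:
  assumes "sep Y N" "y \<in> Y" "y' \<in> Y" "N \<le> k" "lev y k = lev y' k"
  shows "cand y = cand y'"
proof (rule cand_gamma)
  have "\<forall>i<N. y (2*i+2) = y' (2*i+2)" using assms(4,5) unfolding lev_eq by auto
  moreover have "told N y y'" using assms by (simp add: sep_def)
  ultimately show "\<forall>i. y (2*i+2) = y' (2*i+2)" unfolding told_def by metis
qed

lemma cls_cand: "cand y = cand y' \<Longrightarrow> cls In y = cls In y'"
  by (simp add: cls_def prec_def sty_def fun_eq_iff)

text \<open>The common source fixes the level, hence by \<open>sep_level\<close> the candidates and
  the target. The target fixes bit 0 through \<open>okb\<close>, and the class fixes the odd bits,
  so the first \<open>N\<close> bits agree.\<close>

lemma Gr_sep:
  assumes sep: "sep Y N" "y \<in> Y" "y' \<in> Y" and g: "Gr y a b" "Gr y' a b'"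
    and k: "cand y k a b" "N \<le> k"
  shows "y = y' \<and> b = b'"
proof -
  obtain k' where k': "cand y' k' a b'" "okb y' b'" by (rule Gr_cand[OF g(2)])
  have kk: "k' = k" "lev y k = lev y' k'" using cand_level[OF k(1) k'(1)] by auto
  have c: "cand y = cand y'" using sep_level[OF sep k(2)] kk by simp
  have b: "b = b'" using cand_unique(2)[OF k(1)] k'(1) c kk by simp
  have o: "okb y b" by (rule Gr_cand[OF g(1)])
  have "y i = y' i" if i: "i < N" for i
  proof (cases "i = 0 \<or> odd i")
    case False
    then have "i = 2 * (i div 2 - 1) + 2" by presburger
    then obtain j where j: "i = 2 * j + 2" ..
    with i k(2) kk show ?thesis by (auto simp: lev_eq)
  next
    case True
    show ?thesis
    proof (cases "i = 0")
      case True
      with o k'(2) b show ?thesis by (auto simp: okb_def split: if_splits)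
    next
      case False
      with True obtain j where j: "i = 2 * j + 1" by (metis oddE)
      have "j < clb b"
        using i j k(2) cand_bounds[OF k(1)] pe_ge1[of "8*b+8" "8*b+8"] by linarith
      with Gr_class(1)[OF g(1) k(1)] Gr_class(1)[OF g(2) k'(1)] j b kk cls_cand[OF c] show ?thesis by simp
    qed
  qed
  moreover have "told N y y'" using sep by (simp add: sep_def)
  ultimately show ?thesis using b told_eqI by blast
qed

lemma lPE_mod4: "lPE N s y a b \<Longrightarrow> a mod 4 \<noteq> 3"
  by (auto simp: lPE_def Gr_mod4)

text \<open>The residue of \<open>a\<close> modulo 4 distinguishes the three kinds of steps; the
  label or, for grants, the level then tells the generator.\<close>

lemma lPE_unique:
  assumes sep: "sep Y N" "y \<in> Y" "y' \<in> Y" and l: "lPE N s y a b" "lPE N s' y' a b'"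
  shows "s = s' \<and> y = y' \<and> b = b'"
proof -
  have m: "Gr c a d \<Longrightarrow> a \<noteq> D c' d' \<and> a \<noteq> E c' d'" for c d c' d' 
    using Gr_mod4[of c a d] by (metis mod4_D mod4_E zero_neq_numeral zero_neq_one)
  from l(1) consider "\<not> s" "a = D y b" "N \<le> b" | "s" "a = E y b" "N \<le> b" 
    | k where "s" "Gr y a b" "cand y k a b" "N \<le> k" unfolding lPE_def by blast
  then show ?thesis
  proof cases
    case 1
    then have d: "\<not> s'" "D y b = D y' b'" using l(2) m unfolding lPE_def by auto
    then have "b = b'" "pre y (hh b) = pre y' (hh b)" by (auto simp: D_def)
    with sep_label[OF sep 1(3)] 1 d show ?thesis by simp
  next
    case 2
    then have d: "s'" "E y b = E y' b'" using l(2) m unfolding lPE_def by auto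
    then have "b = b'" "pre y (hh b) = pre y' (hh b)" by (auto simp: E_def)
    with sep_label[OF sep 2(3)] 2 d show ?thesis by simp
  next
    case 3
    then have "s'" "Gr y' a b'" using l(2) m unfolding lPE_def by auto
    with Gr_sep[OF sep 3(2) _ 3(3,4)] 3 show ?thesis by simp
  qed
qed

section \<open>Words as maps and paths spelled by letters\<close>

definition st :: "bool \<times> bits \<Rightarrow> nat \<Rightarrow> nat" where
  "st a z = (if fst a then chi (snd a) z else ich (snd a) z)"

definition wv :: "(bool \<times> bits) list \<Rightarrow> nat \<Rightarrow> nat" where "wv w z = foldr st w z"

lemma wv_simps [simp]: "wv [] z = z" "wv (a # w) z = st a (wv w z)" "wv (v @ w) z = wv v (wv w z)"
  by (simp_all add: wv_def)

text \<open>The assignment looks reversed because the letters are those that lead to the parent: a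
  positive letter comes from an \<open>E\<close>-child, a negative one from a
  \<open>D\<close>-child.\<close>

definition onpath :: "(nat \<Rightarrow> bool \<times> bits) \<Rightarrow> nat \<Rightarrow> nat \<Rightarrow> bool" where
  "onpath a r m \<longleftrightarrow> (\<forall>q<r. (vtx ^^ q) m =
     (if fst (a q) then E (snd (a q)) else D (snd (a q))) (vtx ((vtx ^^ q) m)))"

lemma xi_0: "v mod 4 \<noteq> 3 \<Longrightarrow> xi b v s = 0"
  by (simp add: xi_def)

text \<open>Corresponding labels are initial segments of the same bits. Comparing their lengths
  needs the order of the vertices, which is carried along from the roots.\<close>

lemma onpath_coh:
  assumes "onpath a r m" "onpath a r m'" "rp In u m r" "rp In u' m' r" "u < u'"
  shows "coh r m m'"
proof -
  have *: "(vtx ^^ q) m < (vtx ^^ q) m' \<and> (q < r \<longrightarrow> (vtx ^^ q) m mod 4 = (vtx ^^ q) m' mod 4 \<and>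
    lab ((vtx ^^ q) m) = lab ((vtx ^^ q) m') mod 2 ^ hh (vtx ((vtx ^^ q) m)))" if "q \<le> r" for q
    using that
  proof (induction q rule: inc_induct)
    case base
    then show ?case using assms by (simp add: rp_def)
  next
    case (step q)
    define c where "c = (vtx ^^ q) m"
    define d where "d = (vtx ^^ q) m'"
    obtain s y where a: "a q = (s, y)" by (cases "a q")
    have less: "vtx c < vtx d" using step by (simp add: c_def d_def)
    have "(vtx ^^ q) m = (if s then E y else D y) (vtx ((vtx ^^ q) m))"
      using assms(1)[unfolded onpath_def, rule_format, OF step.hyps(2)] unfolding a fst_conv snd_conv .
    then have ce: "c = ch (\<not> s) (vtx c) (pre y (hh (vtx c))) (xi y (vtx c) (\<not> s))"
      by (simp add: c_def[symmetric] E_def D_def split: if_splits)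
    have "(vtx ^^ q) m' = (if s then E y else D y) (vtx ((vtx ^^ q) m'))"
      using assms(2)[unfolded onpath_def, rule_format, OF step.hyps(2)] unfolding a fst_conv snd_conv .
    then have de: "d = ch (\<not> s) (vtx d) (pre y (hh (vtx d))) (xi y (vtx d) (\<not> s))"
      by (simp add: d_def[symmetric] E_def D_def split: if_splits)
    have aux: "aux c = 0" "aux d = 0" using assms(3,4) step.hyps by (auto simp: rp_def okc_def c_def d_def)
    have ac: "xi y (vtx c) (\<not> s) = 0" using arg_cong[OF ce, of aux] aux by simp
    have ad: "xi y (vtx d) (\<not> s) = 0" using arg_cong[OF de, of aux] aux by simp
    have m4: "c mod 4 = d mod 4"
      using arg_cong[OF ce, of "\<lambda>x. x mod 4"] arg_cong[OF de, of "\<lambda>x. x mod 4"] by simp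
    have lc: "lab c = pre y (hh (vtx c))" using arg_cong[OF ce, of lab] by simp
    have ld: "lab d = pre y (hh (vtx d))" using arg_cong[OF de, of lab] by simp
    have l: "lab c = lab d mod 2 ^ hh (vtx c)"
      unfolding lc ld using pre_mod hh_mono less by simp
    then have "lab c \<le> lab d" by simp
    then have "pre y (hh (vtx c)) \<le> pre y (hh (vtx d))" by (simp add: lc ld)
    then have "c < d"
      using ch_strict_mono[OF less, of "pre y (hh (vtx c))" "pre y (hh (vtx d))" 0 0 "\<not> s"] ce de ac ad
      by simp
    with m4 l show ?case by (simp add: c_def d_def)
  qed
  then show ?thesis unfolding coh_def by simp
qed

text \<open>By \<open>onpath_coh\<close> two such grants would be related by \<open>prec\<close> and
  so differ in depth, but all grants of one generator have the same class.\<close>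

lemma own_cycle_unique:
  assumes "Gr y u m" "cand y k u m" "rp In u m r" "onpath a r m"
    and "Gr y u' m'" "cand y k' u' m'" "rp In u' m' r" "onpath a r m'"
  shows "u = u'"
proof -
  have False if "k < k'" "Gr y u m" "cand y k u m" "rp In u m r" "onpath a r m"
    "Gr y u' m'" "cand y k' u' m'" "rp In u' m' r" "onpath a r m'" for k k' u m u' m'
  proof -
    have "coh r m m'"
      using onpath_coh[OF that(5,9,4,8)] cand_less[OF that(3,7,1)] by simp
    then have "prec In y k k' m'" using precI that by blast
    then have "depth y k m < depth y k' m'" using depth_less that by blast
    then show False using Gr_same_depth(1)[OF that(2,3,6,7)] by simp
  qed
  from this[of k k' u m u' m'] this[of k' k u' m' u m] assms
  have "k = k'" by (metis nat_neq_iff)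
  then show ?thesis using cand_unique(1) assms by metis
qed

text \<open>
  A closed walk that always goes to the parent.  It contains a grant of maximal level, and the next
  grant starts at the same root because the roots of higher levels are out of reach.
\<close>

locale upwalk =
  fixes a :: "nat \<Rightarrow> bool \<times> bits" and z :: "nat \<Rightarrow> nat" and l N :: nat and Y
  assumes l: "0 < l" and per: "\<And>i. a (i + l) = a i" "\<And>i. z (i + l) = z i"
    and sep: "sep Y N" and Y: "\<And>i. snd (a i) \<in> Y" and red: "\<And>i. \<not> cancels (a (Suc i)) (a i)"
    and up: "\<And>i. lPE N (fst (a i)) (snd (a i)) (z i) (z (Suc i))" and lN: "l \<le> N"
begin

definition isG :: "nat \<Rightarrow> bool" where "isG i \<longleftrightarrow> Gr (snd (a i)) (z i) (z (Suc i)) \<and> fst (a i)"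

lemma tree_step:
  assumes "\<not> isG i"
  shows "z i = (if fst (a i) then E (snd (a i)) else D (snd (a i))) (z (Suc i))"
    "N \<le> z (Suc i)" "fst (a i) \<Longrightarrow> dn (snd (a i)) (z i)"
  using up[of i] assms by (auto simp: lPE_def isG_def)

lemma z_mod: "z i mod 4 \<noteq> 3" using lPE_mod4[OF up] .

lemma tree_vtx: "\<not> isG i \<Longrightarrow> vtx (z i) = z (Suc i)"
  using tree_step(1)[of i] by (metis vtx_D vtx_E)

lemma tree_decr: "\<not> isG i \<Longrightarrow> z (Suc i) < z i"
  using tree_step(1)[of i] D_gt[of "z (Suc i)" "snd (a i)"] E_gt[of "z (Suc i)" "snd (a i)"]
  by (metis)

lemma tree_code:
  assumes "\<not> isG i"
  shows "z i = ch (\<not> fst (a i)) (z (Suc i)) (pre (snd (a i)) (hh (z (Suc i)))) 0"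
  using tree_step(1)[OF assms] xi_0[OF z_mod[of "Suc i"]] by (simp add: D_def E_def split: if_splits)

lemma tree_FF: "\<not> isG i \<Longrightarrow> z i \<le> FF (z (Suc i))"
proof -
  assume *: "\<not> isG i"
  have "pe (z (Suc i)) (pe (pre (snd (a i)) (hh (z (Suc i)))) 0) \<le> pe (z (Suc i)) (pe (2 ^ hh (z (Suc i))) 0)"
    by (intro pe_mono) (auto intro: less_imp_le_nat[OF pre_less])
  then show ?thesis unfolding FF_def by (subst tree_code[OF *]) (simp add: ch_def)
qed

lemma isG_per: "isG (i + l) = isG i"
  using per(1)[of i] per(2)[of i] per(2)[of "Suc i"] by (simp add: isG_def)

text \<open>Without a grant the walk would decrease strictly through a whole period.\<close>

lemma ex_isG: "\<exists>j. i \<le> j \<and> j < i + l \<and> isG j"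
proof (rule ccontr)
  assume *: "\<not> ?thesis"
  have "z (i + Suc q) < z i" if "q < l" for q
    using that
  proof (induction q)
    case 0
    then show ?case using tree_decr[of i] * l by auto
  next
    case (Suc q)
    then have "\<not> isG (i + Suc q)" using * by auto
    from tree_decr[OF this] Suc show ?case by simp
  qed
  from this[of "l - 1"] l per(2)[of i] show False by simp
qed

lemma tree_run:
  assumes "\<And>q. q < n \<Longrightarrow> \<not> isG (i + q)"
  shows "(vtx ^^ n) (z i) = z (i + n)" "z i \<le> (FF ^^ n) (z (i + n))"
  using assms
proof (induction n)
  case (Suc n)
  {
    case 1
    then show ?case using Suc tree_vtx[of "i + n"] by simp
  next
    case 2
    have "z i \<le> (FF ^^ n) (z (i + n))" using 2 Suc by simp
    also have "\<dots> \<le> (FF ^^ n) (FF (z (i + Suc n)))"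
      using tree_FF[of "i + n"] 2 by (intro FF_pow_mono) simp
    finally show ?case by (simp add: funpow_swap1)
  }
qed simp_all

lemma G_level:
  assumes "isG i"
  obtains k where "cand (snd (a i)) k (z i) (z (Suc i))" "N \<le> k"
proof -
  have "z i mod 4 = 0" using assms Gr_mod4 by (auto simp: isG_def)
  moreover have "D y b mod 4 \<noteq> 0" "E y b mod 4 \<noteq> 0" for y b by simp_all
  ultimately show thesis using up[of i] that unfolding lPE_def by metis
qed

lemma own_cycle:
  "\<exists>i<l. \<exists>r<l. \<exists>k m. Gr (snd (a i)) (z i) m \<and> cand (snd (a i)) k (z i) m \<and> rp In (z i) m r \<and>
     onpath (\<lambda>q. a (i + 1 + q)) r m"
proof -
  define K where "K i = (SOME k. cand (snd (a i)) k (z i) (z (Suc i)) \<and> N \<le> k)" for i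
  have K: "cand (snd (a i)) (K i) (z i) (z (Suc i))" "N \<le> K i" if "isG i" for i
  proof -
    note g = that
    obtain k where "cand (snd (a i)) k (z i) (z (Suc i)) \<and> N \<le> k" using G_level[OF g] by blast
    then have "cand (snd (a i)) (K i) (z i) (z (Suc i)) \<and> N \<le> K i" unfolding K_def by (rule someI)
    then show "cand (snd (a i)) (K i) (z i) (z (Suc i))" "N \<le> K i" by auto
  qed
  define e where "e i = lev (snd (a i)) (K i)" for i
  have Kper: "K (i + l) = K i" for i
    using per(1)[of i] per(2)[of i] per(2)[of "Suc i"] by (simp add: K_def)
  have eper: "e (i + l) = e i" for i using Kper per(1)[of i] by (simp add: e_def)
  let ?G = "{i. i < l \<and> isG i}"
  have "finite ?G" by simp
  moreover have "?G \<noteq> {}" using ex_isG[of 0] by auto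
  ultimately have "Max (e ` ?G) \<in> e ` ?G" by (intro Max_in) auto
  then obtain i where i: "i < l" "isG i" "Max (e ` ?G) = e i" by auto
  have max: "e j \<le> e i" if "j < l" "isG j" for j
    unfolding i(3)[symmetric] using that by (intro Max_ge) auto
  define j where "j = (LEAST j. Suc i \<le> j \<and> isG j)"
  obtain j' where j': "Suc i \<le> j'" "j' < Suc i + l" "isG j'" using ex_isG[of "Suc i"] by auto
  have j: "Suc i \<le> j" "isG j" "j \<le> j'"
    using LeastI[of "\<lambda>j. Suc i \<le> j \<and> isG j" j'] Least_le[of "\<lambda>j. Suc i \<le> j \<and> isG j" j'] j'
    by (auto simp: j_def)
  have nG: "\<not> isG (Suc i + q)" if "q < j - Suc i" for q
    using not_less_Least[of "Suc i + q" "\<lambda>j. Suc i \<le> j \<and> isG j"] that by (auto simp: j_def)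
  define r where "r = j - Suc i"
  have r: "r < l" "Suc i + r = j" using j j' by (auto simp: r_def)
  have run: "(vtx ^^ q) (z (Suc i)) = z (Suc i + q)" if "q \<le> r" for q
    using tree_run(1)[of q "Suc i"] nG that by (simp add: r_def)
  have bound: "z (Suc i) \<le> (FF ^^ r) (z j)" using tree_run(2)[of r "Suc i"] nG r by (simp add: r_def)
  \<comment> \<open>The next grant may lie beyond the first period and is shifted back so that
    maximality applies to it.\<close>
  obtain j0 where j0: "j0 < l" "isG j0" "e j0 = e j"
  proof (cases "j < l")
    case False
    then have jl: "j = (j - l) + l" by simp
    have "isG (j - l)" using j(2) isG_per[of "j - l"] jl by simp
    moreover have "e (j - l) = e j" using eper[of "j - l"] jl by simp
    moreover have "j - l < l" using r i False by linarith
    ultimately show thesis using that by blast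
  qed (use that j in blast)
  have "e j \<le> e i" using max j0 by metis
  \<comment> \<open>The target of grant \<open>i\<close> is at least \<open>AA (e i)\<close>, but
    otherwise it would lie only \<open>r\<close> steps above a root of a lower level, and
    \<open>r\<close> does not exceed \<open>e i\<close>.\<close>
  moreover have "\<not> e j < e i"
  proof
    assume less: "e j < e i"
    obtain o' where o': "o' \<le> AA (e j)" "z j = rt (e j) o'"
      using K(1)[OF j(2)] by (auto simp: cand_def e_def)
    have "r \<le> e i" using r lN K(2)[OF i(2)] lev_ge[of "K i" "snd (a i)"] by (simp add: e_def)
    from ball_bound[OF less o'(1) this] bound o' have "z (Suc i) < AA (e i)" by simp
    moreover have "AA (e i) \<le> z (Suc i)" using K(1)[OF i(2)] by (simp add: cand_def e_def)
    ultimately show False by simp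
  qed
  ultimately have ee: "lev (snd (a i)) (K i) = lev (snd (a j)) (K j)" by (simp add: e_def)
  then have kk: "K j = K i" by (auto simp: lev_eq)
  have "cand (snd (a i)) = cand (snd (a j))"
    by (rule sep_level[OF sep Y Y K(2)[OF i(2)]]) (use ee kk in simp)
  then have zz: "z j = z i" using cand_unique(1) K(1)[OF i(2)] K(1)[OF j(2)] kk by metis
  have rp: "rp In (z i) (z (Suc i)) r"
    unfolding rp_def
  proof (intro conjI allI impI)
    show "(vtx ^^ r) (z (Suc i)) = z i" using run[of r] r zz by simp
    fix q assume q: "q < r"
    define p where "p = Suc i + q"
    have np: "\<not> isG p" using nG q by (simp add: p_def r_def)
    have zq: "(vtx ^^ q) (z (Suc i)) = z p" using run[of q] q by (simp add: p_def)
    have "\<not> In (z (Suc p)) (pre (snd (a p)) (hh (z (Suc p))))" if "fst (a p)"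
    proof -
      have "dn (snd (a p)) (z p)" by (rule tree_step(3)[OF np that])
      then show ?thesis using tree_vtx[OF np] by (simp add: dn_iff In_pre)
    qed
    moreover have "z p mod 4 = (if fst (a p) then 2 else 1)" by (subst tree_code[OF np]) simp
    moreover have "isch (z p)" "aux (z p) = 0" "vtx (z p) = z (Suc p)"
      "lab (z p) = pre (snd (a p)) (hh (z (Suc p)))"
      by (subst tree_code[OF np], simp)+
    ultimately show "okc In ((vtx ^^ q) (z (Suc i)))"
      unfolding zq okc_def by (auto simp: pre_less split: if_splits)
    assume q': "Suc q < r"
    have np': "\<not> isG (Suc p)" using nG[of "Suc q"] q' by (simp add: p_def r_def)
    \<comment> \<open>Agreement of the labels would identify the two generators by
      \<open>sep_label\<close>, and with opposite signs the letters would cancel.\<close>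
    show "nocan ((vtx ^^ q) (z (Suc i)))"
      unfolding zq nocan_def
    proof (intro impI notI)
      assume m4: "vtx (z p) mod 4 \<noteq> z p mod 4"
        and eq: "lab (vtx (z p)) = lab (z p) mod 2 ^ hh (vtx (vtx (z p)))"
      have c: "z p mod 4 = (if fst (a p) then 2 else 1)" by (subst tree_code[OF np]) simp
      have c': "z (Suc p) mod 4 = (if fst (a (Suc p)) then 2 else 1)" by (subst tree_code[OF np']) simp
      have s: "fst (a (Suc p)) \<noteq> fst (a p)" using m4 c c' tree_vtx[OF np] by (auto split: if_splits)
      let ?w = "z (Suc (Suc p))"
      have "lab (z (Suc p)) = pre (snd (a (Suc p))) (hh ?w)" by (subst tree_code[OF np']) simp
      moreover have "lab (z p) = pre (snd (a p)) (hh (z (Suc p)))" by (subst tree_code[OF np]) simp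
      moreover have "hh ?w \<le> hh (z (Suc p))" using tree_decr[OF np'] by (intro hh_mono) simp
      ultimately have "pre (snd (a (Suc p))) (hh ?w) = pre (snd (a p)) (hh ?w)"
        using eq tree_vtx[OF np] tree_vtx[OF np'] pre_mod by simp
      from sep_label[OF sep Y Y tree_step(2)[OF np'] this] s red[of p]
      show False by (simp add: cancels_def)
    qed
  qed
  have "onpath (\<lambda>q. a (i + 1 + q)) r (z (Suc i))"
    unfolding onpath_def
  proof (intro allI impI)
    fix q assume q: "q < r"
    define p where "p = Suc i + q"
    have np: "\<not> isG p" using nG q by (simp add: p_def r_def)
    have zq: "(vtx ^^ q) (z (Suc i)) = z p" using run[of q] q by (simp add: p_def)
    show "(vtx ^^ q) (z (Suc i)) = (if fst (a (i + 1 + q)) then E (snd (a (i + 1 + q))) else D (snd (a (i + 1 + q))))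
        (vtx ((vtx ^^ q) (z (Suc i))))"
      unfolding zq tree_vtx[OF np] using tree_step(1)[OF np] by (simp add: p_def)
  qed
  with rp i r K(1)[OF i(2)] show ?thesis by (auto simp: isG_def)
qed

end

section \<open>Closed walks of cyclically reduced words\<close>

definition nx :: "bool \<times> bits \<Rightarrow> bool \<times> bits" where "nx a = (\<not> fst a, snd a)"

lemma st_nx [simp]: "st (nx a) (st a z) = z" "st a (st (nx a) z) = z"
  by (auto simp: st_def nx_def ich_chi chi_ich)

lemma bij_st: "bij (st a)"
  by (rule o_bij[of "st (nx a)"]) (auto simp: fun_eq_iff)

lemma cancels_sym: "cancels a b = cancels b a"
  by (auto simp: cancels_def)

lemma cancels_nx: "cancels a b \<longleftrightarrow> a = nx b"
  by (auto simp: cancels_def nx_def prod_eq_iff)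

definition wk :: "(nat \<Rightarrow> bool \<times> bits) \<Rightarrow> nat \<Rightarrow> nat \<Rightarrow> nat" where
  "wk a z i = rec_nat z (\<lambda>i x. st (a i) x) i"

lemma wk_simps [simp]: "wk a z 0 = z" "wk a z (Suc i) = st (a i) (wk a z i)"
  by (simp_all add: wk_def)

lemma inj_wk: "inj (\<lambda>z. wk a z i)"
proof (induction i)
  case (Suc i)
  from inj_compose[OF bij_is_inj[OF bij_st[of "a i"]] this] show ?case by (simp add: comp_def)
qed (simp add: inj_on_def)

lemma wk_eq_wv: "wk a z i = wv (rev (map a [0..<i])) z"
  by (induction i) auto

text \<open>The threshold excludes only sources of candidates of small level,
  \<open>E\<close>-children of small vertices, and small vertices. Negative letters reduce to
  positive ones by transport along \<open>chi y\<close>.\<close>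

lemma finite_not_late:
  "finite {x. \<not> lPE N (fst a) (snd a) x (st a x) \<and> \<not> lPE N (\<not> fst a) (snd a) (st a x) x}"
proof -
  obtain s y where a: "a = (s, y)" by (cases a)
  define B where "B = {x. \<not> lPE N True y x (chi y x) \<and> \<not> lPE N False y (chi y x) x}"
  have "finite {u. \<exists>m. cand y k u m}" for k
  proof (cases "\<exists>u m. cand y k u m")
    case True
    then obtain u m where "cand y k u m" by blast
    then have "{u. \<exists>m. cand y k u m} \<subseteq> {u}" using cand_unique(1) by blast
    then show ?thesis using finite_subset by blast
  qed simp
  then have "finite ((\<Union>k<N. {u. \<exists>m. cand y k u m}) \<union> E y ` {..<N} \<union> {..<N})" by auto
  moreover have "B \<subseteq> (\<Union>k<N. {u. \<exists>m. cand y k u m}) \<union> E y ` {..<N} \<union> {..<N}"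
  proof
    fix x assume x: "x \<in> B"
    show "x \<in> (\<Union>k<N. {u. \<exists>m. cand y k u m}) \<union> E y ` {..<N} \<union> {..<N}"
    proof (cases rule: chi_cases[of y x])
      case Gr
      then obtain k where "cand y k x (chi y x)" by (rule Gr_cand)
      with x Gr show ?thesis unfolding B_def lPE_def by (auto simp: not_le)
    next
      case dn
      then have "\<not> N \<le> chi y x" using x unfolding B_def lPE_def by auto
      with dn(2) show ?thesis by auto
    next
      case att
      then show ?thesis using x unfolding B_def lPE_def by auto
    qed
  qed
  ultimately have B: "finite B" by (rule finite_subset[rotated])
  show ?thesis
  proof (cases s)
    case True
    then show ?thesis using B by (simp add: a B_def st_def)
  next
    case False
    have "{x. \<not> lPE N False y x (ich y x) \<and> \<not> lPE N True y (ich y x) x} \<subseteq> chi y ` B"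
    proof
      fix x assume "x \<in> {x. \<not> lPE N False y x (ich y x) \<and> \<not> lPE N True y (ich y x) x}"
      then have "ich y x \<in> B" by (simp add: B_def chi_ich)
      then show "x \<in> chi y ` B" using chi_ich by (metis image_eqI)
    qed
    with B show ?thesis using False by (simp add: a st_def) (meson finite_imageI finite_subset)
  qed
qed

definition roots_on :: "(nat \<Rightarrow> bool \<times> bits) \<Rightarrow> nat \<Rightarrow> nat set" where
  "roots_on a l = {u. \<exists>i<l. \<exists>r<l. \<exists>k m. Gr (snd (a i)) u m \<and> cand (snd (a i)) k u m \<and> rp In u m r \<and>
     onpath (\<lambda>q. a (i + 1 + q)) r m}"

lemma finite_roots_on: "finite (roots_on a l)"
proof -
  define R where "R i r = {u. \<exists>k m. Gr (snd (a i)) u m \<and> cand (snd (a i)) k u m \<and> rp In u m r \<and>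
     onpath (\<lambda>q. a (i + 1 + q)) r m}" for i r
  have "finite (R i r)" for i r
  proof (cases "R i r = {}")
    case False
    then obtain u where "u \<in> R i r" by blast
    then have "R i r \<subseteq> {u}" unfolding R_def using own_cycle_unique by blast
    then show ?thesis using finite_subset by blast
  qed simp
  moreover have "roots_on a l = (\<Union>i<l. \<Union>r<l. R i r)" unfolding roots_on_def R_def by blast
  ultimately show ?thesis by simp
qed

text \<open>A fixed point yields a periodic walk. Outside finitely many points every step goes to
  the parent or comes from it, and a step from the parent is followed by another one. So the walk or
  its reversal is an \<open>upwalk\<close>, which meets one of finitely many roots.\<close>

lemma finite_fixed_cyclic:
  assumes w: "w \<noteq> []" "reduced w" "\<not> cancels (last w) (hd w)"
  shows "finite {z. wv w z = z}"
proof -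
  define l where "l = length w"
  define a where "a i = rev w ! (i mod l)" for i
  have l: "0 < l" using w by (simp add: l_def)
  have aw: "a i = w ! (l - 1 - i mod l)" for i
    using l by (simp add: a_def rev_nth l_def)
  have red: "\<not> cancels (a (Suc i)) (a i)" for i
  proof (cases "Suc (i mod l) < l")
    case True
    then have "Suc i mod l = Suc (i mod l)" by (simp add: mod_Suc)
    moreover from True have "Suc (l - 1 - Suc (i mod l)) = l - 1 - i mod l" by simp
    moreover have "Suc (l - 1 - Suc (i mod l)) < length w" using True by (simp add: l_def)
    then have "\<not> cancels (w ! (l - 1 - Suc (i mod l))) (w ! Suc (l - 1 - Suc (i mod l)))"
      using w(2) by (simp add: reduced_def successively_conv_nth)
    ultimately show ?thesis by (simp add: aw)
  next
    case False
    then have i: "Suc (i mod l) = l" using l by (metis Suc_lessI mod_less_divisor)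
    then have "Suc i mod l = 0" by (simp add: mod_Suc)
    with i l w show ?thesis by (simp add: aw last_conv_nth hd_conv_nth flip: l_def) 
  qed
  have aper: "a (i + l) = a i" for i by (simp add: a_def)
  have wl: "rev (map a [0..<l]) = w"
  proof -
    have "map a [0..<l] = rev w" by (rule nth_equalityI) (auto simp: a_def l_def)
    then show ?thesis by simp
  qed
  define Y where "Y = snd ` set w"
  have Ya: "snd (a i) \<in> Y" for i using l by (auto simp: aw Y_def l_def intro!: imageI nth_mem)
  have "finite Y" by (simp add: Y_def)
  then obtain N0 where "sep Y N0" using sep_exists by blast
  then obtain N where N: "sep Y N" "l \<le> N" using sep_mono[of Y N0 "max N0 l"] by auto
  \<comment> \<open>Modulo the period \<open>l\<close> the index is \<open>- (i + 1)\<close>: the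
    inverse letters are read backwards.\<close>
  define a' where "a' i = nx (a (i * (l - 1) + (l - 1)))" for i
  have perm: "f (p + n * l) = f p" if "\<And>i. f (i + l) = f i" for f :: "nat \<Rightarrow> 'a" and p n
  proof (induction n)
    case (Suc n)
    have "p + Suc n * l = (p + n * l) + l" by simp
    then show ?case using that Suc by metis
  qed simp
  let ?late = "\<lambda>c x. lPE N (fst c) (snd c) x (st c x) \<or> lPE N (\<not> fst c) (snd c) (st c x) x"
  have "{z. wv w z = z} \<subseteq> (\<Union>i<l. (\<lambda>z. wk a z i) -` {x. \<not> ?late (a i) x}) \<union>
    (\<Union>i<l. (\<lambda>z. wk a z i) -` roots_on a l) \<union> (\<Union>i<l. (\<lambda>z. wk a z (i * (l - 1))) -` roots_on a' l)"
  proof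
    fix z assume "z \<in> {z. wv w z = z}"
    then have zl: "wk a z l = z" by (simp add: wk_eq_wv wl)
    define x where "x = wk a z"
    have xper: "x (i + l) = x i" for i
    proof (induction i)
      case (Suc i) then show ?case by (simp add: x_def aper)
    qed (simp add: x_def zl)
    have xs: "x (Suc i) = st (a i) (x i)" for i by (simp add: x_def)
    show "z \<in> (\<Union>i<l. (\<lambda>z. wk a z i) -` {x. \<not> ?late (a i) x}) \<union>
      (\<Union>i<l. (\<lambda>z. wk a z i) -` roots_on a l) \<union> (\<Union>i<l. (\<lambda>z. wk a z (i * (l - 1))) -` roots_on a' l)"
    proof (cases "\<exists>i<l. \<not> ?late (a i) (x i)")
      case True then show ?thesis by (auto simp: x_def)
    next
      case False
      define U where "U i = lPE N (fst (a i)) (snd (a i)) (x i) (x (Suc i))" for i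
      define V where "V i = lPE N (\<not> fst (a i)) (snd (a i)) (x (Suc i)) (x i)" for i
      have Vper: "V (i + l) = V i" for i
        using xper[of i] xper[of "Suc i"] by (simp add: V_def aper)
      have Uper: "U (i + l) = U i" for i
        using xper[of i] xper[of "Suc i"] by (simp add: U_def aper)
      have UV: "U i \<or> V i" for i
      proof -
        have "U (i mod l) \<or> V (i mod l)"
          using False l by (auto simp: U_def V_def xs)
        moreover have "i mod l + (i div l) * l = i" by simp
        ultimately show ?thesis
          using perm[of U "i mod l" "i div l"] perm[of V "i mod l" "i div l"] Uper Vper by metis
      qed
      \<comment> \<open>Otherwise two steps lead from the same vertex to a parent; by uniqueness
        they use the same signed letter, so the word would cancel here.\<close>
      have VV: "V (Suc i)" if "V i" for i
      proof (rule ccontr)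
        assume "\<not> V (Suc i)"
        then have "U (Suc i)" using UV by blast
        with that lPE_unique[OF N(1) Ya Ya] red[of i]
        show False unfolding U_def V_def cancels_def by metis
      qed
      show ?thesis
      proof (cases "\<forall>i. U i")
        case True
        have "upwalk a x l N Y"
          by unfold_locales (use l aper xper N Ya red True in \<open>auto simp: U_def\<close>)
        from upwalk.own_cycle[OF this] obtain i where "i < l" "x i \<in> roots_on a l"
          unfolding roots_on_def by blast
        then show ?thesis by (auto simp: x_def)
      next
        case False
        then obtain i where "V i" using UV by blast
        then have Vj: "V (i + j)" for j by (induction j) (auto intro: VV)
        have V: "V j" for j
        proof -
          have "i \<le> j + i * l" using l by (cases l) auto
          then have "V (j + i * l)" using Vj[of "j + i * l - i"] by simp
          then show ?thesis using perm[of V j i] Vper by metis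
        qed
        define x' where "x' i = x (i * (l - 1))" for i
        have x'1: "x' (Suc i) = x (i * (l - 1) + (l - 1))" for i by (simp add: x'_def add.commute)
        have x'0: "x' i = x (Suc (i * (l - 1) + (l - 1)))" for i
        proof -
          have "Suc (i * (l - 1) + (l - 1)) = i * (l - 1) + l" using l by simp
          then show ?thesis by (simp only: x'_def xper)
        qed
        have "upwalk a' x' l N Y"
        proof
          fix i
          have il: "(i + l) * (l - 1) = i * (l - 1) + (l - 1) * l" using l by (cases l) (simp_all add: algebra_simps)
          have il': "(i + l) * (l - 1) + (l - 1) = i * (l - 1) + (l - 1) + (l - 1) * l" using l by (cases l) (simp_all add: algebra_simps)
          show "a' (i + l) = a' i" unfolding a'_def il' using perm[of a] aper by simp
          show "x' (i + l) = x' i" unfolding x'_def il using perm[of x] xper by simp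
          show "snd (a' i) \<in> Y" using Ya by (simp add: a'_def nx_def)
          show "\<not> cancels (a' (Suc i)) (a' i)"
          proof -
            let ?p = "Suc i * (l - 1) + (l - 1)"
            have "Suc ?p = (i * (l - 1) + (l - 1)) + l" using l by simp
            then have "a (i * (l - 1) + (l - 1)) = a (Suc ?p)" using aper by metis
            then show ?thesis using red[of ?p] by (auto simp: a'_def cancels_def nx_def)
          qed
          show "lPE N (fst (a' i)) (snd (a' i)) (x' i) (x' (Suc i))"
            using V[of "i * (l - 1) + (l - 1)"] unfolding x'0[of i] x'1 V_def by (simp add: a'_def nx_def)
        qed (use l N in auto)
        from upwalk.own_cycle[OF this] obtain i where "i < l" "x' i \<in> roots_on a' l"
          unfolding roots_on_def by blast
        then show ?thesis by (auto simp: x_def x'_def)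
      qed
    qed
  qed
  moreover have "finite ((\<lambda>z. wk a z i) -` {x. \<not> ?late (a i) x})" for i
    using finite_vimageI[OF finite_not_late[of N "a i"] inj_wk[of a i]] by simp
  moreover have "finite ((\<lambda>z. wk a z i) -` roots_on b l)" for i b
    using finite_vimageI[OF finite_roots_on inj_wk] by blast
  ultimately show ?thesis by (meson finite_UN_I finite_UnI finite_lessThan finite_subset)
qed

text \<open>Removing a cancelling pair of outer letters is a conjugation, which moves the fixed
  points by the bijection \<open>st b\<close>.\<close>

theorem finite_fixed:
  "w \<noteq> [] \<Longrightarrow> reduced w \<Longrightarrow> finite {z. wv w z = z}"
proof (induction w rule: length_induct)
  case (1 w)
  show ?case
  proof (cases "cancels (last w) (hd w)")
    case False
    then show ?thesis using finite_fixed_cyclic 1 by blast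
  next
    case True
    obtain b w' where w': "w = b # w'" using 1 by (cases w) auto
    with True have "w' \<noteq> []" by (auto simp: cancels_def)
    then obtain v c where v: "w = b # v @ [c]" using w' by (metis append_butlast_last_id)
    with True have c: "c = nx b" by (simp add: cancels_nx)
    have rv: "reduced v" using 1(3) unfolding v reduced_def by (auto simp: successively_Cons successively_append_iff)
    have vn: "v \<noteq> []"
    proof
      assume "v = []"
      then show False using 1(3) c v by (auto simp: reduced_def cancels_def nx_def)
    qed
    have fin: "finite {z. wv v z = z}" using 1(1) v vn rv by simp
    have "{z. wv w z = z} \<subseteq> st b ` {z. wv v z = z}"
    proof
      fix z assume "z \<in> {z. wv w z = z}"
      then have "st b (wv v (st (nx b) z)) = z" by (simp add: v c)
      then have "wv v (st (nx b) z) = st (nx b) z" by (metis st_nx(1))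
      then show "z \<in> st b ` {z. wv v z = z}" by (metis (mono_tags) image_eqI mem_Collect_eq st_nx(2))
    qed
    with fin show ?thesis by (meson finite_imageI finite_subset)
  qed
qed

text \<open>Apart from grants, a letter leads down only from a child in the opposite direction that
  carries a label of the same generator; the second hypothesis excludes this.\<close>

lemma st_up:
  assumes "if s then \<not> (\<exists>m. Gr y v m) else \<not> (\<exists>u. Gr y u v)"
    and "v mod 4 = (if s then 2 else 1) \<Longrightarrow> lab v \<noteq> pre y (hh (vtx v))"
  shows "st (s, y) v = (if s then D y v else E y v)"
proof (cases s)
  case True
  have "\<not> dn y v"
  proof
    assume "dn y v"
    then have e: "v = E y (vtx v)" by (simp add: dn_iff)
    have "v mod 4 = 2" "lab v = pre y (hh (vtx v))" by (subst e, simp add: E_def)+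
    with assms(2) True show False by simp
  qed
  with assms(1) True have "att y v" by (simp add: att_def)
  with True show ?thesis by (simp add: st_def chi_att)
next
  case False
  have "D y (vtx v) \<noteq> v"
  proof
    assume "D y (vtx v) = v"
    then have e: "v = D y (vtx v)" by simp
    have "v mod 4 = 1" "lab v = pre y (hh (vtx v))" by (subst e, simp add: D_def)+
    with assms(2) False show False by simp
  qed
  with assms(1) False show ?thesis by (simp add: st_def ich_def)
qed

lemma chi_reveal: "v mod 4 = 3 \<Longrightarrow> chi b v = D b v"
  by (rule chi_att) (metis Gr_mod4 att_def dn_iff mod4_E numeral_eq_iff zero_neq_numeral semiring_norm(88))

text \<open>At numbers congruent to 3 modulo 4 the values are always \<open>D\<close>-children,
  whose labels display arbitrarily long initial segments of the bits.\<close>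

lemma inj_chi: "inj chi"
proof
  fix b c assume *: "chi b = chi c"
  have "b i = c i" for i
  proof -
    have m: "(4 * i + 3) mod 4 = (3::nat)" by presburger
    have "D b (4 * i + 3) = D c (4 * i + 3)"
      using chi_reveal[OF m] fun_cong[OF *] by metis
    then have "pre b (hh (4 * i + 3)) = pre c (hh (4 * i + 3))" by (simp add: D_def)
    then show ?thesis using hh_ge[of "4 * i + 3"] by (simp add: pre_eq_iff)
  qed
  then show "b = c" by blast
qed

section \<open>The generated group\<close>

abbreviation XX :: "(nat \<Rightarrow> nat) set" where "XX \<equiv> range chi"

lemma group_S_infinity: "group S_infinity"
  by (rule group_BijGroup)

lemma XX_carrier: "XX \<subseteq> carrier S_infinity"
  using bij_chi by (auto simp: S_infinity_simps)

lemma m_inv_S_infinity: "bij f \<Longrightarrow> m_inv S_infinity f = inv_into UNIV f"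
  using inv_BijGroup[of f UNIV] by (auto simp: Bij_def bij_betw_def fun_eq_iff)

lemma m_inv_chi: "m_inv S_infinity (chi b) = ich b"
  by (simp add: m_inv_S_infinity bij_chi inv_chi)

lemma bij_ich: "bij (ich b)"
  by (rule o_bij[of "chi b"]) (auto simp: fun_eq_iff ich_chi chi_ich)

lemma bij_wv: "bij (wv w)"
proof (induction w)
  case (Cons a w)
  have "wv (a # w) = st a \<circ> wv w" by (simp add: fun_eq_iff)
  with bij_comp[OF Cons bij_st[of a]] show ?case by (simp only:)
next
  case Nil
  have "wv [] = id" by (simp add: fun_eq_iff)
  then show ?case by (simp only: bij_id)
qed

text \<open>Passes from words over permutations to words over bit sequences, on which the
  combinatorics is done.\<close>

lemma word_value_wv: "word_value S_infinity (map (map_prod id chi) w) = wv w"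
proof (induction w)
  case Nil
  show ?case by (simp add: word_value_def S_infinity_simps fun_eq_iff)
next
  case (Cons a w)
  obtain s b where a: "a = (s, b)" by (cases a)
  have "word_value S_infinity (map (map_prod id chi) (a # w)) =
    (if s then chi b else ich b) \<otimes>\<^bsub>S_infinity\<^esub> word_value S_infinity (map (map_prod id chi) w)"
    by (simp add: a word_value_def m_inv_chi)
  also have "\<dots> = (if s then chi b else ich b) \<circ> wv w"
    unfolding Cons using bij_chi bij_ich bij_wv by (intro S_infinity_simps) auto
  also have "\<dots> = wv (a # w)" by (auto simp: a st_def fun_eq_iff)
  finally show ?case .
qed

lemma word_lift:
  assumes "w \<in> lists (UNIV \<times> XX)"
  obtains v where "w = map (map_prod id chi) v"
proof -
  have "UNIV \<times> XX = range (map_prod id chi)" by (auto simp: map_prod_def image_iff split: prod.splits)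
  then have "w \<in> map (map_prod id chi) ` lists UNIV" using assms by (metis lists_image)
  then show thesis using that by blast
qed

lemma reduced_lift: "reduced (map (map_prod id chi) v) = reduced v"
proof -
  have "cancels (map_prod id chi a) (map_prod id chi b) = cancels a b" for a b :: "bool \<times> bits"
    by (auto simp: cancels_def dest: injD[OF inj_chi])
  then show ?thesis by (simp add: reduced_def successively_map)
qed

lemma word_value_id:
  assumes "w \<in> carrier (free_group XX)" "w \<noteq> []"
  shows "finite {z. word_value S_infinity w z = z}"
proof -
  have "w \<in> lists (UNIV \<times> XX)" "reduced w" using assms(1) by (simp_all add: free_group_def)
  then obtain v where "w = map (map_prod id chi) v" "reduced v" using word_lift reduced_lift by metis
  with finite_fixed[of v] assms(2) show ?thesis by (simp add: word_value_wv)
qed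

lemma word_value_hom_XX:
  "group_hom (free_group XX) (S_infinity\<lparr>carrier := generate S_infinity XX\<rparr>) (word_value S_infinity)"
  using group.word_value_hom[OF group_S_infinity XX_carrier] group_free_group
    group.subgroup_imp_group[OF group_S_infinity group.generate_is_subgroup[OF group_S_infinity XX_carrier]]
  by (simp add: group_hom_def group_hom_axioms_def)

lemma generate_XX: "generate S_infinity XX = word_value S_infinity ` carrier (free_group XX)"
proof
  interpret h: group_hom "free_group XX" "S_infinity\<lparr>carrier := generate S_infinity XX\<rparr>" "word_value S_infinity"
    by (rule word_value_hom_XX)
  interpret G: group S_infinity by (rule group_S_infinity)
  show "word_value S_infinity ` carrier (free_group XX) \<subseteq> generate S_infinity XX"
    using h.hom_closed by auto
  have "subgroup (word_value S_infinity ` carrier (free_group XX)) (S_infinity\<lparr>carrier := generate S_infinity XX\<rparr>)"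
    by (rule h.img_is_subgroup)
  then have sub: "subgroup (word_value S_infinity ` carrier (free_group XX)) S_infinity"
    using G.incl_subgroup[OF G.generate_is_subgroup[OF XX_carrier]] by blast
  have "f \<in> word_value S_infinity ` carrier (free_group XX)" if "f \<in> XX" for f
  proof
    show "[(True, f)] \<in> carrier (free_group XX)" using that by (simp add: free_group_def reduced_def)
    show "f = word_value S_infinity [(True, f)]"
      using that XX_carrier by (auto simp: word_value_def S_infinity_simps bij_chi)
  qed
  then show "generate S_infinity XX \<subseteq> word_value S_infinity ` carrier (free_group XX)"
    using G.generate_subgroup_incl[OF _ sub] by blast
qed

theorem freely_generates_XX: "freely_generates S_infinity XX"
proof -
  interpret h: group_hom "free_group XX" "S_infinity\<lparr>carrier := generate S_infinity XX\<rparr>" "word_value S_infinity"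
    by (rule word_value_hom_XX)
  have "inj_on (word_value S_infinity) (carrier (free_group XX))"
  proof (rule h.inj_on_one_iff[THEN iffD2], intro allI impI)
    fix w assume w: "w \<in> carrier (free_group XX)"
      and 1: "word_value S_infinity w = \<one>\<^bsub>S_infinity\<lparr>carrier := generate S_infinity XX\<rparr>\<^esub>"
    show "w = \<one>\<^bsub>free_group XX\<^esub>"
    proof (rule ccontr)
      assume "w \<noteq> \<one>\<^bsub>free_group XX\<^esub>"
      then have "w \<noteq> []" by (simp add: free_group_def)
      from word_value_id[OF w this] 1 show False by (simp add: S_infinity_simps)
    qed
  qed
  then show ?thesis
    unfolding freely_generates_def iso_def bij_betw_def using h.homh generate_XX by simp
qed

theorem cofinitary_group_XX: "cofinitary_group (generate S_infinity XX)"
  unfolding cofinitary_group_def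
proof
  interpret G: group S_infinity by (rule group_S_infinity)
  show "subgroup (generate S_infinity XX) S_infinity" by (rule G.generate_is_subgroup[OF XX_carrier])
  show "\<forall>g\<in>generate S_infinity XX - {id}. cofinitary g"
  proof
    fix g assume g: "g \<in> generate S_infinity XX - {id}"
    then obtain w where w: "w \<in> carrier (free_group XX)" "g = word_value S_infinity w"
      using generate_XX by blast
    have "w \<noteq> []" using g w by (auto simp: word_value_def S_infinity_simps)
    with word_value_id w have "finite {n. g n = n}" by blast
    moreover have "g \<in> carrier S_infinity" using g G.generate_in_carrier[OF XX_carrier] by blast
    ultimately show "cofinitary g" using g by (simp add: cofinitary_def)
  qed
qed

lemma wv_in_generate: "wv w \<in> generate S_infinity XX"
proof -
  have "map (map_prod id chi) w \<in> lists (UNIV \<times> XX)" by (induction w) auto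
  from group.word_value_closed[OF group_S_infinity XX_carrier this] show ?thesis
    by (simp add: word_value_wv)
qed

lemma generate_wv: "g \<in> generate S_infinity XX \<Longrightarrow> \<exists>w. reduced w \<and> g = wv w"
proof -
  assume "g \<in> generate S_infinity XX"
  then obtain w where w: "w \<in> carrier (free_group XX)" "g = word_value S_infinity w"
    using generate_XX by blast
  then have "w \<in> lists (UNIV \<times> XX)" "reduced w" by (simp_all add: free_group_def)
  then obtain v where "w = map (map_prod id chi) v" "reduced v" using word_lift reduced_lift by metis
  with w show ?thesis by (auto simp: word_value_wv)
qed

text \<open>The composition of \<open>g\<close> with the inverse of \<open>wv w\<close> lies in
  \<open>H\<close> and has infinitely many fixed points, so it is the identity.\<close>

lemma caught:
  assumes H: "cofinitary_group H" "generate S_infinity XX \<subseteq> H" "g \<in> H"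
    and inf: "infinite {z. g z = wv w z}"
  shows "g \<in> generate S_infinity XX"
proof -
  interpret G: group S_infinity by (rule group_S_infinity)
  have sub: "subgroup H S_infinity" using H by (simp add: cofinitary_group_def)
  have bg: "bij g" using H(3) subgroup.subset[OF sub] by (auto simp: S_infinity_simps)
  have wH: "wv w \<in> H" using H(2) wv_in_generate by blast
  define f where "f = m_inv S_infinity (wv w) \<otimes>\<^bsub>S_infinity\<^esub> g"
  have fH: "f \<in> H" unfolding f_def
    by (intro subgroup.m_closed[OF sub] subgroup.m_inv_closed[OF sub] wH H(3))
  have f: "f = inv_into UNIV (wv w) \<circ> g"
    using bg bij_wv[of w] by (simp add: f_def m_inv_S_infinity S_infinity_simps bij_imp_bij_inv)
  have "{z. g z = wv w z} \<subseteq> {z. f z = z}"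
    using bij_wv[of w] by (auto simp: f bij_is_inj)
  then have "infinite {z. f z = z}" using inf finite_subset by blast
  then have "f = id" using H(1) fH by (auto simp: cofinitary_group_def cofinitary_def)
  have "g = wv w"
  proof
    fix z
    have "inv_into UNIV (wv w) (g z) = z" using \<open>f = id\<close> f by (metis comp_apply id_apply)
    then show "g z = wv w z" using bij_wv[of w] by (metis bij_inv_eq_iff)
  qed
  then show ?thesis using wv_in_generate by simp
qed

section \<open>Maximality\<close>

text \<open>
  The generator that claims the graph of \<open>g\<close> and grants the class \<open>n\<close>.
\<close>

definition mk :: "bool \<Rightarrow> nat \<Rightarrow> (nat \<Rightarrow> nat) \<Rightarrow> nat \<Rightarrow> bool" where
  "mk c n g i = (if i = 0 then c else if odd i then i div 2 = n
     else g (pfst (i div 2 - 1)) = psnd (i div 2 - 1))"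

lemma mk_simps [simp]: "mk c n g 0 = c" "mk c n g (Suc (2 * i)) = (i = n)"
  "mk c n g (Suc (Suc (2 * i))) = (g (pfst i) = psnd i)"
  by (auto simp: mk_def)

lemma cand_mk: "cand (mk c n g) = cand (mk False 0 g)"
  by (rule cand_gamma) simp

lemma cl_mk: "cl (mk c n g) u a \<longleftrightarrow> g u = a"
  by (simp add: cl_def)

text \<open>The root found by \<open>vroot\<close> is the start \<open>u\<close> of the path. Hence
  candidates related by \<open>prec\<close> lie in no system, and those in systems have depth
  0.\<close>

lemma sysno_own: "rp I u m r \<Longrightarrow> u mod 4 = 0 \<Longrightarrow> sysno m = 0"
proof -
  assume rp: "rp I u m r" and u: "u mod 4 = 0"
  let ?f = "\<lambda>c. if isch c then vtx c else c"
  have "(?f ^^ q) m = (vtx ^^ q) m" if "q \<le> r" for q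
    using that
  proof (induction q)
    case (Suc q)
    then have "isch ((vtx ^^ q) m)" using rp by (simp add: rp_def okc_def)
    with Suc show ?case by simp
  qed simp
  then have r: "(?f ^^ r) m = u" using rp by (simp add: rp_def)
  have "(?f ^^ (r + d)) m = u" for d
    by (induction d) (use r u in \<open>auto simp: isch_def\<close>)
  from this[of "m - r"] rp_le[OF rp] have "vroot m = u" by (simp add: vroot_def)
  with u show "sysno m = 0" by (simp add: sysno_def)
qed

section \<open>Candidates of a permutation\<close>

locale permutation =
  fixes g :: "nat \<Rightarrow> nat"
  assumes bij: "bij g"
begin

abbreviation "b \<equiv> mk False 0 g"

lemma cand_exists: "\<exists>u. cand b k u (g u)"
proof -
  let ?e = "lev b k"
  \<comment> \<open>Pigeonhole: \<open>g\<close> is injective on one more root than there are values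
    below the bound.\<close>
  have "\<exists>i\<le>AA ?e. AA ?e \<le> g (rt ?e i)"
  proof (rule ccontr)
    assume *: "\<not> ?thesis"
    have "inj_on (\<lambda>i. g (rt ?e i)) {..AA ?e}"
      by (rule inj_onI, drule injD[OF bij_is_inj[OF bij]]) (simp add: rt_def)
    moreover have "(\<lambda>i. g (rt ?e i)) ` {..AA ?e} \<subseteq> {..<AA ?e}" using * by auto
    ultimately have "card {..AA ?e} \<le> card {..<AA ?e}" by (rule card_inj_on_le) simp
    then show False by simp
  qed
  then obtain i0 where i0: "i0 \<le> AA ?e \<and> AA ?e \<le> g (rt ?e i0)" by blast
  define i where "i = (LEAST i. i \<le> AA ?e \<and> AA ?e \<le> g (rt ?e i))"
  have i: "i \<le> AA ?e" "AA ?e \<le> g (rt ?e i)" using LeastI[of "\<lambda>i. i \<le> AA ?e \<and> AA ?e \<le> g (rt ?e i)" i0] i0 by (auto simp: i_def)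
  have "g (rt ?e j) < AA ?e" if "j < i" for j
    using not_less_Least[of j "\<lambda>i. i \<le> AA ?e \<and> AA ?e \<le> g (rt ?e i)"] that i(1) by (auto simp: i_def)
  moreover have "k \<le> g (rt ?e i)" using lev_ge[of k b] AA_ge[of ?e] i(2) by linarith
  ultimately have "cand b k (rt ?e i) (g (rt ?e i))"
    unfolding cand_def cl_mk using i by auto
  then show ?thesis ..
qed

definition U :: "nat \<Rightarrow> nat" where "U k = (SOME u. cand b k u (g u))"
definition M :: "nat \<Rightarrow> nat" where "M k = g (U k)"

lemma cand_UM: "cand b k (U k) (M k)"
  unfolding M_def U_def by (rule someI_ex[OF cand_exists])

lemma U_mono: "j < k \<Longrightarrow> U j < U k"
  by (rule cand_less[OF cand_UM cand_UM])

lemma inj_U: "inj U"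
  by (rule strict_mono_imp_inj_on) (simp add: strict_mono_def U_mono)

lemma inj_M: "inj M"
  using inj_compose[OF bij_is_inj[OF bij] inj_U] by (simp add: comp_def M_def[abs_def])

lemma infinite_M_gt: "infinite K \<Longrightarrow> infinite {k \<in> K. n < M k}"
proof
  assume K: "infinite K" and fin: "finite {k \<in> K. n < M k}"
  have "finite (M -` {..n})" by (rule finite_vimageI[OF _ inj_M]) simp
  moreover have "K \<subseteq> {k \<in> K. n < M k} \<union> M -` {..n}" by auto
  ultimately show False using K fin by (meson finite_UnI finite_subset)
qed

lemma cand_M: "cand b j u m \<Longrightarrow> u = U j \<and> m = M j"
  using cand_unique cand_UM by blast

abbreviation cls_of :: "nat \<Rightarrow> nat" where "cls_of k \<equiv> cls In b k (M k)"

lemma Gr_mk: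
  assumes "okb (mk c n g) (M k)" "cls_of k = n"
  shows "Gr (mk c n g) (U k) (M k)"
  unfolding Gr_def GrI_def
proof (intro exI[of _ k] conjI)
  show "k \<le> M k" using cand_bounds[OF cand_UM] by blast
  show "cand (mk c n g) k (U k) (M k)" unfolding cand_mk[of c n g] by (rule cand_UM)
  show "\<forall>j<k. \<forall>u'\<le>8 * M k. \<not> cand (mk c n g) j u' (M k)"
  proof (intro allI impI notI)
    fix j u' assume "j < k" "cand (mk c n g) j u' (M k)"
    then have "M k = M j" using cand_M unfolding cand_mk[of c n g] by blast
    then have "k = j" by (rule injD[OF inj_M])
    with \<open>j < k\<close> show False by simp
  qed
  show "\<forall>i<pe (8 * M k + 8) (8 * M k + 8). mk c n g (2 * i + 1) = (i = cls In (mk c n g) k (M k))"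
    using assms(2) cls_cand[OF cand_mk[of c n g]] by simp
qed (rule assms(1))

definition caught_by_G :: bool where
  "caught_by_G \<longleftrightarrow> (\<exists>w. infinite {z. g z = wv w z})"

lemma caughtI: "infinite K \<Longrightarrow> (\<And>k. k \<in> K \<Longrightarrow> g (U k) = wv w (U k)) \<Longrightarrow> caught_by_G"
proof -
  assume K: "infinite K" and *: "\<And>k. k \<in> K \<Longrightarrow> g (U k) = wv w (U k)"
  have "infinite (U ` K)" using K inj_U by (meson finite_imageD inj_on_subset subset_UNIV)
  moreover have "U ` K \<subseteq> {z. g z = wv w z}" using * by auto
  ultimately show ?thesis unfolding caught_by_G_def using finite_subset by blast
qed

lemma class_caught:
  assumes "infinite {k. cls_of k = n}"
  shows caught_by_G
proof -
  let ?K = "\<lambda>c. {k. cls_of k = n \<and> okb (mk c n g) (M k)}"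
  \<comment> \<open>Each target admits one value of bit 0, so one of the two values serves
    infinitely many levels.\<close>
  have "{k. cls_of k = n} \<subseteq> ?K True \<union> ?K False" by (auto simp: okb_def)
  then obtain c where c: "infinite (?K c)" using assms by (meson finite_UnI finite_subset)
  show ?thesis
  proof (rule caughtI[OF c])
    fix k assume "k \<in> ?K c"
    then have "chi (mk c n g) (U k) = M k" by (intro chi_Gr Gr_mk) auto
    then show "g (U k) = wv [(True, mk c n g)] (U k)" by (simp add: st_def M_def)
  qed
qed

lemma sys_depth: "sysno (M k) \<noteq> 0 \<Longrightarrow> depth b k (M k) = 0"
proof -
  assume s: "sysno (M k) \<noteq> 0"
  have "\<not> prec In b j k (M k)" for j
    unfolding prec_def using s sysno_own cand_bounds by metis
  then show ?thesis by simp
qed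

lemma sty_M: "sty b k (M k) = (if sysno (M k) = 0 then 1
    else if \<exists>j<k. M j < M k \<and> sysno (M j) = sysno (M k) then Suc (sysno (M k)) else 0)"
proof -
  have "(\<exists>j<k. \<exists>m'<M k. \<exists>u\<le>8 * M k. cand b j u m' \<and> sysno m' = sysno (M k)) \<longleftrightarrow>
    (\<exists>j<k. M j < M k \<and> sysno (M j) = sysno (M k))" (is "?l \<longleftrightarrow> ?r")
  proof
    show ?r if ?l using that cand_M by blast
    assume ?r
    then obtain j where j: "j < k" "M j < M k" "sysno (M j) = sysno (M k)" by blast
    then have "U j \<le> 8 * M k" using cand_bounds[OF cand_UM[of j]] by linarith
    with j cand_UM show ?l by blast
  qed
  then show ?thesis by (simp add: sty_def)
qed

text \<open>Either one system contains infinitely many targets, and all but finitely many of them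
  have its later type, or infinitely many systems occur, and their first candidates all have type 0.
  As the depth is 0 in systems, one class is infinite.\<close>

lemma system_caught:
  assumes inf: "infinite {k. sysno (M k) \<noteq> 0}"
  shows caught_by_G
proof (cases "\<exists>s. s \<noteq> 0 \<and> infinite {k. sysno (M k) = s}")
  case True
  then obtain s where s: "s \<noteq> 0" "infinite {k. sysno (M k) = s}" by blast
  then obtain k0 where k0: "sysno (M k0) = s" by (metis (mono_tags, lifting) empty_Collect_eq finite.emptyI)
  have "infinite {k \<in> {k. sysno (M k) = s} - {..k0}. M k0 < M k}"
    by (rule infinite_M_gt) (use s in \<open>simp add: Diff_infinite_finite\<close>)
  moreover have "{k \<in> {k. sysno (M k) = s} - {..k0}. M k0 < M k} \<subseteq> {k. cls_of k = pe 0 (Suc s)}"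
    unfolding cls_def sty_M using sys_depth s k0 by auto
  ultimately show ?thesis using class_caught finite_subset by blast
next
  case False
  define first where "first s = (LEAST k. sysno (M k) = s)" for s
  let ?S = "(\<lambda>k. sysno (M k)) ` {k. sysno (M k) \<noteq> 0}"
  have infS: "infinite ?S"
  proof
    assume "finite ?S"
    moreover have "{k. sysno (M k) \<noteq> 0} = (\<Union>s\<in>?S. {k. sysno (M k) = s})" by auto
    moreover have "finite {k. sysno (M k) = s}" if "s \<in> ?S" for s
    proof -
      have "s \<noteq> 0" using that by auto
      with False show ?thesis by blast
    qed
    ultimately have "finite {k. sysno (M k) \<noteq> 0}" by (metis (no_types, lifting) finite_UN)
    with inf show False by simp
  qed
  have fs: "sysno (M (first s)) = s" if sS: "s \<in> ?S" for s
  proof -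
    obtain k where "sysno (M k) = s" using sS by blast
    then show ?thesis unfolding first_def by (rule LeastI)
  qed
  have "inj_on first ?S"
  proof (rule inj_onI)
    fix s s' assume s: "s \<in> ?S" "s' \<in> ?S" and e: "first s = first s'"
    have "s = sysno (M (first s))" by (rule fs[OF s(1), symmetric])
    also have "\<dots> = s'" unfolding e by (rule fs[OF s(2)])
    finally show "s = s'" .
  qed
  with infS have "infinite (first ` ?S)" using finite_imageD by blast
  moreover have "first ` ?S \<subseteq> {k. cls_of k = pe 0 0}"
  proof
    fix k assume "k \<in> first ` ?S"
    then obtain s where s: "s \<in> ?S" "k = first s" by blast
    then have "sysno (M k) = s" "s \<noteq> 0" using fs[OF s(1)] by blast+
    moreover have "sysno (M j) \<noteq> s" if "j < k" for j
      using not_less_Least[of j "\<lambda>k. sysno (M k) = s"] that s by (simp add: first_def)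
    ultimately show "k \<in> {k. cls_of k = pe 0 0}"
      unfolding cls_def sty_M using sys_depth by auto
  qed
  ultimately show ?thesis using class_caught finite_subset by blast
qed

lemma depth_caught:
  assumes "finite {k. sysno (M k) \<noteq> 0}" "infinite {k. depth b k (M k) = d}"
  shows caught_by_G
proof -
  have "infinite ({k. depth b k (M k) = d} - {k. sysno (M k) \<noteq> 0})"
    using assms by (simp add: Diff_infinite_finite)
  moreover have "{k. depth b k (M k) = d} - {k. sysno (M k) \<noteq> 0} \<subseteq> {k. cls_of k = pe d 1}"
    unfolding cls_def sty_M by auto
  ultimately show ?thesis using class_caught finite_subset by blast
qed

section \<open>The forest of candidates and its infinite branches\<close>

definition Q :: "nat \<Rightarrow> nat \<Rightarrow> bool" where "Q j k \<longleftrightarrow> j < k \<and> prec In b j k (M k)"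

lemma Q_less: "Q j k \<Longrightarrow> j < k" by (simp add: Q_def)

lemma Q_iff: "Q j k \<longleftrightarrow> j < k \<and> (\<exists>r. rp In (U j) (M j) r \<and> rp In (U k) (M k) r \<and> coh r (M j) (M k))"
proof
  assume "Q j k"
  then obtain m u u' r where "j < k" "cand b j u m" "cand b k u' (M k)" "rp In u m r" "rp In u' (M k) r"
    "coh r m (M k)" unfolding Q_def prec_def by blast
  moreover from this have "u = U j" "m = M j" "u' = U k" using cand_M by blast+
  ultimately show "j < k \<and> (\<exists>r. rp In (U j) (M j) r \<and> rp In (U k) (M k) r \<and> coh r (M j) (M k))" by blast
next
  assume "j < k \<and> (\<exists>r. rp In (U j) (M j) r \<and> rp In (U k) (M k) r \<and> coh r (M j) (M k))"
  then show "Q j k" unfolding Q_def using precI[OF cand_UM cand_UM] by blast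
qed

lemma Q_trans: "Q i j \<Longrightarrow> Q j k \<Longrightarrow> Q i k"
  unfolding Q_def using prec_trans[OF _ _ cand_UM] by (metis less_trans)

lemma rp_U_length: "rp In (U j) (M j) r \<Longrightarrow> rp In (U j) (M j) r' \<Longrightarrow> r = r'"
  using rp_length[of In "U j" "M j" r In r'] cand_bounds[OF cand_UM[of j]] by simp

text \<open>Both labels truncate the same label on the path to \<open>M k\<close>, so the shorter
  one truncates the longer one. Thus the predecessors of \<open>k\<close> form a chain.\<close>

lemma Q_linear: "Q i k \<Longrightarrow> Q j k \<Longrightarrow> i < j \<Longrightarrow> Q i j"
proof -
  assume "Q i k" "Q j k" and ij: "i < j"
  obtain r where 1: "rp In (U i) (M i) r" "rp In (U k) (M k) r" "coh r (M i) (M k)"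
    using \<open>Q i k\<close> unfolding Q_iff by blast
  obtain r' where 2: "rp In (U j) (M j) r'" "rp In (U k) (M k) r'" "coh r' (M j) (M k)"
    using \<open>Q j k\<close> unfolding Q_iff by blast
  have "r' = r" using rp_U_length[OF 2(2) 1(2)] .
  with 1 2 have r: "rp In (U i) (M i) r" "rp In (U k) (M k) r" "coh r (M i) (M k)"
    "rp In (U j) (M j) r" "coh r (M j) (M k)" by simp_all
  let ?c = "\<lambda>q. (vtx ^^ q)"
  have "?c q (M i) < ?c q (M j) \<and> (q < r \<longrightarrow> ?c q (M i) mod 4 = ?c q (M j) mod 4 \<and>
    lab (?c q (M i)) = lab (?c q (M j)) mod 2 ^ hh (vtx (?c q (M i))))" if "q \<le> r" for q
    using that
  proof (induction q rule: inc_induct)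
    case base
    then show ?case using r U_mono[OF ij] by (simp add: rp_def)
  next
    case (step q)
    let ?x = "?c q (M i)" and ?y = "?c q (M j)" and ?t = "lab (?c q (M k))"
    have less: "vtx ?x < vtx ?y" using step by simp
    have m4: "?x mod 4 = ?y mod 4" using r step.hyps by (simp add: coh_def)
    have lx: "lab ?x = ?t mod 2 ^ hh (vtx ?x)" and ly: "lab ?y = ?t mod 2 ^ hh (vtx ?y)"
      using r step.hyps by (simp_all add: coh_def)
    have "(2::nat) ^ hh (vtx ?x) dvd 2 ^ hh (vtx ?y)"
      using less by (intro le_imp_power_dvd hh_mono) simp
    then have l: "lab ?x = lab ?y mod 2 ^ hh (vtx ?x)"
      using lx ly by (simp add: mod_mod_cancel)
    have o: "okc In ?x" "okc In ?y" using r step.hyps by (auto simp: rp_def)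
    have "lab ?x \<le> lab ?y" unfolding l by simp
    from okc_less[OF o m4 this less] have "?x < ?y" .
    with m4 l show ?case by blast
  qed
  then have "coh r (M i) (M j)" unfolding coh_def by auto
  with r ij show "Q i j" unfolding Q_iff by blast
qed

lemma depth_Q: "depth b k (M k) = card {j. Q j k}"
  unfolding depth_card Q_def ..

lemma finite_Q: "finite {j. Q j k}"
  by (rule finite_subset[of _ "{..<k}"]) (auto dest: Q_less)

text \<open>By counting, the chain below \<open>k''\<close> has members after \<open>k\<close>; the
  predecessors of the least of them are exactly \<open>k\<close> and those of
  \<open>k\<close>.\<close>

lemma Q_next:
  assumes "Q k k''" "Suc (depth b k (M k)) < depth b k'' (M k'')"
  obtains j where "Q k j" "Q j k''" "depth b j (M j) = Suc (depth b k (M k))"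
proof -
  have "card (insert k {j. Q j k}) \<le> Suc (card {j. Q j k})" by (simp add: card_insert_if finite_Q)
  then have "card (insert k {j. Q j k}) < card {j. Q j k''}"
    using assms(2) unfolding depth_Q by linarith
  then have "\<not> {j. Q j k''} \<subseteq> insert k {j. Q j k}"
    using card_mono[of "insert k {j. Q j k}" "{j. Q j k''}"] finite_Q[of k] by auto
  then obtain i where i: "Q i k''" "i \<noteq> k" "\<not> Q i k" by blast
  have "k < i" using Q_linear[OF i(1) assms(1)] i by (metis nat_neq_iff)
  then have "Q k i" using Q_linear[OF assms(1) i(1)] by blast
  define j where "j = (LEAST j. Q k j \<and> Q j k'')"
  have j: "Q k j" "Q j k''" using LeastI[of "\<lambda>j. Q k j \<and> Q j k''" i] \<open>Q k i\<close> i by (auto simp: j_def)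
  have "{i. Q i j} = insert k {i. Q i k}"
  proof (rule Set.set_eqI, rule iffI)
    fix x assume "x \<in> {i. Q i j}"
    then have x: "Q x j" by simp
    show "x \<in> insert k {i. Q i k}"
    proof (cases x k rule: linorder_cases)
      case less then show ?thesis using Q_linear[OF x j(1)] by simp
    next
      case greater
      then have "Q k x \<and> Q x k''" using Q_linear[OF j(1) x] Q_trans[OF x j(2)] by simp
      then have "j \<le> x" unfolding j_def by (rule Least_le)
      with Q_less[OF x] show ?thesis by simp
    qed simp
  next
    fix x assume "x \<in> insert k {i. Q i k}"
    then show "x \<in> {i. Q i j}" using j(1) Q_trans by auto
  qed
  moreover have "k \<notin> {i. Q i k}" using Q_less by blast
  ultimately have "depth b j (M j) = Suc (depth b k (M k))"
    using finite_Q[of k] by (simp add: depth_Q)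
  with j that show thesis by blast
qed

text \<open>Koenig's lemma for the forest \<open>Q\<close>: finiteness of every depth gives finitely
  many minimal elements and finite branching, while there are infinitely many candidates.\<close>

lemma infinite_chain:
  assumes fin: "\<And>d. finite {k. depth b k (M k) = d}"
  obtains f where "\<And>n. Q (f n) (f (Suc n))"
proof -
  let ?big = "\<lambda>k. infinite {k'. Q k k'}"
  have fin': "finite {k. depth b k (M k) \<le> d}" for d
  proof -
    have "{k. depth b k (M k) \<le> d} = (\<Union>e\<le>d. {k. depth b k (M k) = e})" by auto
    then show ?thesis using fin by simp
  qed
  have "\<exists>k. ?big k"
  proof (rule ccontr)
    assume *: "\<not> ?thesis"
    have "UNIV \<subseteq> {k. depth b k (M k) \<le> 0} \<union> (\<Union>j\<in>{k. depth b k (M k) = 0}. {k'. Q j k'})"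
    proof
      fix k
      show "k \<in> {k. depth b k (M k) \<le> 0} \<union> (\<Union>j\<in>{k. depth b k (M k) = 0}. {k'. Q j k'})"
      proof (cases "depth b k (M k) = 0")
        case False
        then obtain j0 where "Q j0 k" using finite_Q[of k] by (auto simp: depth_Q)
        define j where "j = (LEAST j. Q j k)"
        have j: "Q j k" unfolding j_def using \<open>Q j0 k\<close> by (rule LeastI)
        have "{i. Q i j} = {}"
          using Q_trans[OF _ j] not_less_Least[of _ "\<lambda>j. Q j k"] Q_less by (auto simp: j_def[symmetric])
        then have "depth b j (M j) = 0" unfolding depth_Q by simp
        with j show ?thesis by blast
      qed simp
    qed
    moreover have "finite ({k. depth b k (M k) \<le> 0} \<union> (\<Union>j\<in>{k. depth b k (M k) = 0}. {k'. Q j k'}))"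
      using * by (intro finite_UnI finite_UN_I fin' fin) auto
    ultimately show False using finite_subset infinite_UNIV_nat by blast
  qed
  moreover have "\<exists>j. ?big j \<and> Q k j" if big: "?big k" for k
  proof (rule ccontr)
    assume *: "\<not> ?thesis"
    let ?d = "depth b k (M k)"
    have "{k'. Q k k'} \<subseteq> {j. depth b j (M j) \<le> Suc ?d} \<union>
      (\<Union>j\<in>{j. depth b j (M j) = Suc ?d \<and> Q k j}. {k'. Q j k'})"
    proof
      fix k' assume "k' \<in> {k'. Q k k'}"
      then have k': "Q k k'" by simp
      show "k' \<in> {j. depth b j (M j) \<le> Suc ?d} \<union>
        (\<Union>j\<in>{j. depth b j (M j) = Suc ?d \<and> Q k j}. {k'. Q j k'})"
      proof (cases "depth b k' (M k') \<le> Suc ?d")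
        case False
        then obtain j where "Q k j" "Q j k'" "depth b j (M j) = Suc ?d" using Q_next[OF k'] by auto
        then show ?thesis by blast
      qed simp
    qed
    moreover have "finite ({j. depth b j (M j) \<le> Suc ?d} \<union>
      (\<Union>j\<in>{j. depth b j (M j) = Suc ?d \<and> Q k j}. {k'. Q j k'}))"
    proof (intro finite_UnI finite_UN_I fin')
      show "finite {j. depth b j (M j) = Suc ?d \<and> Q k j}" by (rule finite_subset[OF _ fin[of "Suc ?d"]]) auto
    qed (use * in auto)
    ultimately show False using big finite_subset by blast
  qed
  ultimately have "\<exists>f. \<forall>n. ?big (f n) \<and> Q (f n) (f (Suc n))"
    by (intro dependent_nat_choice) blast+
  then obtain f where "\<And>n. Q (f n) (f (Suc n))" by auto
  then show thesis by (rule that)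
qed

end

section \<open>Limit words along an infinite chain\<close>

locale chain = permutation +
  fixes f :: "nat \<Rightarrow> nat"
  assumes f: "\<And>n. Q (f n) (f (Suc n))"
begin

lemma Q_f: "n < m \<Longrightarrow> Q (f n) (f m)"
proof (induction rule: less_Suc_induct)
  case (1 i) show ?case by (rule f)
next
  case (2 i j k) then show ?case using Q_trans by blast
qed

lemma f_less: "n < m \<Longrightarrow> f n < f m"
  by (rule Q_less[OF Q_f])

lemma inj_f: "inj f"
  by (rule strict_mono_imp_inj_on) (simp add: strict_mono_def f_less)

definition r :: nat where "r = (SOME r. rp In (U (f 0)) (M (f 0)) r)"

abbreviation c :: "nat \<Rightarrow> nat \<Rightarrow> nat" where "c q n \<equiv> (vtx ^^ q) (M (f n))"

lemma rp_coh: "n < m \<Longrightarrow> rp In (U (f n)) (M (f n)) r \<and> rp In (U (f m)) (M (f m)) r \<and> coh r (M (f n)) (M (f m))"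
proof -
  have ex: "\<exists>r. rp In (U (f n)) (M (f n)) r \<and> rp In (U (f m)) (M (f m)) r \<and> coh r (M (f n)) (M (f m))"
    if "n < m" for n m using Q_f[OF that] unfolding Q_iff by blast
  have r0: "rp In (U (f 0)) (M (f 0)) r"
    unfolding r_def by (rule someI_ex) (use ex[of 0 1] in auto)
  have rn: "rp In (U (f n)) (M (f n)) r" for n
  proof (cases n)
    case (Suc k)
    then obtain r' where r': "rp In (U (f 0)) (M (f 0)) r'" "rp In (U (f n)) (M (f n)) r'" using ex[of 0 n] by auto
    from rp_U_length[OF r'(1) r0] r'(2) show ?thesis by simp
  qed (simp add: r0)
  assume "n < m"
  then obtain r' where r': "rp In (U (f n)) (M (f n)) r'" "coh r' (M (f n)) (M (f m))" using ex by blast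
  from rp_U_length[OF r'(1) rn] r'(2) rn show ?thesis by simp
qed

lemma rp_f: "rp In (U (f n)) (M (f n)) r"
  using rp_coh[of n "Suc n"] by simp

lemma c_r: "c r n = U (f n)"
  using rp_f by (simp add: rp_def)

lemma okc_c: "q < r \<Longrightarrow> okc In (c q n)" and nocan_c: "Suc q < r \<Longrightarrow> nocan (c q n)"
  using rp_f[of n] by (auto simp: rp_def)

lemma c_mod: "q < r \<Longrightarrow> c q n mod 4 = c q 0 mod 4"
  using rp_coh[of 0 n] by (cases n) (auto simp: coh_def)

lemma c_lab: "n < m \<Longrightarrow> q < r \<Longrightarrow> lab (c q n) = lab (c q m) mod 2 ^ hh (vtx (c q n))"
  using rp_coh[of n m] by (auto simp: coh_def)

text \<open>The limit of the labels at step \<open>q\<close>, which extend one another along the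
  chain by \<open>c_lab\<close>.\<close>

definition y :: "nat \<Rightarrow> nat \<Rightarrow> bool" where
  "y q i \<longleftrightarrow> (\<exists>n. i < hh (vtx (c q n)) \<and> bit (lab (c q n)) i)"

lemma pre_y:
  assumes "q < r"
  shows "pre (y q) (hh (vtx (c q n))) = lab (c q n)"
proof (rule bit_eqI)
  fix i
  have l: "lab (c q n) = lab (c q n) mod 2 ^ hh (vtx (c q n))"
    using okc_c[OF assms, of n] by (simp add: okc_def)
  have "bit (lab (c q n)) i" if i: "i < hh (vtx (c q n))" and m: "i < hh (vtx (c q m))" "bit (lab (c q m)) i" for m
  proof (cases n m rule: linorder_cases)
    case less
    with m i show ?thesis by (subst c_lab[OF less assms]) (simp add: bit_mod_power)
  next
    case greater
    then have "bit (lab (c q n) mod 2 ^ hh (vtx (c q m))) i" using m c_lab[OF greater assms] by simp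
    then show ?thesis by (simp add: bit_mod_power)
  qed (use m in simp)
  moreover have "i < hh (vtx (c q n))" if "bit (lab (c q n)) i"
    using that by (subst (asm) l) (simp add: bit_mod_power)
  ultimately show "bit (pre (y q) (hh (vtx (c q n)))) i = bit (lab (c q n)) i"
    unfolding bit_pre y_def by blast
qed

definition s :: "nat \<Rightarrow> bool" where "s q \<longleftrightarrow> c q 0 mod 4 = 1"

lemma c_mod4: "q \<le> r \<Longrightarrow> c q n mod 4 = (if q = r then 0 else if s q then 1 else 2)"
proof (cases "q = r")
  case True
  then show ?thesis using c_r cand_bounds[OF cand_UM] by simp
next
  case False
  assume "q \<le> r"
  with False have q: "q < r" by simp
  from okc_c[OF q, of 0] False show ?thesis using c_mod[OF q, of n] by (auto simp: okc_def isch_def s_def)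
qed

lemma c_vertex: "q < r \<Longrightarrow> c q n = (if s q then D else E) (y q) (c (Suc q) n)"
proof -
  assume q: "q < r"
  have "xi (y q) (c (Suc q) n) \<sigma> = 0" for \<sigma> by (rule xi_0) (use c_mod4[of "Suc q" n] q in simp)
  moreover have "ch (c q n mod 4 = 1) (vtx (c q n)) (lab (c q n)) (aux (c q n)) = c q n"
    by (rule ch_collapse) (use okc_c[OF q, of n] in \<open>simp add: okc_def\<close>)
  then have "ch (s q) (vtx (c q n)) (lab (c q n)) 0 = c q n"
    using okc_c[OF q, of n] c_mod4[of q n] q by (cases "s q") (simp_all add: okc_def)
  ultimately show ?thesis using pre_y[OF q, of n] by (cases "s q") (simp_all add: D_def E_def)
qed

lemma no_cancel:
  assumes "q < r" "c (Suc q) n mod 4 = 1 \<or> c (Suc q) n mod 4 = 2" "c (Suc q) n mod 4 \<noteq> c q n mod 4"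
  shows "lab (c (Suc q) n) \<noteq> pre (y q) (hh (vtx (c (Suc q) n)))"
proof -
  have "Suc q < r" using c_mod4[of "Suc q" n] assms by (cases "Suc q = r") auto
  then have "lab (c (Suc q) n) \<noteq> lab (c q n) mod 2 ^ hh (vtx (c (Suc q) n))"
    using nocan_c[of q n] assms(3) by (simp add: nocan_def)
  moreover have "lab (c q n) = pre (y q) (hh (c (Suc q) n))" using pre_y[OF assms(1), of n] by simp
  moreover have "hh (vtx (c (Suc q) n)) \<le> hh (c (Suc q) n)" by (intro hh_mono vtx_le)
  ultimately show ?thesis by (simp add: pre_mod)
qed

text \<open>The conditions \<open>okc\<close> and \<open>nocan\<close> recorded on the path are what
  \<open>st_up\<close> requires. A grant out of the vertex is possible only at the root, hence only
  for \<open>Suc q = r\<close>.\<close>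

lemma c_step:
  assumes q: "q < r" and n: "Suc q = r \<Longrightarrow> \<not> (\<exists>m. Gr (y q) (U (f n)) m)"
  shows "st (s q, y q) (c (Suc q) n) = c q n"
proof -
  have "st (s q, y q) (c (Suc q) n) = (if s q then D (y q) (c (Suc q) n) else E (y q) (c (Suc q) n))"
  proof (rule st_up)
    show "if s q then \<not> (\<exists>m. Gr (y q) (c (Suc q) n) m) else \<not> (\<exists>u. Gr (y q) u (c (Suc q) n))"
    proof (cases "s q")
      case True
      have False if g: "Gr (y q) (c (Suc q) n) m" for m
      proof -
        have "Suc q = r" using Gr_mod4[OF g] c_mod4[of "Suc q" n] q by (auto split: if_splits)
        with g n c_r[of n] show False by metis
      qed
      with True show ?thesis by auto
    next
      case False
      then have "\<not> In (vtx (c q n)) (lab (c q n))" using okc_c[OF q, of n] c_mod4[of q n] q by (simp add: okc_def)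
      with False show ?thesis using pre_y[OF q, of n] In_pre[of "c (Suc q) n" "y q"] by simp
    qed
  next
    assume "c (Suc q) n mod 4 = (if s q then 2 else 1)"
    then show "lab (c (Suc q) n) \<noteq> pre (y q) (hh (vtx (c (Suc q) n)))"
      using c_mod4[of q n] q by (intro no_cancel) (auto split: if_splits)
  qed
  then show ?thesis using c_vertex[OF q, of n, symmetric] by (simp split: if_splits)
qed

lemma c_word:
  assumes "\<And>q. Suc q = r \<Longrightarrow> \<not> (\<exists>m. Gr (y q) (U (f n)) m)"
  shows "g (U (f n)) = wv (map (\<lambda>q. (s q, y q)) [0..<r]) (U (f n))"
proof -
  have "wv (map (\<lambda>q. (s q, y q)) [0..<j]) (c j n) = c 0 n" if "j \<le> r" for j
    using that
  proof (induction j)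
    case (Suc j)
    then have "st (s j, y j) (c (Suc j) n) = c j n" using c_step[of j n] assms by auto
    with Suc show ?case by simp
  qed simp
  from this[of r] have "wv (map (\<lambda>q. (s q, y q)) [0..<r]) (U (f n)) = M (f n)" by (simp only: c_r) simp
  then show ?thesis by (simp add: M_def)
qed

lemma infinite_f: "infinite K \<Longrightarrow> infinite (f ` K)"
  using finite_imageD[OF _ inj_on_subset[OF inj_f subset_UNIV]] by blast

text \<open>Each of these roots codes an initial segment of the claims of \<open>g\<close>, so
  granting at infinitely many of them forces \<open>x\<close> to make the same claims. Then
  \<open>chi x\<close> alone agrees with \<open>g\<close> there.\<close>

lemma Gr_last:
  assumes inf: "infinite X" and X: "\<And>n. n \<in> X \<Longrightarrow> \<exists>m. Gr x (U (f n)) m"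
  shows caught_by_G
proof -
  have lev: "\<exists>m. cand x (f n) (U (f n)) m \<and> lev x (f n) = lev b (f n) \<and> Gr x (U (f n)) m"
    if n: "n \<in> X" for n
  proof -
    obtain m where m: "Gr x (U (f n)) m" using X[OF n] by blast
    then obtain k where k: "cand x k (U (f n)) m" by (rule Gr_cand)
    have "k = f n" "lev x k = lev b (f n)" using cand_level[OF k cand_UM] by blast+
    with k m show ?thesis by blast
  qed
  have "x (2 * i + 2) = b (2 * i + 2)" for i
  proof -
    have "infinite (X - {..i})" using inf by (simp add: Diff_infinite_finite)
    then obtain n where "n \<in> X - {..i}" using infinite_imp_nonempty by blast
    then have n: "n \<in> X" "i < n" by simp_all
    have "n \<le> f n" using strict_mono_imp_increasing[of f n] by (simp add: strict_mono_def f_less)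
    with n(2) have "i < f n" using less_le_trans by blast
    moreover have "lev x (f n) = lev b (f n)" using lev[OF n(1)] by blast
    ultimately show ?thesis unfolding lev_eq by blast
  qed
  then have cx: "cand x = cand b" by (intro cand_gamma) blast
  show ?thesis
  proof (rule caughtI[OF infinite_f[OF inf]])
    fix k assume "k \<in> f ` X"
    then obtain m where m: "cand x k (U k) m" "Gr x (U k) m" using lev by blast
    have "m = M k" using cand_unique(2)[OF m(1)[unfolded cx] cand_UM] .
    with chi_Gr[OF m(2)] show "g (U k) = wv [(True, x)] (U k)" by (simp add: st_def M_def)
  qed
qed

text \<open>If the limit generator next to the roots grants at only finitely many of them, the limit
  word agrees with \<open>g\<close> at the others; otherwise \<open>Gr_last\<close> applies.\<close>

lemma chain_caught: caught_by_G
proof (cases "finite {n. \<exists>m. Gr (y (r - 1)) (U (f n)) m}")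
  case True
  define X where "X = - {n. \<exists>m. Gr (y (r - 1)) (U (f n)) m}"
  have "infinite X" using True unfolding X_def by (metis finite_compl infinite_UNIV_nat)
  show ?thesis
  proof (rule caughtI[OF infinite_f[OF \<open>infinite X\<close>]])
    fix k assume "k \<in> f ` X"
    then obtain n where n: "k = f n" "n \<in> X" by blast
    show "g (U k) = wv (map (\<lambda>q. (s q, y q)) [0..<r]) (U k)"
      unfolding n(1)
    proof (rule c_word)
      fix q assume "Suc q = r"
      then have "q = r - 1" by simp
      then show "\<not> (\<exists>m. Gr (y q) (U (f n)) m)" using n(2) by (simp add: X_def)
    qed
  qed
next
  case False
  then show ?thesis by (rule Gr_last) simp
qed

end

lemma (in permutation) caught_by_G: caught_by_G
proof (cases "infinite {k. sysno (M k) \<noteq> 0} \<or> (\<exists>d. infinite {k. depth b k (M k) = d})")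
  case True
  then show ?thesis using system_caught depth_caught by blast
next
  case False
  then obtain f where "\<And>n. Q (f n) (f (Suc n))" using infinite_chain by blast
  then interpret chain g f by unfold_locales
  show ?thesis by (rule chain_caught)
qed

theorem maximal_cofinitary_group_XX: "maximal_cofinitary_group (generate S_infinity XX)"
  unfolding maximal_cofinitary_group_def
proof (intro conjI notI)
  assume "\<exists>H. cofinitary_group H \<and> generate S_infinity XX \<subset> H"
  then obtain H g where H: "cofinitary_group H" "generate S_infinity XX \<subseteq> H" "g \<in> H"
    and g: "g \<notin> generate S_infinity XX" by blast
  have "bij g" using subgroup.mem_carrier[of H S_infinity g] H by (simp add: cofinitary_group_def S_infinity_simps)
  then interpret permutation g by unfold_locales
  obtain w where "infinite {z. g z = wv w z}" using caught_by_G by (auto simp: caught_by_G_def)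
  from caught[OF H this] g show False by blast
qed (rule cofinitary_group_XX)

section \<open>Bounding the claims by the values of a group element\<close>

text \<open>Bounds what \<open>n\<close> steps of growth \<open>FF\<close> reach from the revealing
  root of system \<open>n\<close> for \<open>u\<close>; by monotonicity smaller systems and fewer
  steps are covered.\<close>

definition th :: "nat \<Rightarrow> nat \<Rightarrow> nat" where "th n u = (FF ^^ n) (4 * pe n u + 3)"

definition Psi :: "nat \<Rightarrow> (nat \<Rightarrow> nat) \<Rightarrow> nat \<Rightarrow> nat" where "Psi n f u = n + (\<Sum>z\<le>th n u. f z)"

text \<open>
  \<open>n\<close> codes the length of a word, the signs of its letters and the parameter of the bound \<open>Psi\<close>.
\<close>

definition FG :: "nat \<Rightarrow> (nat \<Rightarrow> nat) set" where
  "FG n = {f. \<exists>x. (\<forall>z. f z = wk (\<lambda>q. (bit (pfst (psnd n)) q, x q)) z (pfst n)) \<and>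
     (\<forall>q<pfst n. \<forall>u. fcv (x q) u \<le> Psi (psnd (psnd n)) f u)}"

lemma th_mono: "u \<le> u' \<Longrightarrow> th n u \<le> th n u'"
  unfolding th_def by (intro FF_pow_mono) (simp add: pe_mono)

lemma Psi_mono: "u \<le> u' \<Longrightarrow> Psi n f u \<le> Psi n f u'"
  unfolding Psi_def using th_mono[of u u' n] by (auto intro!: sum_mono2)

lemma Psi_ge: "z \<le> th n u \<Longrightarrow> f z \<le> Psi n f u"
  unfolding Psi_def using member_le_sum[of z "{..th n u}" f] by simp

text \<open>Each step to a parent decreases the number, so the \<open>m\<close> iterations in
  \<open>vroot m\<close> reach a root, where they stay.\<close>

lemma vroot_child: "isch c \<Longrightarrow> vroot c = vroot (vtx c)" and vroot_root: "\<not> isch c \<Longrightarrow> vroot c = c"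
proof -
  let ?f = "\<lambda>c. if isch c then vtx c else c"
  have root: "(?f ^^ j) m = m" if "\<not> isch m" for j m
    by (induction j) (use that in auto)
  have child: "(?f ^^ j) m = (?f ^^ (j - 1)) (vtx m)" if "isch m" "m \<le> j" for j m
  proof -
    have "0 < j" using vtx_less[OF that(1)] that(2) by simp
    then obtain i where "j = Suc i" by (cases j) auto
    with that(1) show ?thesis by (simp del: funpow.simps add: funpow_Suc_right)
  qed
  have *: "\<forall>j\<ge>m. (?f ^^ j) m = vroot m" for m
  proof (induction m rule: less_induct)
    case (less m)
    show ?case
    proof (cases "isch m")
      case True
      have "(?f ^^ j) m = vroot (vtx m)" if "m \<le> j" for j
      proof -
        have "vtx m \<le> j - 1" using vtx_less[OF True] that by simp
        with less[OF vtx_less[OF True]] child[OF True that] show ?thesis by simp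
      qed
      moreover from this[of m] have "vroot m = vroot (vtx m)" by (simp add: vroot_def)
      ultimately show ?thesis by simp
    qed (simp add: root vroot_def)
  qed
  show "isch c \<Longrightarrow> vroot c = vroot (vtx c)"
  proof -
    assume c: "isch c"
    then have "vtx c \<le> c - 1" using vtx_less[of c] by simp
    with *[of "vtx c"] have "(?f ^^ (c - 1)) (vtx c) = vroot (vtx c)" by blast
    with child[OF c, of c] show ?thesis unfolding vroot_def[of c] by simp
  qed
  show "\<not> isch c \<Longrightarrow> vroot c = c" by (simp add: vroot_def root)
qed

text \<open>All grants of one generator into systems share a type. The type of later candidates
  names its system, which becomes \<open>bad\<close>; type 0 admits in each system only targets up
  to that of the granted candidate of least level.\<close>

lemma finite_Gr_system:
  "\<exists>bad. \<forall>N. N \<noteq> bad \<longrightarrow> finite {m. \<exists>u. Gr y u m \<and> sysno m = Suc N}"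
proof (cases "\<exists>u m. Gr y u m \<and> sysno m \<noteq> 0")
  case False
  then have "{m. \<exists>u. Gr y u m \<and> sysno m = Suc N} = {}" for N by fastforce
  then show ?thesis by (metis finite.emptyI)
next
  case True
  then obtain u m where g: "Gr y u m" "sysno m \<noteq> 0" by blast
  obtain k where k: "cand y k u m" by (rule Gr_cand[OF g(1)])
  show ?thesis
  proof (cases "sty y k m = 0")
    case False
    then have s: "sty y k m = Suc (sysno m)" using g(2) by (auto simp: sty_def split: if_splits)
    have "{m'. \<exists>u. Gr y u m' \<and> sysno m' = Suc N} = {}" if "N \<noteq> sysno m - 1" for N
    proof -
      have "sysno m' = sysno m" if gm: "Gr y u' m'" "sysno m' \<noteq> 0" for u' m'
      proof -
        obtain k' where k': "cand y k' u' m'" by (rule Gr_cand[OF gm(1)])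
        have "sty y k' m' = Suc (sysno m)" using Gr_same_depth(2)[OF that(1) k' g(1) k] s by simp
        then show ?thesis using that(2) by (auto simp: sty_def split: if_splits)
      qed
      with that show ?thesis using g(2) by fastforce
    qed
    then show ?thesis by (metis finite.emptyI)
  next
    case True
    have "finite {m. \<exists>u. Gr y u m \<and> sysno m = Suc N}" for N
    proof (cases "\<exists>k u m. Gr y u m \<and> cand y k u m \<and> sysno m = Suc N")
      case True
      define k0 where "k0 = (LEAST k. \<exists>u m. Gr y u m \<and> cand y k u m \<and> sysno m = Suc N)"
      obtain u0 m0 where 0: "Gr y u0 m0" "cand y k0 u0 m0" "sysno m0 = Suc N"
        using LeastI_ex[OF True] unfolding k0_def by blast
      have "m' \<le> m0" if gm: "Gr y u' m'" "sysno m' = Suc N" for u' m'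
      proof (rule ccontr)
        assume lt: "\<not> m' \<le> m0"
        obtain k' where k': "cand y k' u' m'" by (rule Gr_cand[OF gm(1)])
        have "k0 \<le> k'" unfolding k0_def by (rule Least_le) (use that k' in blast)
        moreover have "k0 \<noteq> k'" using cand_unique(2)[OF 0(2), of u' m'] k' lt by auto
        ultimately have kk: "k0 < k'" by simp
        have "u0 \<le> 8 * m'" using cand_bounds[OF 0(2)] lt by linarith
        then have "\<exists>j<k'. \<exists>n<m'. \<exists>u\<le>8*m'. cand y j u n \<and> sysno n = sysno m'"
          using kk 0 lt that(2) by (metis not_le)
        then have "sty y k' m' \<noteq> 0" using that(2) by (simp add: sty_def)
        moreover have "sty y k' m' = 0" using Gr_same_depth(2)[OF that(1) k' g(1) k] \<open>sty y k m = 0\<close> by simp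
        ultimately show False by simp
      qed
      then have "{m. \<exists>u. Gr y u m \<and> sysno m = Suc N} \<subseteq> {..m0}" by blast
      then show ?thesis using finite_subset by blast
    next
      case False
      have "\<exists>k. cand y k u m" if "Gr y u m" for u m using Gr_cand[OF that] by metis
      with False have "{m. \<exists>u. Gr y u m \<and> sysno m = Suc N} = {}" by blast
      then show ?thesis by (metis finite.emptyI)
    qed
    then show ?thesis by blast
  qed
qed

text \<open>A walk from a revealing root only moves up: no grant enters the system from there on,
  and labels of the length used at \<open>\<rho>\<close> already tell neighbouring generators
  apart.\<close>

locale climb =
  fixes N \<rho> :: nat and a :: "nat \<Rightarrow> bool \<times> bits" and n :: nat
  assumes root: "\<rho> mod 4 = 3" "N = pfst (\<rho> div 4)"
    and free: "\<And>i u m. i < n \<Longrightarrow> \<rho> \<le> m \<Longrightarrow> sysno m = Suc N \<Longrightarrow> \<not> Gr (snd (a i)) u m"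
    and told: "\<And>i. Suc i < n \<Longrightarrow> snd (a i) \<noteq> snd (a (Suc i)) \<Longrightarrow>
      pre (snd (a i)) (hh \<rho>) \<noteq> pre (snd (a (Suc i))) (hh \<rho>)"
    and red: "\<And>i. Suc i < n \<Longrightarrow> \<not> cancels (a i) (a (Suc i))"
begin

abbreviation ub :: "bool \<times> bits \<Rightarrow> nat \<Rightarrow> nat" where
  "ub c v \<equiv> (if fst c then D (snd c) v else E (snd c) v)"

lemma step: "i < n \<Longrightarrow> wk a \<rho> (Suc i) = ub (a i) (wk a \<rho> i) \<and> \<rho> \<le> wk a \<rho> i \<and> sysno (wk a \<rho> i) = Suc N"
proof (induction i)
  case 0
  have r: "\<not> isch \<rho>" using root by (simp add: isch_def)
  have s: "sysno \<rho> = Suc N" using root vroot_root[OF r] by (simp add: sysno_def)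
  show ?case
  proof (cases "fst (a 0)")
    case True
    then show ?thesis using chi_reveal[OF root(1)] s by (simp add: st_def)
  next
    case False
    have "D y v \<noteq> \<rho>" for y v using root(1) mod4_D[of y v] by auto
    moreover have "\<not> (\<exists>u. Gr (snd (a 0)) u \<rho>)" using free[OF 0 _ s] by blast
    ultimately show ?thesis using False s by (simp add: st_def ich_def)
  qed
next
  case (Suc i)
  let ?p = "wk a \<rho> i" and ?v = "wk a \<rho> (Suc i)" and ?x = "snd (a i)" and ?y = "snd (a (Suc i))"
  have v: "?v = ub (a i) ?p" and p: "\<rho> \<le> ?p" "sysno ?p = Suc N" using Suc by auto
  have ch: "isch ?v" "vtx ?v = ?p" unfolding v by (simp_all add: D_def E_def)
  have vp: "\<rho> \<le> ?v" using vtx_less[OF ch(1)] ch(2) p(1) by simp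
  have s: "sysno ?v = Suc N" using p(2) unfolding sysno_def vroot_child[OF ch(1)] ch(2) .
  have lab: "lab ?v = pre ?x (hh ?p)" "?v mod 4 = (if fst (a i) then 1 else 2)"
    unfolding v by (simp_all add: D_def E_def)
  have "st (fst (a (Suc i)), ?y) ?v = (if fst (a (Suc i)) then D ?y ?v else E ?y ?v)"
  proof (rule st_up)
    have "\<not> (\<exists>m. Gr ?y ?v m)" using Gr_mod4[of ?y ?v] lab(2) by (auto split: if_splits)
    moreover have "\<not> (\<exists>u. Gr ?y u ?v)" using free[OF Suc.prems vp s] by blast
    ultimately show "if fst (a (Suc i)) then \<not> (\<exists>m. Gr ?y ?v m) else \<not> (\<exists>u. Gr ?y u ?v)" by simp
  next
    assume "?v mod 4 = (if fst (a (Suc i)) then 2 else 1)"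
    then have "fst (a i) \<noteq> fst (a (Suc i))"
      using lab(2) by (cases "fst (a i)"; cases "fst (a (Suc i))") (simp_all del: wk_simps)
    then have "?x \<noteq> ?y" using red[OF Suc.prems] by (auto simp: cancels_def)
    with told[OF Suc.prems] have "pre ?x (hh \<rho>) \<noteq> pre ?y (hh \<rho>)" by simp
    then show "lab ?v \<noteq> pre ?y (hh (vtx ?v))"
      unfolding lab(1) ch(2) using pre_mono_eq[of ?x "hh ?p" ?y "hh \<rho>"] hh_mono[OF p(1)] by blast
  qed
  then have "wk a \<rho> (Suc (Suc i)) = ub (a (Suc i)) ?v" by simp
  with vp s show ?case by blast
qed

lemma le_wk: "i \<le> n \<Longrightarrow> j \<le> i \<Longrightarrow> wk a \<rho> j \<le> wk a \<rho> i"
proof (induction i)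
  case (Suc i)
  then have "wk a \<rho> i \<le> wk a \<rho> (Suc i)"
    using step[of i] D_gt[of "wk a \<rho> i" "snd (a i)"] E_gt[of "wk a \<rho> i" "snd (a i)"] by auto
  with Suc show ?case by (cases "j = Suc i") auto
qed simp

lemma first_step: "0 < n \<Longrightarrow> xi (snd (a 0)) \<rho> (fst (a 0)) \<le> wk a \<rho> n"
proof -
  assume n: "0 < n"
  have "xi (snd (a 0)) \<rho> (fst (a 0)) \<le> wk a \<rho> (Suc 0)"
    using step[OF n] by (auto simp: D_def E_def less_imp_le ch_ge_aux)
  also have "\<dots> \<le> wk a \<rho> n" by (rule le_wk) (use n in auto)
  finally show ?thesis .
qed

text \<open>Only the first step starts at a revealing root, so all later auxiliary parts are 0 and
  \<open>FF\<close> bounds the growth.\<close>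

lemma wk_FF:
  assumes "xi (snd (a 0)) \<rho> (fst (a 0)) = 0" "i \<le> n"
  shows "wk a \<rho> i \<le> (FF ^^ i) \<rho>"
  using assms(2)
proof (induction i)
  case (Suc i)
  let ?v = "wk a \<rho> i"
  have x: "xi (snd (a i)) ?v (fst (a i)) = 0"
  proof (cases i)
    case (Suc j)
    then have "?v = ub (a j) (wk a \<rho> j)" using step[of j] \<open>Suc i \<le> n\<close> by simp
    then have "?v mod 4 \<noteq> 3" by (simp add: D_def E_def)
    then show ?thesis by (rule xi_0)
  qed (use assms(1) in simp)
  have "wk a \<rho> (Suc i) = ch (fst (a i)) ?v (pre (snd (a i)) (hh ?v)) 0"
    using step[of i] Suc.prems x by (auto simp: D_def E_def)
  also have "\<dots> \<le> FF ?v"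
    unfolding FF_def ch_def using pe_mono[of ?v ?v "pe (pre (snd (a i)) (hh ?v)) 0" "pe (2 ^ hh ?v) 0"]
      pe_mono[of "pre (snd (a i)) (hh ?v)" "2 ^ hh ?v" 0 0] pre_less[of "snd (a i)" "hh ?v"] by simp
  also have "\<dots> \<le> FF ((FF ^^ i) \<rho>)" using Suc by (intro FF_mono) simp
  finally show ?case by simp
qed simp

end

section \<open>The values of a word reveal the claims of its letters\<close>

lemma wk_add: "wk a z (q + i) = wk (\<lambda>i. a (q + i)) (wk a z q) i"
  by (induction i) simp_all

lemma wk_nx: "j \<le> q \<Longrightarrow> wk a (wk (\<lambda>i. nx (a (q - 1 - i))) z q) j = wk (\<lambda>i. nx (a (q - 1 - i))) z (q - j)"
proof (induction j)
  case (Suc j)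
  then have "q - j = Suc (q - Suc j)" "q - 1 - (q - Suc j) = j" by simp_all
  then have "wk (\<lambda>i. nx (a (q - 1 - i))) z (q - j) = st (nx (a j)) (wk (\<lambda>i. nx (a (q - 1 - i))) z (q - Suc j))"
    by (simp only: wk_simps)
  with Suc show ?case by simp
qed simp

lemma base_digits:
  fixes p :: nat
  shows "(4 * p + 2 * of_bool b + of_bool c) div 4 = p"
    and "odd ((4 * p + 2 * of_bool b + of_bool c) div 2) = b"
    and "odd (4 * p + 2 * of_bool b + of_bool c) = c"
  by (cases b; cases c; simp only: of_bool_eq; presburger)+

text \<open>Let the walk be at a suitable revealing root just before letter \<open>q\<close>. Going
  back along the inverses of the preceding letters reveals nothing and ends at a bounded point
  \<open>z\<close>. From the root on, letter \<open>q\<close> records \<open>fcv\<close> in its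
  child and the walk only grows, so the value at \<open>z\<close> bounds \<open>fcv\<close>.\<close>

lemma claims_bounded:
  assumes red: "\<And>i. Suc i < l \<Longrightarrow> \<not> cancels (a i) (a (Suc i))" and q: "q < l"
  shows "\<exists>n1. \<forall>n\<ge>n1. \<forall>u. fcv (snd (a q)) u \<le> Psi n (\<lambda>z. wk a z l) u"
proof -
  define x where "x = snd (a q)"
  define s where "s = fst (a q)"
  \<comment> \<open>A bit that tells letter \<open>q\<close> from the preceding generator if they
    differ. For \<open>q = 0\<close> truncated subtraction compares the letter with itself.\<close>
  have "\<exists>p. snd (a (q - 1)) \<noteq> x \<longrightarrow> snd (a (q - 1)) p \<noteq> x p" by (auto simp: fun_eq_iff)
  then obtain p where p: "snd (a (q - 1)) \<noteq> x \<Longrightarrow> snd (a (q - 1)) p \<noteq> x p" by blast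
  define d where "d = 4 * p + 2 * of_bool (x p) + of_bool s"
  have d: "d div 4 = p" "odd (d div 2) = x p" "odd d = s"
    unfolding d_def by (rule base_digits)+
  have "\<forall>i. \<exists>bad. \<forall>N. N \<noteq> bad \<longrightarrow> finite {m. \<exists>u. Gr (snd (a i)) u m \<and> sysno m = Suc N}"
    by (intro allI finite_Gr_system)
  from choice[OF this] obtain bad where
    bad: "\<And>i N. N \<noteq> bad i \<Longrightarrow> finite {m. \<exists>u. Gr (snd (a i)) u m \<and> sysno m = Suc N}" by blast
  \<comment> \<open>The first component makes \<open>N\<close> larger than every exceptional
    system.\<close>
  define N where "N = pe (Suc (\<Sum>i<l. bad i)) d"
  have "finite (\<Union>i<l. {m. \<exists>u. Gr (snd (a i)) u m \<and> sysno m = Suc N})"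
  proof (intro finite_UN_I bad notI)
    fix i assume "i \<in> {..<l}" "N = bad i"
    then have "N \<le> (\<Sum>i<l. bad i)" using member_le_sum[of i "{..<l}" bad] by simp
    with pe_ge1[of "Suc (\<Sum>i<l. bad i)" d] show False by (simp add: N_def)
  qed simp
  then obtain M0 where M0: "\<And>i u m. i < l \<Longrightarrow> Gr (snd (a i)) u m \<Longrightarrow> sysno m = Suc N \<Longrightarrow> m < M0"
    unfolding finite_nat_set_iff_bounded by blast
  have "\<forall>i. \<exists>e. \<forall>h\<ge>e. snd (a i) \<noteq> snd (a (Suc i)) \<longrightarrow> pre (snd (a i)) h \<noteq> pre (snd (a (Suc i))) h"
  proof
    fix i
    show "\<exists>e. \<forall>h\<ge>e. snd (a i) \<noteq> snd (a (Suc i)) \<longrightarrow> pre (snd (a i)) h \<noteq> pre (snd (a (Suc i))) h"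
  proof (cases "snd (a i) = snd (a (Suc i))")
    case False
    then obtain j where j: "snd (a i) j \<noteq> snd (a (Suc i)) j" by blast
    then have "pre (snd (a i)) h \<noteq> pre (snd (a (Suc i))) h" if "Suc j \<le> h" for h
      using j Suc_le_lessD[OF that] unfolding pre_eq_iff by blast
    then show ?thesis by blast
  qed simp
  qed
  from choice[OF this] obtain e where e: "\<And>i h. e i \<le> h \<Longrightarrow> snd (a i) \<noteq> snd (a (Suc i)) \<Longrightarrow>
    pre (snd (a i)) h \<noteq> pre (snd (a (Suc i))) h" by blast
  \<comment> \<open>From here on the roots lie beyond all grants into the system and have labels
    long enough for neighbouring letters.\<close>
  define u0 where "u0 = M0 + (\<Sum>i<l. e i)"
  let ?f = "\<lambda>z. wk a z l"
  have big: "\<exists>z\<le>(FF ^^ q) (4 * pe N u + 3). fcv x u \<le> ?f z" if u: "u0 \<le> u" for u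
  proof -
    define \<rho> where "\<rho> = 4 * pe N u + 3"
    let ?c = "\<lambda>i. nx (a (q - 1 - i))" and ?a = "\<lambda>i. a (q + i)"
    have \<rho>: "\<rho> mod 4 = 3" "N = pfst (\<rho> div 4)" "psnd (\<rho> div 4) = u" by (simp_all add: \<rho>_def)
    have dd: "psnd (pfst (\<rho> div 4)) = d" by (simp add: \<rho>_def N_def)
    have "u \<le> \<rho>" using pe_ge2[of u N] by (simp add: \<rho>_def)
    with u have le: "M0 \<le> \<rho>" "(\<Sum>i<l. e i) \<le> \<rho>" by (simp_all add: u0_def)
    have free: "\<not> Gr (snd (a i)) v m" if "i < l" "\<rho> \<le> m" "sysno m = Suc N" for i v m
      using M0[of i v m] that le by auto
    have told: "pre (snd (a i)) (hh \<rho>) \<noteq> pre (snd (a (Suc i))) (hh \<rho>)"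
      if "Suc i < l" "snd (a i) \<noteq> snd (a (Suc i))" for i
    proof (rule e)
      have "e i \<le> (\<Sum>i<l. e i)" using member_le_sum[of i "{..<l}" e] that by simp
      with le hh_ge[of \<rho>] show "e i \<le> hh \<rho>" by simp
    qed (rule that)
    interpret up: climb N \<rho> ?a "l - q"
      by unfold_locales (use \<rho> free told red in auto)
    interpret down: climb N \<rho> ?c q
    proof unfold_locales
      fix i assume i: "Suc i < q"
      then have j: "q - 1 - i = Suc (q - 1 - Suc i)" "Suc (q - 1 - Suc i) < l" using q by auto
      show "\<not> cancels (?c i) (?c (Suc i))" using red[OF j(2)] unfolding j(1) by (auto simp: cancels_def nx_def)
      show "snd (?c i) \<noteq> snd (?c (Suc i)) \<Longrightarrow> pre (snd (?c i)) (hh \<rho>) \<noteq> pre (snd (?c (Suc i))) (hh \<rho>)"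
        using told[OF j(2)] unfolding j(1) by (auto simp: nx_def)
    qed (use \<rho> free q in \<open>auto simp: nx_def\<close>)
    let ?z = "wk ?c \<rho> q"
    have "?z \<le> (FF ^^ q) \<rho>"
    proof (cases "q = 0")
      case False
      \<comment> \<open>The system addresses bit \<open>p\<close> and a sign: a different generator
        fails on the bit, the same one on the sign, because the word is reduced.\<close>
      have "xi (snd (?c 0)) \<rho> (fst (?c 0)) = 0"
      proof (cases "snd (a (q - 1)) = x")
        case True
        then have "fst (?c 0) \<noteq> s"
          using red[of "q - 1"] q False by (auto simp: cancels_def nx_def s_def x_def)
        then show ?thesis using d(3) by (auto simp: xi_def dd)
      next
        case False
        then show ?thesis using d p by (auto simp: xi_def dd nx_def)
      qed
      then show ?thesis by (rule down.wk_FF) simp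
    qed simp
    moreover have "?f ?z = wk ?a \<rho> (l - q)"
      using wk_add[of a ?z q "l - q"] wk_nx[of q q a \<rho>] q by simp
    moreover have "xi x \<rho> s = fcv x u"
      using \<rho> d by (simp add: xi_def dd)
    moreover have "xi x \<rho> s \<le> wk ?a \<rho> (l - q)" using up.first_step q by (simp add: x_def s_def)
    ultimately show ?thesis unfolding \<rho>_def[symmetric] by metis
  qed
  have "fcv x u \<le> Psi n ?f u" if n: "N + q + (\<Sum>u<u0. fcv x u) \<le> n" for n u
  proof (cases "u < u0")
    case True
    then have "fcv x u \<le> (\<Sum>u<u0. fcv x u)" using member_le_sum[of u "{..<u0}" "fcv x"] by simp
    with n show ?thesis by (simp add: Psi_def)
  next
    case False
    then have "u0 \<le> u" by simp
    from big[OF this] obtain z where z: "z \<le> (FF ^^ q) (4 * pe N u + 3)" "fcv x u \<le> ?f z" by blast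
    have "(FF ^^ q) (4 * pe N u + 3) \<le> (FF ^^ n) (4 * pe N u + 3)" by (rule FF_pow_le) (use n in simp)
    also have "\<dots> \<le> th n u" unfolding th_def by (intro FF_pow_mono) (use n in \<open>simp add: pe_mono\<close>)
    finally have "z \<le> th n u" using z(1) by simp
    from Psi_ge[OF this] z(2) show ?thesis by (meson le_trans)
  qed
  then show ?thesis unfolding x_def by blast
qed

lemma wv_FG:
  assumes "reduced w"
  shows "\<exists>n. wv w \<in> FG n"
proof -
  define l where "l = length w"
  define a where "a i = rev w ! i" for i
  have f: "wv w = (\<lambda>z. wk a z l)"
  proof
    have "map a [0..<l] = rev w" unfolding a_def l_def by (metis length_rev map_nth)
    then show "wv w z = wk a z l" for z by (simp add: wk_eq_wv)
  qed
  have red: "\<not> cancels (a i) (a (Suc i))" if "Suc i < l" for i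
  proof -
    have "Suc (l - 2 - i) = l - 1 - i" using that by simp
    moreover have "\<not> cancels (w ! (l - 2 - i)) (w ! Suc (l - 2 - i))"
      using assms that unfolding reduced_def successively_conv_nth by (simp add: l_def)
    moreover have "a i = w ! (l - 1 - i)" "a (Suc i) = w ! (l - 2 - i)"
      using that by (simp_all add: a_def rev_nth l_def)
    ultimately show ?thesis using cancels_sym[of "a i"] by simp
  qed
  have "\<forall>q. \<exists>n1. q < l \<longrightarrow> (\<forall>n\<ge>n1. \<forall>u. fcv (snd (a q)) u \<le> Psi n (\<lambda>z. wk a z l) u)"
    using claims_bounded[of l a, OF red] by blast
  from choice[OF this] obtain n1 where n1: "\<And>q n u. q < l \<Longrightarrow> n1 q \<le> n \<Longrightarrow> fcv (snd (a q)) u \<le> Psi n (\<lambda>z. wk a z l) u"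
    by blast
  define n where "n = pe l (pe (pre (\<lambda>q. fst (a q)) l) (\<Sum>q<l. n1 q))"
  have "wk (\<lambda>q. (bit (pre (\<lambda>q. fst (a q)) l) q, snd (a q))) z i = wk a z i" if "i \<le> l" for z i
    using that by (induction i) (simp_all add: bit_pre)
  moreover have "fcv (snd (a q)) u \<le> Psi (\<Sum>q<l. n1 q) (wv w) u" if "q < l" for q u
    unfolding f using n1[OF that] member_le_sum[of q "{..<l}" n1] that by simp
  ultimately have "wv w \<in> FG n"
    unfolding FG_def by (intro CollectI exI[of _ "\<lambda>q. snd (a q)"]) (simp add: n_def f)
  then show ?thesis ..
qed

lemma FG_generate: "FG n \<subseteq> generate S_infinity XX"
proof
  fix f assume "f \<in> FG n"
  then obtain x where "\<forall>z. f z = wk (\<lambda>q. (bit (pfst (psnd n)) q, x q)) z (pfst n)" by (auto simp: FG_def)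
  then have "f = wv (rev (map (\<lambda>q. (bit (pfst (psnd n)) q, x q)) [0..<pfst n]))"
    by (simp add: fun_eq_iff wk_eq_wv)
  then show "f \<in> generate S_infinity XX" using wv_in_generate by simp
qed

lemma generate_FG: "generate S_infinity XX = (\<Union>n. FG n)"
proof (intro subset_antisym subsetI)
  fix g assume "g \<in> generate S_infinity XX"
  then obtain w where w: "reduced w" "g = wv w" using generate_wv by blast
  from wv_FG[OF w(1)] show "g \<in> (\<Union>n. FG n)" unfolding w(2) by simp
next
  fix g assume "g \<in> (\<Union>n. FG n)"
  then obtain n where "g \<in> FG n" by (rule UN_E)
  then show "g \<in> generate S_infinity XX" by (rule subsetD[OF FG_generate])
qed

text \<open>The number codes length 1, positive sign and parameter \<open>pe 0 3\<close>. The
  systems \<open>pe 0 1\<close> and \<open>pe 0 3\<close> address the two values of bit 0 with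
  positive sign, so one of them reveals the claims of any given generator.\<close>

lemma XX_FG: "XX = FG (pe 1 (pe 1 (pe 0 3)))"
proof (intro subset_antisym subsetI)
  fix f assume "f \<in> XX"
  then obtain b where f: "f = chi b" by blast
  have "fcv b u \<le> Psi (pe 0 3) f u" for u
  proof -
    define N where "N = pe 0 (if b 0 then 3 else 1)"
    define \<rho> where "\<rho> = 4 * pe N u + 3"
    have "\<rho> mod 4 = 3" "\<rho> div 4 = pe N u" by (simp_all add: \<rho>_def)
    then have "xi b \<rho> True = fcv b u" by (simp add: xi_def N_def)
    then have "fcv b u \<le> D b \<rho>" using ch_ge_aux[of "xi b \<rho> True"] by (simp add: D_def less_imp_le)
    moreover have "chi b \<rho> = D b \<rho>" by (rule chi_reveal) (simp add: \<rho>_def)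
    moreover have "N \<le> pe 0 3" by (simp add: N_def pe_mono)
    then have "\<rho> \<le> 4 * pe (pe 0 3) u + 3" by (simp add: \<rho>_def pe_mono)
    then have "\<rho> \<le> th (pe 0 3) u" unfolding th_def using FF_pow_ge le_trans by blast
    from Psi_ge[OF this] have "f \<rho> \<le> Psi (pe 0 3) f u" .
    ultimately show ?thesis by (simp add: f)
  qed
  then show "f \<in> FG (pe 1 (pe 1 (pe 0 3)))"
    unfolding FG_def by (intro CollectI exI[of _ "\<lambda>_. b"]) (simp add: f st_def bit_0)
next
  fix f assume "f \<in> FG (pe 1 (pe 1 (pe 0 3)))"
  then have "\<exists>x :: nat \<Rightarrow> nat \<Rightarrow> bool. (\<forall>z. f z = chi (x 0) z) \<and> (\<forall>u. fcv (x 0) u \<le> Psi (pe 0 3) f u)"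
    by (simp add: FG_def st_def bit_0)
  then obtain x :: "nat \<Rightarrow> nat \<Rightarrow> bool" where "\<forall>z. f z = chi (x 0) z" by (elim exE conjE)
  then have "f = chi (x 0)" by blast
  then show "f \<in> XX" by simp
qed

section \<open>Approximating the generators by finite information\<close>

lemma fcv_eq_Suc: "fcv b u = Suc m \<longleftrightarrow> cl b u m \<and> (\<forall>a<m. \<not> cl b u a)"
proof
  assume *: "fcv b u = Suc m"
  then have ex: "\<exists>a. cl b u a" and m: "m = (LEAST a. cl b u a)" by (auto simp: fcv_def split: if_splits)
  show "cl b u m \<and> (\<forall>a<m. \<not> cl b u a)"
    unfolding m using LeastI_ex[OF ex] not_less_Least[of _ "cl b u"] by blast
next
  assume *: "cl b u m \<and> (\<forall>a<m. \<not> cl b u a)"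
  then have "(LEAST a. cl b u a) = m" by (intro Least_equality) (auto simp: not_less[symmetric])
  with * show "fcv b u = Suc m" by (auto simp: fcv_def)
qed

lemma fcv_eq_0: "fcv b u = 0 \<longleftrightarrow> (\<forall>a. \<not> cl b u a)"
  by (simp add: fcv_def)

lemma Gr_fcv: "Gr b u m \<Longrightarrow> fcv b u = Suc m"
proof -
  assume "Gr b u m"
  then obtain k where "cand b k u m" by (rule Gr_cand)
  then show ?thesis unfolding fcv_eq_Suc cand_def by blast
qed

text \<open>Once the first claims up to \<open>z\<close> are bounded, finitely many bits decide the
  values at \<open>z\<close>: a grant out of \<open>v\<close> has the first claim at
  \<open>v\<close> as its target.\<close>

locale agree =
  fixes x y :: "nat \<Rightarrow> bool" and c z :: nat
  assumes bits: "\<And>i. i < hh (c + z) \<Longrightarrow> x i = y i"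
    and claims: "\<And>u. u \<le> z \<Longrightarrow> fcv x u = fcv y u" "\<And>u. u \<le> z \<Longrightarrow> fcv x u \<le> c"
begin

lemma bits_le: "v \<le> c + z \<Longrightarrow> i < hh v \<Longrightarrow> x i = y i"
  using bits hh_mono[of v "c + z"] by simp

lemma Gr_eq: "v \<le> z \<Longrightarrow> Gr x v m = Gr y v m"
proof -
  assume v: "v \<le> z"
  have "Gr x v m = Gr y v m" if "m \<le> c" by (rule Gr_local) (use bits_le[of m] that in auto)
  moreover have "m \<le> c" if "Gr x v m \<or> Gr y v m"
    using that claims[OF v] Gr_fcv[of x v m] Gr_fcv[of y v m] by auto
  ultimately show ?thesis by blast
qed

lemma Gr_into_eq: "v \<le> z \<Longrightarrow> Gr x u v = Gr y u v"
  by (rule Gr_local) (use bits_le[of v] in auto)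

lemma pre_eq: "v \<le> z \<Longrightarrow> pre x (hh v) = pre y (hh v)"
  unfolding pre_eq_iff using bits_le[of v] by auto

lemma xi_eq: "v \<le> z \<Longrightarrow> xi x v s = xi y v s"
proof -
  assume v: "v \<le> z"
  have "psnd (pfst (v div 4)) \<le> v div 4" using psnd_le pfst_le le_trans by blast
  then have "psnd (pfst (v div 4)) div 4 \<le> v" by linarith
  then have "x (psnd (pfst (v div 4)) div 4) = y (psnd (pfst (v div 4)) div 4)"
    using bits_le[of v] hh_ge[of v] v by (meson le_less_trans trans_le_add2)
  moreover have "psnd (v div 4) \<le> z" using psnd_le[of "v div 4"] v by linarith
  then have "fcv x (psnd (v div 4)) = fcv y (psnd (v div 4))" by (rule claims)
  ultimately show ?thesis by (simp add: xi_def)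
qed

lemma DE_eq: "v \<le> z \<Longrightarrow> D x v = D y v" "v \<le> z \<Longrightarrow> E x v = E y v"
  by (simp_all add: D_def E_def pre_eq xi_eq)

lemma dn_eq: "v \<le> z \<Longrightarrow> dn x v = dn y v"
proof (induction v rule: less_induct)
  case (less v)
  have le: "vtx v \<le> z" "vtx (vtx v) \<le> z" using less.prems vtx_le le_trans by blast+
  have "dn x (vtx (vtx v)) = dn y (vtx (vtx v))" if "E x (vtx v) = v"
  proof (rule less.IH)
    show "vtx (vtx v) < v" using E_gt[of "vtx v" x] that vtx_le[of "vtx v"] by simp
  qed (rule le)
  then show ?case
    unfolding dn_iff[of x v] dn_iff[of y v] att_def using DE_eq le Gr_eq[OF le(2)] Gr_into_eq[OF le(1)] by auto
qed

lemma st_eq: "st (s, x) z = st (s, y) z"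
proof -
  have "Gr x z = Gr y z" using Gr_eq[of z] by (simp add: fun_eq_iff)
  then have "chi x z = chi y z"
    using dn_eq[of z] DE_eq[of z] by (simp add: chi_def)
  moreover have "att x (vtx z) = att y (vtx z)"
    unfolding att_def using Gr_eq[OF vtx_le] dn_eq[OF vtx_le] by simp
  then have "ich x z = ich y z"
    using Gr_into_eq[of z] DE_eq(1)[OF vtx_le] DE_eq(2)[of z] by (simp add: ich_def)
  ultimately show ?thesis by (simp add: st_def)
qed

end

definition vis :: "nat \<Rightarrow> nat \<Rightarrow> nat \<Rightarrow> nat" where
  "vis k T q = pre (\<lambda>i. pe q i < k \<and> bit T (pe q i)) k"

text \<open>
  \<open>vis k T q\<close> is what the first \<open>k\<close> bits of \<open>T\<close> tell about the generator number \<open>q\<close>.  \<open>run\<close> returns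
  the successor of the value of the word, or 0 if the first \<open>k\<close> bits and values do not determine it.
\<close>

definition run :: "nat \<Rightarrow> nat \<Rightarrow> nat \<Rightarrow> nat \<Rightarrow> (nat \<Rightarrow> nat) \<Rightarrow> nat \<Rightarrow> nat \<Rightarrow> nat \<Rightarrow> nat" where
  "run l S n k f T z j = rec_nat (Suc z) (\<lambda>i a. if a \<noteq> 0 \<and> th n (a - 1) < k \<and>
     pe l (hh (Psi n f (a - 1) + (a - 1))) < k then Suc (st (bit S i, bit (vis k T i)) (a - 1)) else 0) j"

text \<open>The condition of \<open>FG n\<close> as far as stage \<open>k\<close> can see it.
  Undetermined runs are accepted; by \<open>Chk_iff\<close> passing all stages is enough.\<close>

definition Chk :: "nat \<Rightarrow> nat \<Rightarrow> (nat \<Rightarrow> nat) \<Rightarrow> nat \<Rightarrow> bool" where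
  "Chk n k f T \<longleftrightarrow>
     (\<forall>q<pfst n. \<forall>u<k. th (psnd (psnd n)) u < k \<longrightarrow> fcv (bit (vis k T q)) u \<le> Psi (psnd (psnd n)) f u) \<and>
     (\<forall>z<k. run (pfst n) (pfst (psnd n)) (psnd (psnd n)) k f T z (pfst n) \<noteq> 0 \<longrightarrow>
        run (pfst n) (pfst (psnd n)) (psnd (psnd n)) k f T z (pfst n) = Suc (f z))"

lemma run_simps [simp]: "run l S n k f T z 0 = Suc z"
  "run l S n k f T z (Suc i) = (if run l S n k f T z i \<noteq> 0 \<and> th n (run l S n k f T z i - 1) < k \<and>
     pe l (hh (Psi n f (run l S n k f T z i - 1) + (run l S n k f T z i - 1))) < k
     then Suc (st (bit S i, bit (vis k T i)) (run l S n k f T z i - 1)) else 0)"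
  unfolding run_def by (simp_all only: nat.rec)

lemma Psi_cong: "th n u < k \<Longrightarrow> (\<And>i. i < k \<Longrightarrow> f i = g i) \<Longrightarrow> Psi n f u = Psi n g u"
  by (simp add: Psi_def)

lemma Chk_cong:
  assumes "\<And>i. i < k \<Longrightarrow> f i = g i"
  shows "Chk n k f T = Chk n k g T"
proof -
  have P: "Psi m f u = Psi m g u" if "th m u < k" for m u using Psi_cong[OF that] assms by blast
  have "run l S m k f T z i = run l S m k g T z i" for l S m z i
  proof (induction i)
    case (Suc i)
    then show ?case using P[of m "run l S m k g T z i - 1"] by auto
  qed simp
  then show ?thesis unfolding Chk_def using P assms by (auto simp del: run_simps)
qed

lemma Chk_mod: "Chk n k f (T mod 2 ^ k) = Chk n k f T"
proof -
  have v: "vis k (T mod 2 ^ k) = vis k T"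
    unfolding vis_def by (intro ext arg_cong[of _ _ "\<lambda>b. pre b k"]) (auto simp: bit_mod_power)
  then have "run l S m k f (T mod 2 ^ k) = run l S m k f T" for l S m
    by (intro ext) (simp only: run_def)
  with v show ?thesis by (simp add: Chk_def)
qed

section \<open>Correctness of the finite stages\<close>

locale approx =
  fixes B :: "nat \<Rightarrow> bool" and x :: "nat \<Rightarrow> nat \<Rightarrow> bool"
  assumes B: "\<And>q i. B (pe q i) = x q i"
begin

abbreviation t :: "nat \<Rightarrow> nat \<Rightarrow> nat" where "t k q \<equiv> vis k (pre B k) q"

lemma bit_t: "bit (t k q) i \<longleftrightarrow> pe q i < k \<and> x q i"
  using pe_ge2[of i q] by (auto simp: vis_def bit_pre B)

lemma cl_t: "cl (bit (t k q)) u a \<longleftrightarrow> pe q (2 * pe u a + 2) < k \<and> cl (x q) u a"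
  by (simp add: cl_def bit_t)

text \<open>Pairing is monotone, so with a claim all bits for smaller values at the same argument
  are visible. Truncation can hide the first claim but not replace it.\<close>

lemma fcv_t_cases: "fcv (bit (t k q)) u = 0 \<or> fcv (bit (t k q)) u = fcv (x q) u"
proof (cases "fcv (bit (t k q)) u")
  case (Suc a)
  then have a: "cl (bit (t k q)) u a" "\<And>a'. a' < a \<Longrightarrow> \<not> cl (bit (t k q)) u a'" by (auto simp: fcv_eq_Suc)
  have "\<not> cl (x q) u a'" if "a' < a" for a'
  proof -
    have "pe q (2 * pe u a' + 2) \<le> pe q (2 * pe u a + 2)"
      by (intro pe_mono add_mono mult_le_mono2) (use that in auto)
    then show ?thesis using a(2)[OF that] a(1) unfolding cl_t by simp
  qed
  with a(1) have "fcv (x q) u = Suc a" unfolding fcv_eq_Suc cl_t by blast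
  with Suc show ?thesis by simp
qed simp

lemma fcv_t:
  assumes "fcv (x q) u \<le> c" "u \<le> z" "pe q (hh (c + z)) < k"
  shows "fcv (bit (t k q)) u = fcv (x q) u"
proof (cases "fcv (x q) u")
  case 0
  then show ?thesis using fcv_t_cases[of k q u] by simp
next
  case (Suc a)
  then have a: "cl (x q) u a" by (simp add: fcv_eq_Suc)
  have "2 * pe u a + 2 < hh (c + z)" by (rule pe_less_hh) (use Suc assms in auto)
  then have "pe q (2 * pe u a + 2) \<le> pe q (hh (c + z))" by (intro pe_mono) auto
  with a assms(3) have "cl (bit (t k q)) u a" by (simp add: cl_t)
  then have "fcv (bit (t k q)) u \<noteq> 0" by (auto simp: fcv_eq_0)
  with fcv_t_cases[of k q u] show ?thesis by simp
qed

lemma st_t: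
  assumes "\<And>u. fcv (x q) u \<le> Psi n f u" "pe l (hh (Psi n f z + z)) < k" "q < l"
  shows "st (s, bit (t k q)) z = st (s, x q) z"
proof -
  have k: "pe q (hh (Psi n f z + z)) < k"
    using assms(2,3) pe_mono[of q l "hh (Psi n f z + z)" "hh (Psi n f z + z)"] by simp
  have f: "fcv (x q) u \<le> Psi n f z" if "u \<le> z" for u
    using assms(1)[of u] Psi_mono[OF that, of n f] by simp
  interpret agree "x q" "bit (t k q)" "Psi n f z" z
  proof
    fix i assume "i < hh (Psi n f z + z)"
    then have "pe q i < k" using k pe_mono[of q q i "hh (Psi n f z + z)"] by simp
    then show "x q i = bit (t k q) i" by (simp add: bit_t)
  next
    fix u assume u: "u \<le> z"
    show "fcv (x q) u = fcv (bit (t k q)) u" using fcv_t[OF f[OF u] u k] by simp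
    show "fcv (x q) u \<le> Psi n f z" by (rule f[OF u])
  qed
  from st_eq show ?thesis by simp
qed

lemma run_sound:
  assumes "\<And>q u. q < l \<Longrightarrow> fcv (x q) u \<le> Psi n f u" "j \<le> l" "run l S n k f (pre B k) z j \<noteq> 0"
  shows "run l S n k f (pre B k) z j = Suc (wk (\<lambda>q. (bit S q, x q)) z j)"
  using assms(2,3)
proof (induction j)
  case (Suc j)
  let ?a = "run l S n k f (pre B k) z j"
  have g: "?a \<noteq> 0" "pe l (hh (Psi n f (?a - 1) + (?a - 1))) < k"
    "run l S n k f (pre B k) z (Suc j) = Suc (st (bit S j, bit (t k j)) (?a - 1))"
    using Suc.prems by (auto split: if_splits)
  have "?a = Suc (wk (\<lambda>q. (bit S q, x q)) z j)" using Suc g(1) by simp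
  moreover have "st (bit S j, bit (t k j)) (?a - 1) = st (bit S j, x j) (?a - 1)"
    by (rule st_t[OF _ g(2)]) (use assms(1) Suc.prems in auto)
  ultimately show ?case using g(3) by simp
qed simp

lemma run_complete:
  assumes "\<And>q u. q < l \<Longrightarrow> fcv (x q) u \<le> Psi n f u" "j \<le> l"
    and "\<And>i. i < j \<Longrightarrow> th n (wk (\<lambda>q. (bit S q, x q)) z i) < k \<and>
      pe l (hh (Psi n f (wk (\<lambda>q. (bit S q, x q)) z i) + wk (\<lambda>q. (bit S q, x q)) z i)) < k"
  shows "run l S n k f (pre B k) z j \<noteq> 0"
  using assms(2,3)
proof (induction j)
  case (Suc j)
  have n0: "run l S n k f (pre B k) z j \<noteq> 0" by (rule Suc.IH) (use Suc.prems in auto)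
  have "run l S n k f (pre B k) z j = Suc (wk (\<lambda>q. (bit S q, x q)) z j)"
    by (rule run_sound[OF assms(1) _ n0]) (use Suc.prems in auto)
  with Suc.prems(2)[of j] show ?case by simp
qed simp

lemma Chk_iff:
  "(\<forall>k. Chk n k f (pre B k)) \<longleftrightarrow> (\<forall>z. f z = wk (\<lambda>q. (bit (pfst (psnd n)) q, x q)) z (pfst n)) \<and>
     (\<forall>q<pfst n. \<forall>u. fcv (x q) u \<le> Psi (psnd (psnd n)) f u)"
proof -
  define l S n0 where "l = pfst n" and "S = pfst (psnd n)" and "n0 = psnd (psnd n)"
  let ?w = "wk (\<lambda>q. (bit S q, x q))"
  have "(\<forall>k. Chk n k f (pre B k)) \<longleftrightarrow> (\<forall>z. f z = ?w z l) \<and> (\<forall>q<l. \<forall>u. fcv (x q) u \<le> Psi n0 f u)"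
  proof
    assume *: "(\<forall>z. f z = ?w z l) \<and> (\<forall>q<l. \<forall>u. fcv (x q) u \<le> Psi n0 f u)"
    then have b: "\<And>q u. q < l \<Longrightarrow> fcv (x q) u \<le> Psi n0 f u" by blast
    have "fcv (bit (t k q)) u \<le> Psi n0 f u" if "q < l" for k q u
      using fcv_t_cases[of k q u] b[OF that, of u] by auto
    moreover have "run l S n0 k f (pre B k) z l \<noteq> 0 \<longrightarrow> run l S n0 k f (pre B k) z l = Suc (f z)" for k z
      using run_sound[of l n0 f l S k z, OF b] * by simp
    ultimately show "\<forall>k. Chk n k f (pre B k)"
      unfolding Chk_def l_def[symmetric] S_def[symmetric] n0_def[symmetric] by blast
  next
    assume C: "\<forall>k. Chk n k f (pre B k)"
    then have 1: "\<And>k q u. q < l \<Longrightarrow> u < k \<Longrightarrow> th n0 u < k \<Longrightarrow> fcv (bit (t k q)) u \<le> Psi n0 f u"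
      and 2: "\<And>k z. z < k \<Longrightarrow> run l S n0 k f (pre B k) z l \<noteq> 0 \<Longrightarrow> run l S n0 k f (pre B k) z l = Suc (f z)"
      unfolding Chk_def l_def[symmetric] S_def[symmetric] n0_def[symmetric] by blast+
    have b: "fcv (x q) u \<le> Psi n0 f u" if q: "q < l" for q u
    proof -
      \<comment> \<open>A stage at which both the first claim and its bound are visible.\<close>
      define k where "k = Suc (u + th n0 u + pe q (hh (fcv (x q) u + u)))"
      have "fcv (bit (t k q)) u = fcv (x q) u" by (rule fcv_t[of q u _ u]) (auto simp: k_def)
      with 1[OF q, of u k] show ?thesis by (simp add: k_def)
    qed
    moreover have "f z = ?w z l" for z
    proof -
      define h where "h i = th n0 (?w z i) + pe l (hh (Psi n0 f (?w z i) + ?w z i))" for i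
      \<comment> \<open>A stage beyond all thresholds met by the run on \<open>z\<close>.\<close>
      define k where "k = Suc (z + (\<Sum>i<l. h i))"
      have "th n0 (?w z i) < k \<and> pe l (hh (Psi n0 f (?w z i) + ?w z i)) < k" if "i < l" for i
        using member_le_sum[of i "{..<l}" h] that by (simp add: k_def h_def)
      then have r: "run l S n0 k f (pre B k) z l \<noteq> 0"
        by (intro run_complete b) auto
      have "Suc (f z) = run l S n0 k f (pre B k) z l" using 2[of z k] r by (simp add: k_def)
      also have "\<dots> = Suc (?w z l)" by (rule run_sound[OF b _ r]) auto
      finally show ?thesis by simp
    qed
    ultimately show "(\<forall>z. f z = ?w z l) \<and> (\<forall>q<l. \<forall>u. fcv (x q) u \<le> Psi n0 f u)" by blast
  qed
  then show ?thesis unfolding l_def S_def n0_def .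
qed

end

lemma FG_Chk: "f \<in> FG n \<longleftrightarrow> (\<exists>B. \<forall>k. Chk n k f (pre B k))"
proof
  assume "f \<in> FG n"
  then obtain x where x: "(\<forall>z. f z = wk (\<lambda>q. (bit (pfst (psnd n)) q, x q)) z (pfst n)) \<and>
     (\<forall>q<pfst n. \<forall>u. fcv (x q) u \<le> Psi (psnd (psnd n)) f u)" unfolding FG_def by blast
  interpret approx "\<lambda>i. x (pfst i) (psnd i)" x by unfold_locales simp
  from x show "\<exists>B. \<forall>k. Chk n k f (pre B k)" unfolding Chk_iff[symmetric] by blast
next
  assume "\<exists>B. \<forall>k. Chk n k f (pre B k)"
  then obtain B where *: "\<forall>k. Chk n k f (pre B k)" by blast
  interpret approx B "\<lambda>q i. B (pe q i)" by unfold_locales simp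
  from * show "f \<in> FG n" unfolding Chk_iff FG_def
    by (intro CollectI exI[of _ "\<lambda>q i. B (pe q i)"])
qed

text \<open>Compactness of the space of bits; \<open>good k T\<close> means that \<open>T\<close>
  has admissible extensions of every length.\<close>

lemma Koenig_bits:
  assumes "\<And>k. \<exists>T<2^k. \<forall>k'\<le>k. P k' (T mod 2 ^ k' :: nat)"
  shows "\<exists>B. \<forall>k. P k (pre B k)"
proof -
  define good where "good k T \<longleftrightarrow> (\<forall>n\<ge>k. \<exists>T'<2^n. T' mod 2 ^ k = T \<and> (\<forall>k'\<le>n. P k' (T' mod 2 ^ k' :: nat)))" for k T
  have "good 0 0" unfolding good_def using assms by simp
  moreover have "\<exists>T'. good (Suc k) T' \<and> T' mod 2 ^ k = T" if g: "good k T" for k T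
  proof (rule ccontr)
    assume *: "\<not> ?thesis"
    obtain T0 where "T0 mod 2 ^ k = T" using g unfolding good_def by blast
    then have T: "T < 2 ^ k" by auto
    \<comment> \<open>If neither one-bit extension is good, each fails at some length, and an
      admissible extension of \<open>T\<close> to the larger length contradicts one of them.\<close>
    have "\<forall>c. \<exists>n. Suc k \<le> n \<and> (\<forall>T'<2^n. T' mod 2 ^ Suc k = T + of_bool c * 2 ^ k \<longrightarrow> \<not> (\<forall>k'\<le>n. P k' (T' mod 2 ^ k')))"
    proof
      fix c
      have "(T + of_bool c * 2 ^ k) mod 2 ^ k = T" using T by (cases c) auto
      with * have "\<not> good (Suc k) (T + of_bool c * 2 ^ k)" by blast
      then show "\<exists>n. Suc k \<le> n \<and> (\<forall>T'<2^n. T' mod 2 ^ Suc k = T + of_bool c * 2 ^ k \<longrightarrow> \<not> (\<forall>k'\<le>n. P k' (T' mod 2 ^ k')))"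
        unfolding good_def by blast
    qed
    from choice[OF this] obtain ns where ns: "\<And>c. Suc k \<le> ns c"
      "\<And>c T'. T' < 2 ^ ns c \<Longrightarrow> T' mod 2 ^ Suc k = T + of_bool c * 2 ^ k \<Longrightarrow> \<not> (\<forall>k'\<le>ns c. P k' (T' mod 2 ^ k'))"
      by blast
    have "k \<le> max (ns True) (ns False)" using ns(1)[of True] by simp
    then obtain T' where T': "T' mod 2 ^ k = T" "\<And>k'. k' \<le> max (ns True) (ns False) \<Longrightarrow> P k' (T' mod 2 ^ k')"
      using g unfolding good_def by blast
    define m where "m = ns (bit T' k)"
    have "pre (bit T') (Suc k) = pre (bit T') k + of_bool (bit T' k) * 2 ^ k" by (rule pre_Suc)
    then have "T' mod 2 ^ Suc k = T + of_bool (bit T' k) * 2 ^ k" unfolding pre_bit T'(1) .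
    moreover have mm: "T' mod 2 ^ m mod 2 ^ k' = T' mod 2 ^ k'" if "k' \<le> m" for k'
      using that by (simp add: mod_mod_cancel le_imp_power_dvd)
    ultimately have "T' mod 2 ^ m mod 2 ^ Suc k = T + of_bool (bit T' k) * 2 ^ k"
      using ns(1)[of "bit T' k"] by (simp only: m_def)
    then have "\<not> (\<forall>k'\<le>m. P k' (T' mod 2 ^ m mod 2 ^ k'))"
      unfolding m_def by (intro ns(2)) auto
    then obtain k' where k': "k' \<le> m" "\<not> P k' (T' mod 2 ^ k')" using mm by auto
    have "m \<le> max (ns True) (ns False)" unfolding m_def by (cases "bit T' k") auto
    with T'(2)[of k'] k' show False by simp
  qed
  ultimately have "\<exists>T. \<forall>k. good k (T k) \<and> T (Suc k) mod 2 ^ k = T k"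
    by (intro dependent_nat_choice) blast+
  then obtain T where T: "\<And>k. good k (T k)" "\<And>k. T (Suc k) mod 2 ^ k = T k" by blast
  have PT: "P k (T k) \<and> T k < 2 ^ k" for k
  proof -
    from T(1)[of k] obtain T' where "T' < 2 ^ k" "T' mod 2 ^ k = T k" "P k (T' mod 2 ^ k)"
      unfolding good_def by blast
    then show ?thesis by simp
  qed
  have "pre (\<lambda>i. bit (T (Suc i)) i) k = T k" for k
  proof (induction k)
    case 0
    then show ?case using PT[of 0] by (simp add: pre_def)
  next
    case (Suc k)
    have "T (Suc k) = pre (bit (T (Suc k))) (Suc k)" using PT[of "Suc k"] by (simp add: pre_bit)
    also have "\<dots> = pre (bit (T (Suc k))) k + of_bool (bit (T (Suc k)) k) * 2 ^ k" by (rule pre_Suc)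
    also have "pre (bit (T (Suc k))) k = T k" by (simp add: pre_bit T(2))
    finally show ?case by (simp add: pre_Suc Suc)
  qed
  with PT have "\<forall>k. P k (pre (\<lambda>i. bit (T (Suc i)) i) k)" by simp
  then show ?thesis by blast
qed

definition RR :: "nat \<Rightarrow> nat list set" where
  "RR n = {s. \<exists>T<2^length s. \<forall>k\<le>length s. Chk n k ((!) s) T}"

lemma FG_RR: "FG n = {f. \<forall>k. initial_segment f k \<in> RR n}"
proof (rule Set.set_eqI)
  fix f
  have "initial_segment f k \<in> RR n \<longleftrightarrow> (\<exists>T<2^k. \<forall>k'\<le>k. Chk n k' f T)" for k
  proof -
    have "Chk n k' ((!) (initial_segment f k)) T = Chk n k' f T" if "k' \<le> k" for k' T
      by (rule Chk_cong) (use that in auto)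
    then show ?thesis by (auto simp: RR_def)
  qed
  moreover have "f \<in> FG n \<longleftrightarrow> (\<forall>k. \<exists>T<2^k. \<forall>k'\<le>k. Chk n k' f T)"
  proof
    assume "f \<in> FG n"
    then obtain B where B: "\<And>k. Chk n k f (pre B k)" unfolding FG_Chk by blast
    have "Chk n k' f (pre B k)" if "k' \<le> k" for k k'
      using B[of k'] Chk_mod[of n k' f "pre B k"] pre_mod[OF that, of B] by simp
    then show "\<forall>k. \<exists>T<2^k. \<forall>k'\<le>k. Chk n k' f T" using pre_less by blast
  next
    assume "\<forall>k. \<exists>T<2^k. \<forall>k'\<le>k. Chk n k' f T"
    then have "\<exists>B. \<forall>k. Chk n k f (pre B k)" by (intro Koenig_bits) (simp add: Chk_mod)
    then show "f \<in> FG n" unfolding FG_Chk .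
  qed
  ultimately show "f \<in> FG n \<longleftrightarrow> f \<in> {f. \<forall>k. initial_segment f k \<in> RR n}" by simp
qed

section \<open>Computability of the approximations\<close>

text \<open>The lifting lemmas pack the arguments into one environment: an unfolded definition is
  treated once for variables and then used with arbitrary computable terms.\<close>

lemma urec_lift2:
  assumes "urec g" "urec h" "urec (\<lambda>w. f (pfst w) (psnd w))"
  shows "urec (\<lambda>z. f (g z) (h z))"
  using urec_comp[OF assms(3) r_pe[OF assms(1,2)]] by simp

lemma dec_lift2:
  assumes "urec g" "urec h" "dec (\<lambda>w. f (pfst w) (psnd w))"
  shows "dec (\<lambda>z. f (g z) (h z))"
  using d_comp[OF assms(3) r_pe[OF assms(1,2)]] by simp

lemma urec_lift3:
  assumes "urec g" "urec h" "urec i" "urec (\<lambda>w. f (pfst w) (pfst (psnd w)) (psnd (psnd w)))"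
  shows "urec (\<lambda>z. f (g z) (h z) (i z))"
  using urec_comp[OF assms(4) r_pe[OF assms(1) r_pe[OF assms(2,3)]]] by simp

lemma dec_lift3:
  assumes "urec g" "urec h" "urec i" "dec (\<lambda>w. f (pfst w) (pfst (psnd w)) (psnd (psnd w)))"
  shows "dec (\<lambda>z. f (g z) (h z) (i z))"
  using d_comp[OF assms(4) r_pe[OF assms(1) r_pe[OF assms(2,3)]]] by simp

lemma urec_lift4:
  assumes "urec g" "urec h" "urec i" "urec j"
    and "urec (\<lambda>w. f (pfst w) (pfst (psnd w)) (pfst (psnd (psnd w))) (psnd (psnd (psnd w))))"
  shows "urec (\<lambda>z. f (g z) (h z) (i z) (j z))"
  using urec_comp[OF assms(5) r_pe[OF assms(1) r_pe[OF assms(2) r_pe[OF assms(3,4)]]]] by simp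

lemma dec_lift4:
  assumes "urec g" "urec h" "urec i" "urec j"
    and "dec (\<lambda>w. f (pfst w) (pfst (psnd w)) (pfst (psnd (psnd w))) (psnd (psnd (psnd w))))"
  shows "dec (\<lambda>z. f (g z) (h z) (i z) (j z))"
  using d_comp[OF assms(5) r_pe[OF assms(1) r_pe[OF assms(2) r_pe[OF assms(3,4)]]]] by simp

lemma dec_lift5:
  assumes "urec g" "urec h" "urec i" "urec j" "urec k"
    and "dec (\<lambda>w. f (pfst w) (pfst (psnd w)) (pfst (psnd (psnd w))) (pfst (psnd (psnd (psnd w))))
      (psnd (psnd (psnd (psnd w)))))"
  shows "dec (\<lambda>z. f (g z) (h z) (i z) (j z) (k z))"
  using d_comp[OF assms(6) r_pe[OF assms(1) r_pe[OF assms(2) r_pe[OF assms(3) r_pe[OF assms(4,5)]]]]] by simp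

section \<open>Computability of the grants and the generators\<close>

lemma r_hh [rec_intros]: "urec m \<Longrightarrow> urec (\<lambda>z. hh (m z))"
  unfolding hh_def by (intro rec_intros; assumption)

lemma r_ch [rec_intros]:
  "dec s \<Longrightarrow> urec v \<Longrightarrow> urec t \<Longrightarrow> urec a \<Longrightarrow> urec (\<lambda>z. ch (s z) (v z) (t z) (a z))"
  unfolding ch_def by (intro rec_intros; assumption)

lemma r_vtx [rec_intros]: "urec c \<Longrightarrow> urec (\<lambda>z. vtx (c z))"
  unfolding vtx_def by (intro rec_intros; assumption)

lemma r_lab [rec_intros]: "urec c \<Longrightarrow> urec (\<lambda>z. lab (c z))"
  unfolding lab_def by (intro rec_intros; assumption)

lemma r_aux [rec_intros]: "urec c \<Longrightarrow> urec (\<lambda>z. aux (c z))"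
  unfolding aux_def by (intro rec_intros; assumption)

lemma d_isch [rec_intros]: "urec c \<Longrightarrow> dec (\<lambda>z. isch (c z))"
  unfolding isch_def by (intro rec_intros; assumption)

lemma r_FF [rec_intros]: "urec c \<Longrightarrow> urec (\<lambda>z. FF (c z))"
  unfolding FF_def by (intro rec_intros; assumption)

lemma r_AA [rec_intros]: "urec c \<Longrightarrow> urec (\<lambda>z. AA (c z))"
proof (rule urec_comp[of AA])
  have "AA e = rec_nat 1 (\<lambda>e a. (FF ^^ Suc e) (8 * a) + 1) e" for e
    by (induction e) simp_all
  then have "AA = (\<lambda>e. rec_nat 1 (\<lambda>e a. (FF ^^ Suc e) (8 * a) + 1) e)" by blast
  moreover have "urec (\<lambda>e. rec_nat 1 (\<lambda>e a. (FF ^^ Suc e) (8 * a) + 1) e)"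
    by (intro rec_intros)
  ultimately show "urec AA" by simp
qed

lemma r_rt [rec_intros]: "urec e \<Longrightarrow> urec i \<Longrightarrow> urec (\<lambda>z. rt (e z) (i z))"
  unfolding rt_def by (intro rec_intros; assumption)

lemma r_lev [rec_intros]: "urec t \<Longrightarrow> urec k \<Longrightarrow> urec (\<lambda>z. lev (bit (t z)) (k z))"
  by (rule urec_lift2[of _ _ "\<lambda>t k. lev (bit t) k"], assumption, assumption, unfold lev_def pre_def, intro rec_intros)

lemma d_cl [rec_intros]: "urec t \<Longrightarrow> urec u \<Longrightarrow> urec a \<Longrightarrow> dec (\<lambda>z. cl (bit (t z)) (u z) (a z))"
  unfolding cl_def by (intro rec_intros; assumption)

lemma d_cand [rec_intros]:
  "urec t \<Longrightarrow> urec k \<Longrightarrow> urec u \<Longrightarrow> urec m \<Longrightarrow> dec (\<lambda>z. cand (bit (t z)) (k z) (u z) (m z))"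
  by (rule dec_lift4[of _ _ _ _ "\<lambda>t k u m. cand (bit t) k u m"], assumption+, unfold cand_def, intro rec_intros)

text \<open>A finite table of bits in the place of \<open>In\<close>, indexed as in
  \<open>PhiIn\<close>.\<close>

abbreviation TI :: "nat \<Rightarrow> nat \<Rightarrow> nat \<Rightarrow> bool" where "TI s \<equiv> \<lambda>v t. bit s (2 ^ hh v + t)"

lemma d_okc [rec_intros]: "urec s \<Longrightarrow> urec c \<Longrightarrow> dec (\<lambda>z. okc (TI (s z)) (c z))"
  unfolding okc_def by (intro rec_intros; assumption)

lemma d_nocan [rec_intros]: "urec c \<Longrightarrow> dec (\<lambda>z. nocan (c z))"
  unfolding nocan_def by (intro rec_intros; assumption)

lemma d_rp [rec_intros]:
  "urec s \<Longrightarrow> urec u \<Longrightarrow> urec m \<Longrightarrow> urec r \<Longrightarrow> dec (\<lambda>z. rp (TI (s z)) (u z) (m z) (r z))"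
  by (rule dec_lift4[of _ _ _ _ "\<lambda>s u m r. rp (TI s) u m r"], assumption+, unfold rp_def, intro rec_intros)

lemma d_coh [rec_intros]: "urec r \<Longrightarrow> urec m \<Longrightarrow> urec m' \<Longrightarrow> dec (\<lambda>z. coh (r z) (m z) (m' z))"
  by (rule dec_lift3[of _ _ _ coh], assumption+, unfold coh_def, intro rec_intros)

lemma d_prec [rec_intros]:
  "urec s \<Longrightarrow> urec t \<Longrightarrow> urec j \<Longrightarrow> urec k \<Longrightarrow> urec m \<Longrightarrow>
    dec (\<lambda>z. prec (TI (s z)) (bit (t z)) (j z) (k z) (m z))"
  by (rule dec_lift5[of _ _ _ _ _ "\<lambda>s t j k m. prec (TI s) (bit t) j k m"], assumption+,
      unfold prec_def, intro rec_intros)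

lemma r_vroot [rec_intros]: "urec c \<Longrightarrow> urec (\<lambda>z. vroot (c z))"
  by (rule urec_comp[of vroot]) (unfold vroot_def, intro rec_intros)

lemma r_sysno [rec_intros]: "urec c \<Longrightarrow> urec (\<lambda>z. sysno (c z))"
  unfolding sysno_def by (intro rec_intros; assumption)

lemma r_sty [rec_intros]: "urec t \<Longrightarrow> urec k \<Longrightarrow> urec m \<Longrightarrow> urec (\<lambda>z. sty (bit (t z)) (k z) (m z))"
  by (rule urec_lift3[of _ _ _ "\<lambda>t k m. sty (bit t) k m"], assumption+, unfold sty_def, intro rec_intros)

lemma r_cls [rec_intros]:
  "urec s \<Longrightarrow> urec t \<Longrightarrow> urec k \<Longrightarrow> urec m \<Longrightarrow> urec (\<lambda>z. cls (TI (s z)) (bit (t z)) (k z) (m z))"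
  by (rule urec_lift4[of _ _ _ _ "\<lambda>s t k m. cls (TI s) (bit t) k m"], assumption+,
      unfold cls_def, intro rec_intros)

lemma d_okb [rec_intros]: "urec t \<Longrightarrow> urec m \<Longrightarrow> dec (\<lambda>z. okb (bit (t z)) (m z))"
  unfolding okb_def by (intro rec_intros; assumption)

lemma d_GrI [rec_intros]:
  "urec s \<Longrightarrow> urec t \<Longrightarrow> urec u \<Longrightarrow> urec m \<Longrightarrow> dec (\<lambda>z. GrI (TI (s z)) (bit (t z)) (u z) (m z))"
  by (rule dec_lift4[of _ _ _ _ "\<lambda>s t u m. GrI (TI s) (bit t) u m"], assumption+,
      unfold GrI_def, intro rec_intros)

lemma d_PhiIn: "dec (\<lambda>w. PhiIn (bit (pfst w)) (psnd w))"
  by (unfold PhiIn_def, intro rec_intros)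

lemma r_tab_PhiIn [rec_intros]: "urec b \<Longrightarrow> urec (\<lambda>z. tab PhiIn (b z))"
proof (rule r_tab)
  show "dec (\<lambda>w. PhiIn (bit (pfst (psnd w))) (pfst w))"
    using d_comp[OF d_PhiIn, of "\<lambda>w. pe (pfst (psnd w)) (pfst w)"] by (simp add: rec_intros)
qed

text \<open>A grant into \<open>m\<close> queries \<open>In\<close> only at vertices below
  \<open>m\<close>, whose indices are below \<open>2 ^ hh m\<close>.\<close>

lemma Gr_tab: "Gr b u m = GrI (TI (tab PhiIn (2 ^ hh m))) b u m"
  unfolding Gr_def
proof (rule GrI_cong)
  fix v t :: nat assume "v < m" "t < 2 ^ hh v"
  from index_less[OF this, of 0] show "In v t = bit (tab PhiIn (2 ^ hh m)) (2 ^ hh v + t)"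
    by (simp add: bit_tab In_def)
qed

lemma d_Gr [rec_intros]: "urec t \<Longrightarrow> urec u \<Longrightarrow> urec m \<Longrightarrow> dec (\<lambda>z. Gr (bit (t z)) (u z) (m z))"
  unfolding Gr_tab by (intro rec_intros; assumption)

lemma cl_bit_less: "cl (bit t) u a \<Longrightarrow> a < t"
proof -
  assume "cl (bit t) u a"
  then have "bit t (2 * pe u a + 2)" by (simp add: cl_def)
  then have "2 ^ (2 * pe u a + 2) \<le> t" by (simp add: bit_iff_odd) (metis div_less dvd_0_right not_less)
  then show ?thesis using less_exp[of "2 * pe u a + 2"] pe_ge2[of a u] by linarith
qed

lemma fcv_sum: "fcv (bit t) u = (\<Sum>a<t. of_bool (cl (bit t) u a \<and> (\<forall>a'<a. \<not> cl (bit t) u a')) * Suc a)"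
proof (cases "fcv (bit t) u")
  case 0
  then show ?thesis by (simp add: fcv_eq_0)
next
  case (Suc m)
  then have m: "cl (bit t) u a \<and> (\<forall>a'<a. \<not> cl (bit t) u a') \<longleftrightarrow> a = m" for a
    using fcv_eq_Suc[of "bit t" u] by (metis nat.inject)
  then have "m < t" using cl_bit_less by blast
  moreover have "(\<Sum>a<t. of_bool (a = m) * Suc a) = (\<Sum>a<t. if a = m then Suc m else 0)"
    by (rule sum.cong) auto
  ultimately show ?thesis unfolding m Suc by simp
qed

lemma r_fcv [rec_intros]: "urec t \<Longrightarrow> urec u \<Longrightarrow> urec (\<lambda>z. fcv (bit (t z)) (u z))"
  by (rule urec_lift2[of _ _ "\<lambda>t u. fcv (bit t) u"], assumption+, unfold fcv_sum, intro rec_intros)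

lemma r_xi [rec_intros]: "urec t \<Longrightarrow> urec v \<Longrightarrow> dec s \<Longrightarrow> urec (\<lambda>z. xi (bit (t z)) (v z) (s z))"
  unfolding xi_def by (intro rec_intros; assumption)

lemma r_D [rec_intros]: "urec t \<Longrightarrow> urec v \<Longrightarrow> urec (\<lambda>z. D (bit (t z)) (v z))"
  unfolding D_def pre_bit by (intro rec_intros; assumption)

lemma r_E [rec_intros]: "urec t \<Longrightarrow> urec v \<Longrightarrow> urec (\<lambda>z. E (bit (t z)) (v z))"
  unfolding E_def pre_bit by (intro rec_intros; assumption)

text \<open>A target is a claimed value, and a number \<open>t\<close> read as a bit sequence claims
  only values below \<open>t\<close>. So the search is bounded.\<close>

lemma ex_Gr_out: "(\<exists>m. Gr (bit t) u m) \<longleftrightarrow> (\<exists>m<t. Gr (bit t) u m)"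
  using Gr_fcv fcv_eq_Suc cl_bit_less by blast

lemma ex_Gr_in: "(\<exists>u. Gr b u m) \<longleftrightarrow> (\<exists>u\<le>8*m. Gr b u m)"
  using Gr_u_le by blast

lemma d_ex_Gr_out [rec_intros]: "urec t \<Longrightarrow> urec u \<Longrightarrow> dec (\<lambda>z. \<exists>m. Gr (bit (t z)) (u z) m)"
  by (rule dec_lift2[of _ _ "\<lambda>t u. \<exists>m. Gr (bit t) u m"], assumption+, subst ex_Gr_out, intro rec_intros)

lemma d_ex_Gr_in [rec_intros]: "urec t \<Longrightarrow> urec m \<Longrightarrow> dec (\<lambda>z. \<exists>u. Gr (bit (t z)) u (m z))"
  by (rule dec_lift2[of _ _ "\<lambda>t m. \<exists>u. Gr (bit t) u m"], assumption+, subst ex_Gr_in, intro rec_intros)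

lemma d_dn [rec_intros]: "urec t \<Longrightarrow> urec v \<Longrightarrow> dec (\<lambda>z. dn (bit (t z)) (v z))"
proof (rule dec_lift2[of _ _ "\<lambda>t v. dn (bit t) v"])
  show "dec (\<lambda>w. dn (bit (pfst w)) (psnd w))"
    unfolding dn_def by (rule d_cov) (intro rec_intros, unfold PhiDn_def, intro rec_intros)
qed

lemma d_att [rec_intros]: "urec t \<Longrightarrow> urec v \<Longrightarrow> dec (\<lambda>z. att (bit (t z)) (v z))"
  unfolding att_def by (intro rec_intros; assumption)

text \<open>The target of a grant is the first claim, which turns the definite description into a
  computable term.\<close>

lemma chi_alt: "chi b z = (if \<exists>m. Gr b z m then fcv b z - 1 else if dn b z then vtx z else D b z)"
proof (cases "\<exists>m. Gr b z m")
  case True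
  then obtain m where "Gr b z m" ..
  with chi_Gr[OF this] Gr_fcv[OF this] show ?thesis by auto
next
  case False
  then show ?thesis by (simp add: chi_def)
qed

lemma r_chi [rec_intros]: "urec t \<Longrightarrow> urec v \<Longrightarrow> urec (\<lambda>z. chi (bit (t z)) (v z))"
  unfolding chi_alt by (intro rec_intros; assumption)

lemma ich_alt: "ich b w = (if \<exists>u. Gr b u w then \<Sum>u<Suc (8 * w). of_bool (Gr b u w) * u
  else if D b (vtx w) = w \<and> att b (vtx w) then vtx w else E b w)"
proof (cases "\<exists>u. Gr b u w")
  case True
  then obtain u where u: "Gr b u w" ..
  then have "Gr b u' w \<longleftrightarrow> u' = u" for u' using Gr_in_unique by blast
  moreover have "u < Suc (8 * w)" using Gr_u_le[OF u] by simp
  ultimately show ?thesis using ich_Gr[OF u]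
    by (simp add: of_bool_def if_distrib[of "\<lambda>x. x * _"] del: sum.lessThan_Suc cong: if_cong)
next
  case False
  then show ?thesis by (simp add: ich_def)
qed

lemma r_ich [rec_intros]: "urec t \<Longrightarrow> urec v \<Longrightarrow> urec (\<lambda>z. ich (bit (t z)) (v z))"
  by (rule urec_lift2[of _ _ "\<lambda>t v. ich (bit t) v"], assumption+, unfold ich_alt, intro rec_intros)

lemma r_st [rec_intros]: "dec s \<Longrightarrow> urec t \<Longrightarrow> urec v \<Longrightarrow> urec (\<lambda>z. st (s z, bit (t z)) (v z))"
  unfolding st_def fst_conv snd_conv by (intro rec_intros; assumption)

lemma r_vis [rec_intros]: "urec k \<Longrightarrow> urec T \<Longrightarrow> urec q \<Longrightarrow> urec (\<lambda>z. vis (k z) (T z) (q z))"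
  by (rule urec_lift3[of _ _ _ vis], assumption+, unfold vis_def pre_def, intro rec_intros)

lemma r_th [rec_intros]: "urec n \<Longrightarrow> urec u \<Longrightarrow> urec (\<lambda>z. th (n z) (u z))"
  by (rule urec_lift2[of _ _ th], assumption+, unfold th_def, intro rec_intros)

text \<open>Operations on list codes: \<open>list_encode\<close> gives 0 for the empty list and
  otherwise the successor of the pair of the head and the code of the tail.\<close>

definition tlc :: "nat \<Rightarrow> nat \<Rightarrow> nat" where "tlc c i = ((\<lambda>c. psnd (c - 1)) ^^ i) c"
definition nthc :: "nat \<Rightarrow> nat \<Rightarrow> nat" where "nthc c i = pfst (tlc c i - 1)"
definition lenc :: "nat \<Rightarrow> nat" where "lenc c = (\<Sum>i<c. of_bool (tlc c i \<noteq> 0))"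

lemma r_tlc [rec_intros]: "urec c \<Longrightarrow> urec i \<Longrightarrow> urec (\<lambda>z. tlc (c z) (i z))"
  by (rule urec_lift2[of _ _ tlc], assumption+, unfold tlc_def, intro rec_intros)

lemma r_nthc [rec_intros]: "urec c \<Longrightarrow> urec i \<Longrightarrow> urec (\<lambda>z. nthc (c z) (i z))"
  unfolding nthc_def by (intro rec_intros; assumption)

lemma r_lenc [rec_intros]: "urec c \<Longrightarrow> urec (\<lambda>z. lenc (c z))"
  by (rule urec_comp[of lenc], unfold lenc_def, intro rec_intros)

lemma tlc_encode: "tlc (list_encode s) i = list_encode (drop i s)"
proof (induction i)
  case (Suc i)
  have "psnd (list_encode r - 1) = list_encode (tl r)" for r
    using psnd_le[of 0] by (cases r) (simp_all add: psnd_def)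
  with Suc show ?case by (simp add: tlc_def drop_Suc tl_drop)
qed (simp add: tlc_def)

lemma nthc_encode: "i < length s \<Longrightarrow> nthc (list_encode s) i = s ! i"
  unfolding nthc_def tlc_encode by (subst Cons_nth_drop_Suc[symmetric]) (simp_all add: pfst_def)

lemma lenc_encode: "lenc (list_encode s) = length s"
proof -
  have "length s \<le> list_encode s"
  proof (induction s)
    case (Cons a s)
    then show ?case using le_prod_encode_2[of "list_encode s" a] by simp
  qed simp
  moreover have "list_encode r = 0 \<longleftrightarrow> r = []" for r by (cases r) simp_all
  then have "tlc (list_encode s) i \<noteq> 0 \<longleftrightarrow> i < length s" for i
    by (simp add: tlc_encode not_le)
  ultimately show ?thesis
    unfolding lenc_def by (simp add: of_bool_def sum.If_cases Int_def Collect_conj_eq[symmetric])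
      (metis (no_types, lifting) Collect_cong card_Collect_less_nat less_le_trans)
qed

lemma r_Psi [rec_intros]: "urec n \<Longrightarrow> urec c \<Longrightarrow> urec u \<Longrightarrow> urec (\<lambda>z. Psi (n z) (nthc (c z)) (u z))"
  by (rule urec_lift3[of _ _ _ "\<lambda>n c u. Psi n (nthc c) u"], assumption+,
      unfold Psi_def lessThan_Suc_atMost[symmetric], intro rec_intros)

lemma d_Chk [rec_intros]:
  "urec n \<Longrightarrow> urec k \<Longrightarrow> urec c \<Longrightarrow> urec T \<Longrightarrow> dec (\<lambda>z. Chk (n z) (k z) (nthc (c z)) (T z))"
  by (rule dec_lift4[of _ _ _ _ "\<lambda>n k c T. Chk n k (nthc c) T"], assumption+,
      unfold Chk_def run_def, intro rec_intros)

section \<open>Decidability of the trees and the two pointclasses\<close>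

definition QQ :: "nat \<Rightarrow> nat \<Rightarrow> bool" where
  "QQ n c \<longleftrightarrow> (\<exists>T<2^lenc c. \<forall>k\<le>lenc c. Chk n k (nthc c) T)"

lemma QQ_encode: "QQ n (list_encode s) \<longleftrightarrow> s \<in> RR n"
proof -
  have "Chk n k (nthc (list_encode s)) T = Chk n k ((!) s) T" if "k \<le> length s" for k T
    by (rule Chk_cong) (use that nthc_encode in auto)
  then show ?thesis by (auto simp: QQ_def RR_def lenc_encode)
qed

lemma d_QQ [rec_intros]: "urec n \<Longrightarrow> urec c \<Longrightarrow> dec (\<lambda>z. QQ (n z) (c z))"
  by (rule dec_lift2[of _ _ QQ], assumption+, unfold QQ_def, intro rec_intros)

lemma computable_setI: "dec (\<lambda>x. x \<in> A) \<Longrightarrow> computable_set A"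
proof -
  assume "dec (\<lambda>x. x \<in> A)"
  then obtain p where p: "\<And>xs. length xs = 1 \<Longrightarrow> computes p xs (of_bool (xs ! 0 \<in> A))"
    unfolding dec_def urec_def rn_def by blast
  have "computes p [x] (if x \<in> A then 1 else 0)" for x
    using p[of "[x]"] by (simp add: of_bool_def)
  then show ?thesis unfolding computable_set_def by blast
qed

lemma computable_RR: "computable_seqs (RR n)"
  unfolding computable_seqs_def
proof (rule computable_setI, rule dec_cong)
  show "dec (QQ n)" using d_QQ[OF r_const[of n] r_id] by simp
  show "QQ n c \<longleftrightarrow> c \<in> list_encode ` RR n" for c
    using QQ_encode[of n "list_decode c"] by (metis image_iff list_decode_inverse list_encode_inverse)
qed

lemma computable_RR_uniform: "computable_nat_seqs {(n, s). s \<in> RR n}"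
  unfolding computable_nat_seqs_def
proof (rule computable_setI, rule dec_cong)
  show "dec (\<lambda>x. QQ (pfst x) (psnd x))" by (intro rec_intros)
  show "QQ (pfst x) (psnd x) \<longleftrightarrow> x \<in> (\<lambda>(n, s). prod_encode (n, list_encode s)) ` {(n, s). s \<in> RR n}" for x
  proof -
    have "x = prod_encode (pfst x, list_encode (list_decode (psnd x)))"
      using pe_collapse[of x] by (simp add: pe_def list_decode_inverse)
    moreover have "QQ (pfst x) (psnd x) \<longleftrightarrow> list_decode (psnd x) \<in> RR (pfst x)"
      using QQ_encode[of "pfst x" "list_decode (psnd x)"] by (simp add: list_decode_inverse)
    moreover have "QQ (pfst x) (psnd x)" if "x = prod_encode (n, list_encode s)" "s \<in> RR n" for n s
      using that QQ_encode[of n s] pfst_pe[of n "list_encode s"] psnd_pe[of n "list_encode s"] by (simp add: pe_def)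
    ultimately show ?thesis by (force simp: image_iff)
  qed
qed

lemma lightface_Pi01_XX: "lightface_Pi01 XX"
  unfolding lightface_Pi01_def XX_FG using computable_RR FG_RR by blast

lemma lightface_Sigma02_generate: "lightface_Sigma02 (generate S_infinity XX)"
  unfolding lightface_Sigma02_def
proof (intro exI conjI)
  show "computable_nat_seqs {(n, s). s \<in> RR n}" by (rule computable_RR_uniform)
  show "generate S_infinity XX = {f. \<exists>n. \<forall>k. (n, initial_segment f k) \<in> {(n, s). s \<in> RR n}}"
    unfolding generate_FG FG_RR by auto
qed

theorem theorem0p1:
  shows "\<exists>X. X \<subseteq> carrier S_infinity \<and> lightface_Pi01 X \<and> freely_generates S_infinity X \<and>
    lightface_Sigma02 (generate S_infinity X) \<and>
    maximal_cofinitary_group (generate S_infinity X)"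
  using XX_carrier lightface_Pi01_XX freely_generates_XX lightface_Sigma02_generate
    maximal_cofinitary_group_XX by blast

end
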